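(* The Fibonacci-Lyndon monomial algebra $F_6$, with its $\mathbb Z^2$-grading, does not deform to a bigraded ($\mathbb Z^2$-graded) Artin-Schelter regular algebra.
   Context: $K$ is a field. The Fibonacci-Lyndon words in letters $x<y$ are defined by $f_0=x$, $f_1=y$ and, for $k\ge1$, $f_{2k}=f_{2k-2}f_{2k-1}$, $f_{2k+1}=f_{2k}f_{2k-1}$. Let $U=\{f_{2k-2}f_{2k}\mid k\ge1\}\cup\{f_{2k+1}f_{2k-1}\mid k\ge 1\}$, and let $W_6$ be the set of minimal elements of $U\cup\{f_6\}$ with respect to the subword (contiguous factor) relation; explicitly $W_6=\{f_0f_2,\ f_3f_1,\ f_2f_4,\ f_5f_3,\ f_6\}$. Then $F_6=K\langle x,y\rangle/(W_6)$, which is $\mathbb Z^2$-graded with $\deg x=(1,0)$, $\deg y=(0,1)$. A connected graded algebra $A=k\oplus A_1\oplus A_2\oplus\cdots$ over a field $k$ is Artin-Schelter regular of dimension $d$ if: $A$ has finite global dimension $d$; $A$ has finite Gelfand-Kirillov dimension; and $A$ is Gorenstein, i.e. $\mathrm{Ext}^i_A(k,A)=0$ for $i\ne d$ and $\mathrm{Ext}^d_A(k,A)\cong k(l)$ for some shift $l$. It is a bigraded Artin-Schelter regular algebra if moreover it is $\mathbb Z^2$-graded (as a quotient of the free algebra on $x,y$ by a bihomogeneous ideal, $\deg x=(1,0)$, $\deg y=(0,1)$), with the grading above being the total degree. Deformation is understood keeping the multigrading: a deformation of $F_6$ to a bigraded Artin-Schelter regular algebra is a $\mathbb Z^2$-graded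 algebra $\mathcal A=K[[t]]\langle x,y\rangle/\mathcal I$ ($t$ central of degree $(0,0)$, $\mathcal I$ a bihomogeneous two-sided ideal), each of whose bigraded components is a free $K[[t]]$-module of finite rank, such that $\mathcal A/t\mathcal A= F_6$ (i.e. $\mathcal I$ reduces modulo $t$ to $(W_6)$) and the general fibre $\mathcal A\otimes_{K[[t]]}K((t))$ is a bigraded Artin-Schelter regular algebra over $K((t))$. *)

theory Defs
  imports
    "HOL-Algebra.Algebra"
    "HOL-Algebra.Algebraic_Closure_Type"
    "HOL-Computational_Algebra.Formal_Laurent_Series"
    "HOL-Library.Poly_Mapping"
    "HOL-Library.Sublist"
    "HOL-Library.Extended_Real"
    "HOL-Library.Extended_Nat"
begin

section \<open>Modules over noncommutative rings\<close>

text \<open>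
  The locale \<open>module\<close> of \<open>HOL-Algebra\<close> requires a commutative ring of scalars, so only its record type is
  reused.  The fields \<^const>\<open>monoid.mult\<close> and \<^const>\<open>monoid.one\<close> of a module record are irrelevant.
  Right modules over \<open>A\<close> are left modules over \<open>opposite A\<close>.
\<close>

locale left_module = A: ring A + M: abelian_group M
    for A :: "('a, 'r) ring_scheme" (structure) and M :: "('a, 'm, 's) module_scheme" (structure) +
  assumes smult_closed: "\<lbrakk>a \<in> carrier A; x \<in> carrier M\<rbrakk> \<Longrightarrow> a \<odot>\<^bsub>M\<^esub> x \<in> carrier M"
    and smult_l_distr: "\<lbrakk>a \<in> carrier A; b \<in> carrier A; x \<in> carrier M\<rbrakk>
      \<Longrightarrow> (a \<oplus>\<^bsub>A\<^esub> b) \<odot>\<^bsub>M\<^esub> x = a \<odot>\<^bsub>M\<^esub> x \<oplus>\<^bsub>M\<^esub> b \<odot>\<^bsub>M\<^esub> x"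
    and smult_r_distr: "\<lbrakk>a \<in> carrier A; x \<in> carrier M; y \<in> carrier M\<rbrakk>
      \<Longrightarrow> a \<odot>\<^bsub>M\<^esub> (x \<oplus>\<^bsub>M\<^esub> y) = a \<odot>\<^bsub>M\<^esub> x \<oplus>\<^bsub>M\<^esub> a \<odot>\<^bsub>M\<^esub> y"
    and smult_assoc: "\<lbrakk>a \<in> carrier A; b \<in> carrier A; x \<in> carrier M\<rbrakk>
      \<Longrightarrow> (a \<otimes>\<^bsub>A\<^esub> b) \<odot>\<^bsub>M\<^esub> x = a \<odot>\<^bsub>M\<^esub> (b \<odot>\<^bsub>M\<^esub> x)"
    and smult_one: "x \<in> carrier M \<Longrightarrow> \<one>\<^bsub>A\<^esub> \<odot>\<^bsub>M\<^esub> x = x"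

definition opposite :: "'a ring \<Rightarrow> 'a ring" where
  "opposite A = A\<lparr>mult := \<lambda>x y. y \<otimes>\<^bsub>A\<^esub> x\<rparr>"

definition module_of ::
    "'m set \<Rightarrow> 'm \<Rightarrow> ('m \<Rightarrow> 'm \<Rightarrow> 'm) \<Rightarrow> ('a \<Rightarrow> 'm \<Rightarrow> 'm) \<Rightarrow> ('a, 'm) module" where
  "module_of C z pl sm =
     \<lparr>carrier = C, monoid.mult = undefined, one = undefined, ring.zero = z, add = pl, module.smult = sm\<rparr>"

definition regular_module :: "'a ring \<Rightarrow> ('a, 'a) module" where
  "regular_module A = module_of (carrier A) \<zero>\<^bsub>A\<^esub> (add A) (monoid.mult A)"

definition quotient_module :: "('a, 'm) module \<Rightarrow> 'm set \<Rightarrow> ('a, 'm set) module" where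
  "quotient_module M N = module_of (a_rcosets\<^bsub>M\<^esub> N) N (set_add M)
     (\<lambda>a U. \<Union>x\<in>U. N +>\<^bsub>M\<^esub> (a \<odot>\<^bsub>M\<^esub> x))"

definition free_module :: "'a ring \<Rightarrow> 'b set \<Rightarrow> ('a, 'b \<Rightarrow> 'a) module" where
  "free_module A B = module_of
     {f \<in> B \<rightarrow>\<^sub>E carrier A. finite {b \<in> B. f b \<noteq> \<zero>\<^bsub>A\<^esub>}}
     (\<lambda>b\<in>B. \<zero>\<^bsub>A\<^esub>) (\<lambda>f g. \<lambda>b\<in>B. f b \<oplus>\<^bsub>A\<^esub> g b) (\<lambda>a f. \<lambda>b\<in>B. a \<otimes>\<^bsub>A\<^esub> f b)"

definition lmodule_hom :: "'a ring \<Rightarrow> ('a, 'm) module \<Rightarrow> ('a, 'n) module \<Rightarrow> ('m \<Rightarrow> 'n) set" where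
  "lmodule_hom A M N = {f \<in> carrier M \<rightarrow>\<^sub>E carrier N.
     (\<forall>x\<in>carrier M. \<forall>y\<in>carrier M. f (x \<oplus>\<^bsub>M\<^esub> y) = f x \<oplus>\<^bsub>N\<^esub> f y) \<and>
     (\<forall>a\<in>carrier A. \<forall>x\<in>carrier M. f (a \<odot>\<^bsub>M\<^esub> x) = a \<odot>\<^bsub>N\<^esub> f x)}"

text \<open>
  Projective means direct summand of a free module.  Index sets \<open>B\<close> inside the type of \<open>P\<close> suffice,
  since a projective \<open>P\<close> is a summand of the free module on \<open>carrier P\<close>.
\<close>

definition projective_module :: "'a ring \<Rightarrow> ('a, 'm) module \<Rightarrow> bool" where
  "projective_module A P \<longleftrightarrow> left_module A P \<and>
     (\<exists>B :: 'm set. \<exists>s \<in> lmodule_hom A P (free_module A B). \<exists>r \<in> lmodule_hom A (free_module A B) P.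
        \<forall>x\<in>carrier P. r (s x) = x)"

definition projective_resolution ::
    "'a ring \<Rightarrow> ('a, 'n) module \<Rightarrow> (nat \<Rightarrow> ('a, 'm) module) \<Rightarrow> (nat \<Rightarrow> 'm \<Rightarrow> 'm) \<Rightarrow> ('m \<Rightarrow> 'n) \<Rightarrow> bool"
  where
  "projective_resolution A M P \<delta> \<epsilon> \<longleftrightarrow>
     (\<forall>i. projective_module A (P i)) \<and>
     (\<forall>i. \<delta> i \<in> lmodule_hom A (P (Suc i)) (P i)) \<and>
     \<epsilon> \<in> lmodule_hom A (P 0) M \<and>
     \<epsilon> ` carrier (P 0) = carrier M \<and>
     \<delta> 0 ` carrier (P 1) = {x \<in> carrier (P 0). \<epsilon> x = \<zero>\<^bsub>M\<^esub>} \<and>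
     (\<forall>i. \<delta> (Suc i) ` carrier (P (Suc (Suc i))) =
          {x \<in> carrier (P (Suc i)). \<delta> i x = \<zero>\<^bsub>P i\<^esub>})"

text \<open>
  Modules are taken with carriers in a type \<open>'m\<close>.  If \<open>'m\<close> is infinite and has at least as many
  elements as \<open>A\<close>, this is no restriction: every module in \<open>'m\<close> has a free resolution in \<open>'m\<close>, and
  by Auslander's theorem the global dimension is already attained on cyclic modules.
\<close>

definition proj_dim :: "'a ring \<Rightarrow> ('a, 'm) module \<Rightarrow> enat" where
  "proj_dim A M = Inf {enat n |n. \<exists>(P :: nat \<Rightarrow> ('a, 'm) module) \<delta> \<epsilon>.
     projective_resolution A M P \<delta> \<epsilon> \<and> (\<forall>i>n. carrier (P i) = {\<zero>\<^bsub>P i\<^esub>})}"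

definition global_dim :: "'m itself \<Rightarrow> 'a ring \<Rightarrow> enat" where
  "global_dim _ A = (SUP M \<in> {M :: ('a, 'm) module. left_module A M}. proj_dim A M)"


section \<open>Graded rings and modules\<close>

definition direct_sum_grading :: "('m, 'r) ring_scheme \<Rightarrow> (int \<Rightarrow> 'm set) \<Rightarrow> bool" where
  "direct_sum_grading M g \<longleftrightarrow> (\<forall>i. additive_subgroup (g i) M) \<and>
     (\<forall>m\<in>carrier M. \<exists>!c. (\<forall>i. c i \<in> g i) \<and> finite {i. c i \<noteq> \<zero>\<^bsub>M\<^esub>} \<and>
        m = (\<Oplus>\<^bsub>M\<^esub>i\<in>{i. c i \<noteq> \<zero>\<^bsub>M\<^esub>}. c i))"

text \<open>The base field \<open>k\<close> of a connected graded algebra is its component \<open>G 0\<close>.\<close>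

definition connected_graded_algebra :: "'a ring \<Rightarrow> (int \<Rightarrow> 'a set) \<Rightarrow> bool" where
  "connected_graded_algebra A G \<longleftrightarrow> ring A \<and> direct_sum_grading A G \<and>
     (\<forall>i j. \<forall>a\<in>G i. \<forall>b\<in>G j. a \<otimes>\<^bsub>A\<^esub> b \<in> G (i + j)) \<and>
     (\<forall>i<0. G i = {\<zero>\<^bsub>A\<^esub>}) \<and>
     subfield (G 0) A \<and> (\<forall>c\<in>G 0. \<forall>a\<in>carrier A. c \<otimes>\<^bsub>A\<^esub> a = a \<otimes>\<^bsub>A\<^esub> c)"

definition graded_module ::
    "'a ring \<Rightarrow> (int \<Rightarrow> 'a set) \<Rightarrow> ('a, 'm) module \<Rightarrow> (int \<Rightarrow> 'm set) \<Rightarrow> bool" where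
  "graded_module A G M g \<longleftrightarrow> left_module A M \<and> direct_sum_grading M g \<and>
     (\<forall>i j. \<forall>a\<in>G i. \<forall>x\<in>g j. a \<odot>\<^bsub>M\<^esub> x \<in> g (i + j))"

definition graded_hom :: "int \<Rightarrow> 'a ring \<Rightarrow> ('a, 'm) module \<Rightarrow> (int \<Rightarrow> 'm set) \<Rightarrow>
    ('a, 'n) module \<Rightarrow> (int \<Rightarrow> 'n set) \<Rightarrow> ('m \<Rightarrow> 'n) set" where
  "graded_hom j A M g N h = {f \<in> lmodule_hom A M N. \<forall>i. f ` g i \<subseteq> h (i + j)}"

definition graded_iso :: "'a ring \<Rightarrow> ('a, 'm) module \<Rightarrow> (int \<Rightarrow> 'm set) \<Rightarrow>
    ('a, 'n) module \<Rightarrow> (int \<Rightarrow> 'n set) \<Rightarrow> bool" where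
  "graded_iso A M g N h \<longleftrightarrow> (\<exists>f \<in> lmodule_hom A M N.
     bij_betw f (carrier M) (carrier N) \<and> (\<forall>i. f ` g i = h i))"

definition quotient_grading ::
    "('a, 'm) module \<Rightarrow> 'm set \<Rightarrow> (int \<Rightarrow> 'm set) \<Rightarrow> int \<Rightarrow> 'm set set" where
  "quotient_grading M N g i = (\<lambda>x. N +>\<^bsub>M\<^esub> x) ` g i"

definition shift :: "(int \<Rightarrow> 'm set) \<Rightarrow> int \<Rightarrow> int \<Rightarrow> 'm set" where
  "shift g l i = g (l + i)"

definition augmentation_ideal :: "'a ring \<Rightarrow> (int \<Rightarrow> 'a set) \<Rightarrow> 'a set" where
  "augmentation_ideal A G = generate (add_monoid A) (\<Union>i\<in>{0<..}. G i)"

definition trivial_module :: "'a ring \<Rightarrow> (int \<Rightarrow> 'a set) \<Rightarrow> ('a, 'a set) module" where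
  "trivial_module A G = quotient_module (regular_module A) (augmentation_ideal A G)"

definition trivial_grading :: "'a ring \<Rightarrow> (int \<Rightarrow> 'a set) \<Rightarrow> int \<Rightarrow> 'a set set" where
  "trivial_grading A G = quotient_grading (regular_module A) (augmentation_ideal A G) G"

definition graded_projective_resolution ::
    "'a ring \<Rightarrow> (int \<Rightarrow> 'a set) \<Rightarrow> ('a, 'n) module \<Rightarrow> (int \<Rightarrow> 'n set) \<Rightarrow>
     (nat \<Rightarrow> ('a, 'm) module) \<Rightarrow> (nat \<Rightarrow> int \<Rightarrow> 'm set) \<Rightarrow> (nat \<Rightarrow> 'm \<Rightarrow> 'm) \<Rightarrow> ('m \<Rightarrow> 'n) \<Rightarrow> bool"
  where
  "graded_projective_resolution A G M h P g \<delta> \<epsilon> \<longleftrightarrow> projective_resolution A M P \<delta> \<epsilon> \<and>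
     (\<forall>i. graded_module A G (P i) (g i)) \<and>
     (\<forall>i. \<delta> i \<in> graded_hom 0 A (P (Suc i)) (g (Suc i)) (P i) (g i)) \<and>
     \<epsilon> \<in> graded_hom 0 A (P 0) (g 0) M h"


section \<open>The graded modules Ext(M, A)\<close>

definition dual_module :: "'a ring \<Rightarrow> ('a, 'm) module \<Rightarrow> ('a, 'm \<Rightarrow> 'a) module" where
  "dual_module A M = module_of (lmodule_hom A M (regular_module A))
     (\<lambda>x\<in>carrier M. \<zero>\<^bsub>A\<^esub>) (\<lambda>\<phi> \<psi>. \<lambda>x\<in>carrier M. \<phi> x \<oplus>\<^bsub>A\<^esub> \<psi> x)
     (\<lambda>a \<phi>. \<lambda>x\<in>carrier M. \<phi> x \<otimes>\<^bsub>A\<^esub> a)"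

text \<open>
  The right module of all finite sums of homogeneous homomorphisms \<open>M \<rightarrow> A\<close>; the component of degree
  \<open>j\<close> consists of the homomorphisms of degree \<open>j\<close>, i.e. the degree-preserving maps \<open>M \<rightarrow> A(j)\<close>.
\<close>

definition dual_component ::
    "'a ring \<Rightarrow> (int \<Rightarrow> 'a set) \<Rightarrow> ('a, 'm) module \<Rightarrow> (int \<Rightarrow> 'm set) \<Rightarrow> int \<Rightarrow> ('m \<Rightarrow> 'a) set" where
  "dual_component A G M g j = graded_hom j A M g (regular_module A) G"

definition graded_dual ::
    "'a ring \<Rightarrow> (int \<Rightarrow> 'a set) \<Rightarrow> ('a, 'm) module \<Rightarrow> (int \<Rightarrow> 'm set) \<Rightarrow> ('a, 'm \<Rightarrow> 'a) module" where
  "graded_dual A G M g = (dual_module A M)\<lparr>carrier :=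
     generate (add_monoid (dual_module A M)) (\<Union>j. dual_component A G M g j)\<rparr>"

text \<open>
  Ext is the cohomology of the dual of a graded projective resolution \<open>(P, g, \<delta>)\<close>; up to
  isomorphism of graded right modules it does not depend on the resolution.
\<close>

context
  fixes A :: "'a ring" and G :: "int \<Rightarrow> 'a set"
    and P :: "nat \<Rightarrow> ('a, 'm) module" and g :: "nat \<Rightarrow> int \<Rightarrow> 'm set" and \<delta> :: "nat \<Rightarrow> 'm \<Rightarrow> 'm"
begin

definition cocycles :: "nat \<Rightarrow> ('m \<Rightarrow> 'a) set" where
  "cocycles i = {\<phi> \<in> carrier (graded_dual A G (P i) (g i)).
     \<forall>x\<in>carrier (P (Suc i)). \<phi> (\<delta> i x) = \<zero>\<^bsub>A\<^esub>}"

definition coboundaries :: "nat \<Rightarrow> ('m \<Rightarrow> 'a) set" where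
  "coboundaries i = (case i of
       0 \<Rightarrow> {\<zero>\<^bsub>graded_dual A G (P 0) (g 0)\<^esub>}
     | Suc j \<Rightarrow> (\<lambda>\<phi>. \<lambda>x\<in>carrier (P (Suc j)). \<phi> (\<delta> j x)) ` carrier (graded_dual A G (P j) (g j)))"

definition Ext :: "nat \<Rightarrow> ('a, ('m \<Rightarrow> 'a) set) module" where
  "Ext i = quotient_module ((graded_dual A G (P i) (g i))\<lparr>carrier := cocycles i\<rparr>) (coboundaries i)"

definition Ext_grading :: "nat \<Rightarrow> int \<Rightarrow> ('m \<Rightarrow> 'a) set set" where
  "Ext_grading i = quotient_grading ((graded_dual A G (P i) (g i))\<lparr>carrier := cocycles i\<rparr>)
     (coboundaries i) (\<lambda>j. cocycles i \<inter> dual_component A G (P i) (g i) j)"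

end


section \<open>Artin-Schelter regular algebras\<close>

definition growth_space :: "'a ring \<Rightarrow> 'a set \<Rightarrow> 'a set \<Rightarrow> nat \<Rightarrow> 'a set" where
  "growth_space A K S n = generate (add_monoid A)
     {c \<otimes>\<^bsub>A\<^esub> foldr (monoid.mult A) ws \<one>\<^bsub>A\<^esub> |c ws. c \<in> K \<and> set ws \<subseteq> S \<and> length ws \<le> n}"

definition GK_dim :: "'a ring \<Rightarrow> 'a set \<Rightarrow> ereal" where
  "GK_dim A K = (SUP S \<in> {S. finite S \<and> S \<subseteq> carrier A}.
     limsup (\<lambda>n. ereal (log (real n) (real (ring.dim A K (growth_space A K S n))))))"

text \<open>
  The type \<open>'a list set\<close> is infinite and at least as large as \<open>A\<close>, so it can serve as the universe
  of modules.  Resolutions and global dimension are those of left modules; for connected graded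
  algebras the left and right versions of regularity agree.
\<close>

definition AS_Gorenstein :: "'a ring \<Rightarrow> (int \<Rightarrow> 'a set) \<Rightarrow> nat \<Rightarrow> bool" where
  "AS_Gorenstein A G d \<longleftrightarrow>
     (\<exists>(P :: nat \<Rightarrow> ('a, 'a list set) module) g \<delta> \<epsilon>.
        graded_projective_resolution A G (trivial_module A G) (trivial_grading A G) P g \<delta> \<epsilon> \<and>
        (\<forall>i. i \<noteq> d \<longrightarrow> carrier (Ext A G P g \<delta> i) = {\<zero>\<^bsub>Ext A G P g \<delta> i\<^esub>}) \<and>
        (\<exists>l. graded_iso (opposite A) (Ext A G P g \<delta> d) (Ext_grading A G P g \<delta> d)
           (trivial_module (opposite A) G) (shift (trivial_grading (opposite A) G) l)))"

definition AS_regular :: "'a ring \<Rightarrow> (int \<Rightarrow> 'a set) \<Rightarrow> nat \<Rightarrow> bool" where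
  "AS_regular A G d \<longleftrightarrow> connected_graded_algebra A G \<and>
     global_dim TYPE('a list set) A = enat d \<and>
     GK_dim A (G 0) < \<infinity> \<and>
     AS_Gorenstein A G d"


section \<open>Free algebras on two letters and their bigraded quotients\<close>

datatype letter = Lx | Ly

instantiation list :: (type) monoid_add
begin

definition zero_list :: "'a list" where "zero_list = []"

definition plus_list :: "'a list \<Rightarrow> 'a list \<Rightarrow> 'a list" where "plus_list = (@)"

instance by standard (simp_all add: zero_list_def plus_list_def)

end

text \<open>
  Words form a monoid under concatenation, so the convolution product of finitely supported
  functions is the product of the free algebra.
\<close>

type_synonym 'k free_alg = "letter list \<Rightarrow>\<^sub>0 'k"

abbreviation free_ring :: "('k::comm_ring_1) free_alg ring" where
  "free_ring \<equiv> ring_of_type_algebra"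

lemma ring_ring_of_type_algebra: "ring (ring_of_type_algebra :: ('a::ring_1) ring)"
proof -
  have "\<exists>y. y + x = 0" for x :: 'a
    by (rule exI[of _ "- x"]) simp
  moreover have "\<exists>y. x + y = 0" for x :: 'a
    by (rule exI[of _ "- x"]) simp
  ultimately show ?thesis
    unfolding ring_of_type_algebra_def
    by unfold_locales (auto simp: algebra_simps Units_def)
qed

definition bidegree :: "letter list \<Rightarrow> nat \<times> nat" where
  "bidegree w = (count_list w Lx, count_list w Ly)"

definition bihomogeneous :: "nat \<times> nat \<Rightarrow> ('k::comm_ring_1) free_alg set" where
  "bihomogeneous b = {p. \<forall>w\<in>Poly_Mapping.keys p. bidegree w = b}"

definition bihomogeneous_ideal :: "('k::comm_ring_1) free_alg set \<Rightarrow> bool" where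
  "bihomogeneous_ideal I \<longleftrightarrow> ideal I free_ring \<and>
     I = Idl\<^bsub>free_ring\<^esub> (\<Union>b. I \<inter> bihomogeneous b)"

definition bigraded_component ::
    "('k::comm_ring_1) free_alg set \<Rightarrow> nat \<times> nat \<Rightarrow> ('k, 'k free_alg set) module" where
  "bigraded_component I b = module_of
     ((\<lambda>p. I +>\<^bsub>free_ring\<^esub> p) ` bihomogeneous b) \<zero>\<^bsub>free_ring Quot I\<^esub> (add (free_ring Quot I))
     (\<lambda>c u. (I +>\<^bsub>free_ring\<^esub> Poly_Mapping.single [] c) \<otimes>\<^bsub>free_ring Quot I\<^esub> u)"

definition total_degree_grading ::
    "('k::comm_ring_1) free_alg set \<Rightarrow> int \<Rightarrow> 'k free_alg set set" where
  "total_degree_grading I n =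
     (\<lambda>p. I +>\<^bsub>free_ring\<^esub> p) ` {p. \<forall>w\<in>Poly_Mapping.keys p. int (length w) = n}"

definition bigraded_AS_regular :: "('k::field) free_alg set \<Rightarrow> bool" where
  "bigraded_AS_regular I \<longleftrightarrow> bihomogeneous_ideal I \<and>
     (\<exists>d. AS_regular (free_ring Quot I) (total_degree_grading I) d)"


section \<open>Deformations\<close>

definition free_finite_rank :: "'r ring \<Rightarrow> ('r, 'm) module \<Rightarrow> bool" where
  "free_finite_rank R M \<longleftrightarrow> (\<exists>B. finite B \<and> B \<subseteq> carrier M \<and>
     (\<forall>m\<in>carrier M. \<exists>!c. c \<in> B \<rightarrow>\<^sub>E carrier R \<and> m = (\<Oplus>\<^bsub>M\<^esub>b\<in>B. c b \<odot>\<^bsub>M\<^esub> b)))"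

definition special_fibre :: "('k::field) fps free_alg set \<Rightarrow> 'k free_alg set" where
  "special_fibre J = Poly_Mapping.map (\<lambda>c. fps_nth c 0) ` J"

text \<open>
  Tensoring with \<open>K((t))\<close> is right exact, so the general fibre of \<open>K[[t]]\<langle>x,y\<rangle>/J\<close> is the quotient of
  \<open>K((t))\<langle>x,y\<rangle>\<close> by the ideal generated by the image of \<open>J\<close>.
\<close>

definition general_fibre :: "('k::field) fps free_alg set \<Rightarrow> 'k fls free_alg set" where
  "general_fibre J = Idl\<^bsub>free_ring\<^esub> (Poly_Mapping.map fps_to_fls ` J)"

definition AS_regular_deformation :: "('k::field) free_alg set \<Rightarrow> 'k fps free_alg set \<Rightarrow> bool" where
  "AS_regular_deformation I J \<longleftrightarrow> bihomogeneous_ideal J \<and>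
     (\<forall>b. free_finite_rank ring_of_type_algebra (bigraded_component J b)) \<and>
     special_fibre J = I \<and>
     bigraded_AS_regular (general_fibre J)"


section \<open>The Fibonacci-Lyndon algebra\<close>

fun fib_word :: "nat \<Rightarrow> letter list" where
  "fib_word 0 = [Lx]"
| "fib_word (Suc 0) = [Ly]"
| "fib_word (Suc (Suc n)) =
     (if even n then fib_word n @ fib_word (Suc n) else fib_word (Suc n) @ fib_word n)"

definition fib_U :: "letter list set" where
  "fib_U = {fib_word (2 * k - 2) @ fib_word (2 * k) |k. k \<ge> 1} \<union>
           {fib_word (2 * k + 1) @ fib_word (2 * k - 1) |k. k \<ge> 1}"

definition fib_W6 :: "letter list set" where
  "fib_W6 = {w \<in> fib_U \<union> {fib_word 6}. \<forall>v \<in> fib_U \<union> {fib_word 6}. sublist v w \<longrightarrow> v = w}"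

definition F6_ideal :: "('k::field) free_alg set" where
  "F6_ideal = Idl\<^bsub>free_ring\<^esub> ((\<lambda>w. Poly_Mapping.single w 1) ` fib_W6)"

lemma sublist_fib_word_6:
  assumes "n \<ge> 6" shows "sublist (fib_word 6) (fib_word n)"
  using assms
proof (induction n rule: less_induct)
  case (less n)
  show ?case
  proof (cases "n = 6")
    case False
    then obtain m where n: "n = Suc (Suc m)" "Suc m \<ge> 6"
      using less.prems by (intro that[of "n - 2"]) auto
    then have "sublist (fib_word 6) (fib_word (Suc m))"
      using less.IH by simp
    then show ?thesis
      unfolding n by (auto intro: sublist_order.order.trans)
  qed simp
qed

lemma fib_W6_explicit:
  "fib_W6 = {fib_word 0 @ fib_word 2, fib_word 3 @ fib_word 1, fib_word 2 @ fib_word 4,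
             fib_word 5 @ fib_word 3, fib_word 6}" (is "_ = ?S")
proof -
  have step: "fib_word (n + 2) =
      (if even n then fib_word n @ fib_word (n + 1) else fib_word (n + 1) @ fib_word n)" for n
    by simp
  have f2: "fib_word 2 = [Lx, Ly]"
    by (simp add: numeral_2_eq_2)
  have f3: "fib_word 3 = [Lx, Ly, Ly]"
    by (simp add: numeral_3_eq_3)
  have w: "fib_word 0 @ fib_word 2 = [Lx,Lx,Ly]" "fib_word 3 @ fib_word 1 = [Lx,Ly,Ly,Ly]"
    "fib_word 2 @ fib_word 4 = [Lx,Ly,Lx,Ly,Lx,Ly,Ly]"
    "fib_word 5 @ fib_word 3 = [Lx,Ly,Lx,Ly,Ly,Lx,Ly,Ly,Lx,Ly,Ly]"
    "fib_word 6 = [Lx,Ly,Lx,Ly,Ly,Lx,Ly,Lx,Ly,Ly,Lx,Ly,Ly]"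
    using step[of 2] step[of 3] step[of 4] by (simp_all add: f2 f3)
  have antichain: "v = u" if "v \<in> ?S" "u \<in> ?S" "sublist v u" for u v
    using that unfolding w by (elim insertE emptyE; simp add: sublist_Cons_right)
  have S_U: "?S \<subseteq> fib_U \<union> {fib_word 6}"
  proof -
    have "fib_word (2 * k - 2) @ fib_word (2 * k) \<in> fib_U"
      "fib_word (2 * k + 1) @ fib_word (2 * k - 1) \<in> fib_U" if "k \<ge> 1" for k
      using that unfolding fib_U_def by blast+
    from this[of 1] this[of 2] show ?thesis by simp
  qed
  have len: "length (fib_word n) \<ge> 1" for n
    by (induction n rule: fib_word.induct) auto
  have big: "sublist (fib_word 6) v \<and> length v > 13" if v: "v \<in> fib_U" "v \<notin> ?S" for v
  proof -
    obtain m n where v': "v = fib_word m @ fib_word n" "m \<ge> 6 \<or> n \<ge> 6"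
    proof -
      from v(1) obtain k where k: "k \<ge> 1" "v = fib_word (2*k-2) @ fib_word (2*k) \<or>
          v = fib_word (2*k+1) @ fib_word (2*k-1)"
        unfolding fib_U_def by auto
      have "k \<ge> 3"
      proof (rule ccontr)
        assume "\<not> k \<ge> 3"
        then have "k = 1 \<or> k = 2" using k(1) by auto
        then show False using k(2) v(2) by auto
      qed
      then have "6 \<le> 2*k" "6 \<le> 2*k+1" by auto
      then show thesis using k(2) that by blast
    qed
    have 13: "length (fib_word i) \<ge> 13" if "i \<ge> 6" for i
      using sublist_length_le[OF sublist_fib_word_6[OF that]] unfolding w by simp
    show ?thesis
      using v'(2)
    proof
      assume "m \<ge> 6"
      then have "sublist (fib_word 6) v" "length (fib_word m) \<ge> 13"
        using sublist_fib_word_6 13 unfolding v'(1) by (simp_all add: sublist_append)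
      then show ?thesis using len[of n] unfolding v'(1) by simp
    next
      assume "n \<ge> 6"
      then have "sublist (fib_word 6) v" "length (fib_word n) \<ge> 13"
        using sublist_fib_word_6 13 unfolding v'(1) by (simp_all add: sublist_append)
      then show ?thesis using len[of m] unfolding v'(1) by simp
    qed
  qed
  have short: "length u \<le> 13" if "u \<in> ?S" for u
    using that unfolding w by auto
  show ?thesis
  proof (intro equalityI subsetI)
    fix u assume u: "u \<in> fib_W6"
    show "u \<in> ?S"
    proof (rule ccontr)
      assume "u \<notin> ?S"
      moreover from this have "u \<in> fib_U" using u by (auto simp: fib_W6_def)
      ultimately have "sublist (fib_word 6) u" using big by blast
      then have "fib_word 6 = u" using u by (auto simp: fib_W6_def)
      with \<open>u \<notin> ?S\<close> show False by blast
    qed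
  next
    fix u assume u: "u \<in> ?S"
    have "v = u" if "v \<in> fib_U \<union> {fib_word 6}" "sublist v u" for v
    proof (cases "v \<in> ?S")
      case False
      then have "length v > 13" using big that(1) by blast
      with sublist_length_le[OF that(2)] short[OF u] show ?thesis by simp
    qed (use antichain u that(2) in blast)
    with u S_U show "u \<in> fib_W6" unfolding fib_W6_def by blast
  qed
qed

end

theory Submission
  imports Defs
begin

text \<open>
  The algebra \<open>F\<^sub>6\<close> has as a basis the words avoiding the five words of \<open>W\<^sub>6\<close>, and so has the general
  fibre \<open>A\<close> of any deformation: it is given by five rewriting rules, whose left-hand sides are the words
  of \<open>W\<^sub>6\<close> and whose right-hand sides are combinations of reduced words of the same bidegree.  Resolving
  overlaps forces strong constraints on the coefficients.  The rules for \<open>xxy\<close> and \<open>xyyy\<close> become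
  \<open>xxy = 0\<close>, \<open>xyyy = 0\<close>, or \<open>xxy = a xyx\<close>, \<open>xyyy = a yxyy\<close> with \<open>a \<noteq> 0\<close>, and in the second case
  \<open>xyxyxyy = a xyxyyxy\<close>.  In either case there is a left linear map \<open>\<phi>\<close> from the augmentation ideal
  to \<open>A\<close>, sending \<open>x, y\<close> to \<open>0, yyy\<close> or to \<open>xyxyy - a xyyxy, 0\<close>, such that \<open>\<phi>\<close> followed by right multiplication
  with \<open>x\<close> is not right multiplication by an element of \<open>A\<close>.  So \<open>x\<close> does not annihilate the class of \<open>\<phi>\<close>
  in \<open>Ext\<^sup>1(k, A)\<close>, whereas for a Gorenstein algebra this right module is \<open>0\<close> or a shift of \<open>k\<close>.
\<close>

text \<open>Not all coefficients of the five rules get determined; what matters is which of them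
  \<phi> sees. The element \<open>u = xyxyy - a xyyxy\<close> is chosen because
  \<open>x u = 0\<close> and \<open>xy u = 0\<close> in \<open>A\<close>, the latter being the third
  relation. A word \<open>w x\<close> is sent to \<open>w u\<close>, which vanishes unless
  \<open>w\<close> ends in \<open>yy\<close>, so only the coefficients of reduced words ending in
  \<open>yyx\<close> have to be shown zero. The obstacle is the fifth rule, whose lead is
  \<open>f_6\<close>. The overlap of the third and fourth rules produces this lead on both sides. If
  its two coefficients cancel, the overlap fixes the fourth rule and further overlaps control the
  fifth; if not, the overlap itself derives the fifth relation from the others, and nothing about
  its coefficients has to be known. Checking \<phi> on five relations suffices because each lead,
  read as a binary number, is smaller than the reduced words of its bidegree, so that rewriting
  terminates. That \<phi> followed by \<open>x\<close> is not a right multiplication rests on left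
  cancellation of \<open>y\<close>: no lead begins with \<open>y\<close>.\<close>

fun wd :: "string \<Rightarrow> letter list" where
  "wd [] = []"
| "wd (c # s) = (if c = CHR ''x'' then Lx else Ly) # wd s"

definition leads :: "letter list list" where
  "leads = [wd ''xxy'', wd ''xyyy'', wd ''xyxyxyy'', wd ''xyxyyxyyxyy'', wd ''xyxyyxyxyyxyy'']"

lemma set_leads: "set leads = fib_W6"
proof -
  have step: "fib_word (n + 2) =
      (if even n then fib_word n @ fib_word (n + 1) else fib_word (n + 1) @ fib_word n)" for n
    by simp
  have f2: "fib_word 2 = [Lx, Ly]"
    by (simp add: numeral_2_eq_2)
  have f3: "fib_word 3 = [Lx, Ly, Ly]"
    by (simp add: numeral_3_eq_3)
  show ?thesis
    unfolding fib_W6_explicit leads_def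
    using step[of 2] step[of 3] step[of 4] by (simp add: f2 f3)
qed

section \<open>Enumeration of the reduced words by bidegree\<close>

definition reduced :: "letter list \<Rightarrow> bool" where
  "reduced w \<longleftrightarrow> (\<forall>l\<in>set leads. \<not> sublist l w)"

fun lead_prefix :: "letter list \<Rightarrow> bool" where
  "lead_prefix w \<longleftrightarrow> list_ex (\<lambda>l. prefix l w) leads"

lemma leads_nonempty: "l \<in> set leads \<Longrightarrow> l \<noteq> []"
  by (auto simp: leads_def)

lemma reduced_Nil [simp]: "reduced []"
  using leads_nonempty by (auto simp: reduced_def)

text \<open>A factor of \<open>a # w\<close> is a prefix of it or a factor of \<open>w\<close>, so
  reduced words can be built by prepending letters, with a test at the head only.\<close>

lemma reduced_Cons: "reduced (a # w) \<longleftrightarrow> \<not> lead_prefix (a # w) \<and> reduced w"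
  by (auto simp: reduced_def sublist_Cons_right list_ex_iff)

lemma lead_prefix_Ly [simp]: "\<not> lead_prefix (Ly # w)"
  by (simp add: leads_def)

lemma lead_prefix_Lx: "lead_prefix (Lx # w) \<longleftrightarrow>
   prefix (wd ''xy'') w \<or> prefix (wd ''yyy'') w \<or> prefix (wd ''yxyxyy'') w \<or>
   prefix (wd ''yxyyxyyxyy'') w \<or> prefix (wd ''yxyyxyxyyxyy'') w"
  by (simp add: leads_def)

declare lead_prefix.simps [simp del]

text \<open>Row \<open>a + 1\<close> arises from row \<open>a\<close> by prepending letters, so that not all words of a bidegree have to
  be enumerated.\<close>

fun next_row :: "letter list list \<Rightarrow> letter list list list \<Rightarrow> letter list list list"
  and next_row' where
  "next_row c [] = []"
| "next_row c (p # ps) = next_row' ps (filter (\<lambda>w. \<not> lead_prefix w) (map ((#) Lx) p) @ map ((#) Ly) c)"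
| "next_row' ps d = d # next_row d ps"

fun rows :: "nat \<Rightarrow> nat \<Rightarrow> letter list list list" where
  "rows 0 n = map (\<lambda>b. [replicate b Ly]) [0..<n]"
| "rows (Suc a) n = next_row [] (rows a n)"

lemma count_bidegree_Cons:
  "bidegree (Lx # w) = (Suc (fst (bidegree w)), snd (bidegree w))"
  "bidegree (Ly # w) = (fst (bidegree w), Suc (snd (bidegree w)))"
  by (simp_all add: bidegree_def)

definition reduced_words :: "nat \<times> nat \<Rightarrow> letter list set" where
  "reduced_words b = {w. reduced w \<and> bidegree w = b}"

text \<open>Split off the first letter: no lead begins with \<open>y\<close>, so a leading
  \<open>y\<close> is always allowed, while a leading \<open>x\<close> has to pass the prefix
  test.\<close>

lemma reduced_words_Suc:
  "reduced_words (Suc a, b) = {Lx # w | w. w \<in> reduced_words (a, b) \<and> \<not> lead_prefix (Lx # w)} \<union>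
     (if b = 0 then {} else (#) Ly ` reduced_words (Suc a, b - 1))" (is "?l = ?r")
proof (intro equalityI subsetI)
  fix w assume w: "w \<in> ?l"
  then obtain l v where "w = l # v" by (cases w) (auto simp: reduced_words_def bidegree_def)
  with w show "w \<in> ?r"
    by (cases l; cases "bidegree v") (auto simp: reduced_words_def reduced_Cons count_bidegree_Cons)
qed (auto simp: reduced_words_def reduced_Cons count_bidegree_Cons split: if_splits)

lemma reduced_words_0: "reduced_words (0, b) = {replicate b Ly}"
proof -
  have "w = replicate b Ly" if "bidegree w = (0, b)" for w
    using that
  proof (induction w arbitrary: b)
    case (Cons l w) then show ?case by (cases l; cases b) (auto simp: bidegree_def)
  qed (simp add: bidegree_def)
  moreover have "reduced (replicate b Ly)"
    by (induction b) (simp_all add: reduced_Cons)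
  moreover have "bidegree (replicate b Ly) = (0, b)"
    by (induction b) (simp_all add: bidegree_def)
  ultimately show ?thesis unfolding reduced_words_def by blast
qed

lemma length_next_row: "length (next_row c ps) = length ps" "length (next_row' ps d) = Suc (length ps)"
  by (induction c ps and ps d rule: next_row_next_row'.induct) simp_all

text \<open>Here \<open>ps\<close> is the part of row \<open>a\<close> from second index
  \<open>k\<close> on, and \<open>c\<close> is the entry of row \<open>a + 1\<close> finished just
  before, of bidegree \<open>(a + 1, k - 1)\<close>; for \<open>k = 0\<close> there is none and
  \<open>c\<close> is empty. The offset \<open>k\<close> is the generalisation needed for induction
  along the row.\<close>

lemma set_next_row:
  assumes "\<And>b. b < length ps \<Longrightarrow> set (ps ! b) = reduced_words (a, b + k)"
    and "set c = (if k = 0 then {} else reduced_words (Suc a, k - 1))"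
    and "b < length ps"
  shows "set (next_row c ps ! b) = reduced_words (Suc a, b + k)"
  using assms
proof (induction ps arbitrary: c k b)
  case (Cons p ps)
  let ?d = "filter (\<lambda>w. \<not> lead_prefix w) (map ((#) Lx) p) @ map ((#) Ly) c"
  have "set p = reduced_words (a, k)"
    using Cons.prems(1)[of 0] by simp
  then have d: "set ?d = reduced_words (Suc a, k)"
    using Cons.prems(2) by (auto simp: reduced_words_Suc[of a k])
  show ?case
  proof (cases b)
    case (Suc b')
    have "set (next_row ?d ps ! b') = reduced_words (Suc a, b' + Suc k)"
    proof (rule Cons.IH)
      show "set (ps ! i) = reduced_words (a, i + Suc k)" if "i < length ps" for i
        using Cons.prems(1)[of "Suc i"] that by simp
    qed (use d Cons.prems(3) Suc in auto)
    then show ?thesis using Suc by simp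
  qed (use d in simp)
qed simp

lemma length_rows [simp]: "length (rows a n) = n"
  by (induction a) (simp_all add: length_next_row)

lemma set_rows: "b < n \<Longrightarrow> set (rows a n ! b) = reduced_words (a, b)"
proof (induction a arbitrary: b)
  case (Suc a)
  then show ?case using set_next_row[of "rows a n" a 0 "[]" b] by simp
qed (simp add: reduced_words_0)

lemmas rows_eval = eval_nat_numeral upt_rec lead_prefix_Lx

text \<open>The digits in the names are bidegrees, namely those of the five leads. The lists thus
  hold all words that can occur on the right-hand sides of the rules.\<close>

definition tails21 where "tails21 = map wd [''xyx'', ''yxx'']"
definition tails13 where "tails13 = map wd [''yxyy'', ''yyxy'', ''yyyx'']"
definition tails34 where "tails34 = map wd [''xyxyyxy'', ''xyyxyxy'', ''xyyxyyx'', ''yxyxyxy'', ''yxyxyyx'', ''yxyyxyx'',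
    ''yyxyxyx'', ''yyxyyxx'', ''yyyxyxx'', ''yyyyxxx'']"
definition tails47 where "tails47 = map wd [''xyyxyxyyxyy'', ''xyyxyyxyxyy'', ''xyyxyyxyyxy'', ''yxyxyyxyxyy'', ''yxyxyyxyyxy'',
    ''yxyyxyxyyxy'', ''yxyyxyyxyxy'', ''yxyyxyyxyyx'', ''yyxyxyyxyxy'', ''yyxyxyyxyyx'',
    ''yyxyyxyxyxy'', ''yyxyyxyxyyx'', ''yyxyyxyyxyx'', ''yyyxyxyxyxy'', ''yyyxyxyyxyx'',
    ''yyyxyyxyxyx'', ''yyyxyyxyyxx'', ''yyyyxyxyxyx'', ''yyyyxyxyyxx'', ''yyyyxyyxyxx'',
    ''yyyyyxyxyxx'', ''yyyyyxyyxxx'', ''yyyyyyxyxxx'', ''yyyyyyyxxxx'']"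
definition tails58 where "tails58 = map wd [''xyxyyxyyxyxyy'', ''xyyxyxyyxyxyy'', ''xyyxyxyyxyyxy'', ''xyyxyyxyxyyxy'',
    ''xyyxyyxyyxyxy'', ''xyyxyyxyyxyyx'', ''yxyxyyxyxyyxy'', ''yxyxyyxyyxyxy'',
    ''yxyyxyxyyxyxy'', ''yxyyxyxyyxyyx'', ''yxyyxyyxyxyxy'', ''yxyyxyyxyxyyx'',
    ''yxyyxyyxyyxyx'', ''yyxyxyyxyxyxy'', ''yyxyxyyxyxyyx'', ''yyxyxyyxyyxyx'',
    ''yyxyyxyxyxyxy'', ''yyxyyxyxyyxyx'', ''yyxyyxyyxyxyx'', ''yyxyyxyyxyyxx'',
    ''yyyxyxyxyxyxy'', ''yyyxyxyyxyxyx'', ''yyyxyxyyxyyxx'', ''yyyxyyxyxyxyx'',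
    ''yyyxyyxyxyyxx'', ''yyyxyyxyyxyxx'', ''yyyyxyxyxyxyx'', ''yyyyxyxyyxyxx'',
    ''yyyyxyyxyxyxx'', ''yyyyxyyxyyxxx'', ''yyyyyxyxyxyxx'', ''yyyyyxyxyyxxx'',
    ''yyyyyxyyxyxxx'', ''yyyyyyxyxyxxx'', ''yyyyyyxyyxxxx'', ''yyyyyyyxyxxxx'',
    ''yyyyyyyyxxxxx'']"

lemma set_tails:
  "set tails21 = reduced_words (2, 1)" "set tails13 = reduced_words (1, 3)"
  "set tails34 = reduced_words (3, 4)" "set tails47 = reduced_words (4, 7)"
  "set tails58 = reduced_words (5, 8)"
proof -
  have "rows 2 2 ! 1 = tails21" "rows 1 4 ! 3 = tails13" "rows 3 5 ! 4 = tails34"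
    "rows 4 8 ! 7 = tails47" "rows 5 9 ! 8 = tails58"
    by (simp_all add: rows_eval tails21_def tails13_def tails34_def tails47_def tails58_def)
  then show "set tails21 = reduced_words (2, 1)" "set tails13 = reduced_words (1, 3)"
    "set tails34 = reduced_words (3, 4)" "set tails47 = reduced_words (4, 7)"
    "set tails58 = reduced_words (5, 8)"
    using set_rows[of 1 2 2] set_rows[of 3 4 1] set_rows[of 4 5 3] set_rows[of 7 8 4]
      set_rows[of 8 9 5] by simp_all
qed

lemma bidegree_append: "bidegree (u @ v) = (fst (bidegree u) + fst (bidegree v), snd (bidegree u) + snd (bidegree v))"
  by (simp add: bidegree_def)

section \<open>The free algebra and its two-sided ideals\<close>

abbreviation (input) "lookup \<equiv> Poly_Mapping.lookup"
abbreviation (input) "keys \<equiv> Poly_Mapping.keys"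

abbreviation mon :: "letter list \<Rightarrow> 'k::comm_ring_1 free_alg" where
  "mon w \<equiv> Poly_Mapping.single w 1"

lemma single_mult: "Poly_Mapping.single u (a::'k::comm_ring_1) * Poly_Mapping.single v b = Poly_Mapping.single (u @ v) (a * b)"
  by (simp add: mult_single plus_list_def)

lemma one_eq_mon: "(1 :: 'k::comm_ring_1 free_alg) = mon []"
  by (simp flip: single_one add: zero_list_def)

lemma free_alg_sum: "f = (\<Sum>w\<in>keys f. Poly_Mapping.single w (lookup f w))" for f :: "'k::comm_ring_1 free_alg"
  by (rule poly_mapping_eqI) (auto simp: lookup_sum lookup_single when_def in_keys_iff)

lemma free_alg_induct [case_names zero single add]:
  fixes f :: "'k::comm_ring_1 free_alg"
  assumes "P 0" "\<And>w c. P (Poly_Mapping.single w c)" "\<And>f g. P f \<Longrightarrow> P g \<Longrightarrow> P (f + g)"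
  shows "P f"
proof -
  have "P (\<Sum>w\<in>A. Poly_Mapping.single w (lookup f w))" if "finite A" for A
    using that by (induction A) (auto simp: assms)
  then show ?thesis by (subst free_alg_sum) simp
qed

text \<open>Ideals of \<open>free_ring\<close> in terms of the type-class operations, in which the
  computations are done. Closure under negation follows by multiplying with
  \<open>- 1\<close>.\<close>

definition two_sided :: "'k::comm_ring_1 free_alg set \<Rightarrow> bool" where
  "two_sided I \<longleftrightarrow> 0 \<in> I \<and> (\<forall>f\<in>I. \<forall>g\<in>I. f + g \<in> I) \<and> (\<forall>f\<in>I. \<forall>g. g * f \<in> I \<and> f * g \<in> I)"

lemma two_sidedD:
  assumes "two_sided I"
  shows "0 \<in> I" "f \<in> I \<Longrightarrow> g \<in> I \<Longrightarrow> f + g \<in> I" "f \<in> I \<Longrightarrow> h * f \<in> I" "f \<in> I \<Longrightarrow> f * h \<in> I"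
    "f \<in> I \<Longrightarrow> - f \<in> I" "f \<in> I \<Longrightarrow> g \<in> I \<Longrightarrow> f - g \<in> I"
proof -
  show "0 \<in> I" "f \<in> I \<Longrightarrow> h * f \<in> I" "f \<in> I \<Longrightarrow> f * h \<in> I" for f h
    using assms by (auto simp: two_sided_def)
  show add: "f \<in> I \<Longrightarrow> g \<in> I \<Longrightarrow> f + g \<in> I" for f g
    using assms by (auto simp: two_sided_def)
  show neg: "f \<in> I \<Longrightarrow> - f \<in> I" for f
    using assms unfolding two_sided_def by (metis mult_minus_left mult_1)
  show "f \<in> I \<Longrightarrow> g \<in> I \<Longrightarrow> f - g \<in> I"
    using add[of f "- g"] neg[of g] by simp
qed

lemma free_ring_simps [simp]:
  "carrier free_ring = UNIV" "\<zero>\<^bsub>free_ring\<^esub> = 0" "\<one>\<^bsub>free_ring\<^esub> = 1"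
  "f \<oplus>\<^bsub>free_ring\<^esub> g = f + g" "f \<otimes>\<^bsub>free_ring\<^esub> g = f * g" for f g :: "'k::comm_ring_1 free_alg"
  by (simp_all add: ring_of_type_algebra_def)

lemma a_inv_free_ring [simp]: "\<ominus>\<^bsub>free_ring\<^esub> f = - f" for f :: "'k::comm_ring_1 free_alg"
proof -
  interpret ring "free_ring :: 'k free_alg ring" by (rule ring_ring_of_type_algebra)
  show ?thesis by (rule minus_equality) auto
qed

lemma ideal_free_ring_iff: "ideal I (free_ring :: 'k::comm_ring_1 free_alg ring) \<longleftrightarrow> two_sided I"
proof
  assume I: "ideal I (free_ring :: 'k free_alg ring)"
  interpret ideal I "free_ring :: 'k free_alg ring" by (rule I)
  show "two_sided I"
    using additive_subgroup.a_closed[OF is_additive_subgroup] additive_subgroup.zero_closed[OF is_additive_subgroup]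
      I_l_closed I_r_closed by (simp add: two_sided_def)
next
  assume I: "two_sided I"
  interpret ring "free_ring :: 'k free_alg ring" by (rule ring_ring_of_type_algebra)
  have inv: "inv\<^bsub>add_monoid free_ring\<^esub> f = - f" for f :: "'k free_alg"
    using a_inv_free_ring[of f] unfolding a_inv_def .
  have "subgroup I (add_monoid (free_ring :: 'k free_alg ring))"
  proof
    show "inv\<^bsub>add_monoid free_ring\<^esub> f \<in> I" if "f \<in> I" for f
      unfolding inv by (rule two_sidedD(5)[OF I that])
  qed (use two_sidedD[OF I] in auto)
  then show "ideal I (free_ring :: 'k free_alg ring)"
    by (rule idealI[OF ring_ring_of_type_algebra]) (use two_sidedD[OF I] in auto)
qed

section \<open>Rewriting\<close>

text \<open>Polynomials as explicit lists of terms, so that rewriting becomes evaluation by the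
  simplifier. A word may occur several times in a list; \<open>coef\<close> adds up its
  occurrences.\<close>

definition lin :: "('k \<times> letter list) list \<Rightarrow> 'k::comm_ring_1 free_alg" where
  "lin xs = (\<Sum>(c, w)\<leftarrow>xs. Poly_Mapping.single w c)"

fun coef :: "letter list \<Rightarrow> ('k::comm_ring_1 \<times> letter list) list \<Rightarrow> 'k" where
  "coef t [] = 0"
| "coef t ((c, w) # xs) = (if w = t then c else 0) + coef t xs"

lemma lin_Nil [simp]: "lin [] = 0"
  and lin_Cons: "lin (p # xs) = Poly_Mapping.single (snd p) (fst p) + lin xs"
  and lin_append: "lin (xs @ ys) = lin xs + lin ys"
  by (simp_all add: lin_def case_prod_unfold)

lemma lookup_lin: "lookup (lin xs) t = coef t xs"
  by (induction xs) (auto simp: lin_Cons lookup_add lookup_single)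

definition expand :: "letter list \<Rightarrow> letter list \<Rightarrow> 'k::comm_ring_1 \<Rightarrow> ('k \<times> letter list) list \<Rightarrow> ('k \<times> letter list) list" where
  "expand p q c xs = map (\<lambda>(d, v). (c * d, p @ v @ q)) xs"

lemma expand_simps [simp]:
  "expand p q c [] = []" "expand p q c ((d, v) # xs) = (c * d, p @ v @ q) # expand p q c xs"
  by (simp_all add: expand_def)

lemma lin_expand: "lin (expand p q c xs) = Poly_Mapping.single p c * lin xs * mon q"
  by (induction xs) (auto simp: lin_Cons algebra_simps single_mult)

type_synonym 'k rules = "(letter list \<times> ('k \<times> letter list) list) list"

fun strip :: "letter list \<Rightarrow> letter list \<Rightarrow> letter list option" where
  "strip [] w = Some w"
| "strip (a # l) [] = None"
| "strip (a # l) (b # w) = (if a = b then strip l w else None)"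

lemma strip_Some: "strip l w = Some q \<Longrightarrow> w = l @ q"
  by (induction l w rule: strip.induct) (auto split: if_splits)

fun rewrite_head :: "'k::comm_ring_1 rules \<Rightarrow> letter list \<Rightarrow> ('k \<times> letter list) list option" where
  "rewrite_head [] w = None"
| "rewrite_head ((l, r) # R) w = (case strip l w of Some q \<Rightarrow> Some (expand [] q 1 r) | None \<Rightarrow> rewrite_head R w)"

type_synonym 'k head = "letter list \<Rightarrow> ('k \<times> letter list) list option"

fun rewrite :: "'k::comm_ring_1 head \<Rightarrow> letter list \<Rightarrow> ('k \<times> letter list) list option" where
  "rewrite h [] = None"
| "rewrite h (a # w) = (case h (a # w) of Some r \<Rightarrow> Some r
     | None \<Rightarrow> (case rewrite h w of Some r \<Rightarrow> Some (expand [a] [] 1 r) | None \<Rightarrow> None))"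

text \<open>The counter bounds the number of successive rewriting steps on a term. When it runs out,
  terms are left as they are: the result is still congruent to the input, but need not be
  reduced.\<close>

fun reduce :: "'k::comm_ring_1 head \<Rightarrow> nat \<Rightarrow> ('k \<times> letter list) list \<Rightarrow> ('k \<times> letter list) list" where
  "reduce h 0 xs = xs"
| "reduce h (Suc n) [] = []"
| "reduce h (Suc n) ((c, w) # xs) = (case rewrite h w of None \<Rightarrow> [(c, w)]
     | Some r \<Rightarrow> reduce h n (expand [] [] c r)) @ reduce h (Suc n) xs"

lemma reduce_numeral:
  "reduce h (numeral k) [] = []"
  "reduce h (numeral k) ((c, w) # xs) = (case rewrite h w of None \<Rightarrow> [(c, w)]
     | Some r \<Rightarrow> reduce h (pred_numeral k) (expand [] [] c r)) @ reduce h (numeral k) xs"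
  by (simp_all add: numeral_eq_Suc)

definition sound :: "'k::comm_ring_1 free_alg set \<Rightarrow> 'k head \<Rightarrow> bool" where
  "sound I h \<longleftrightarrow> (\<forall>w r. h w = Some r \<longrightarrow> mon w - lin r \<in> I)"

definition rules_of :: "'k::comm_ring_1 free_alg set \<Rightarrow> 'k rules \<Rightarrow> bool" where
  "rules_of I R \<longleftrightarrow> (\<forall>(l, r)\<in>set R. mon l - lin r \<in> I)"

lemma rewrite_head_sound:
  assumes "two_sided I" "rules_of I R"
  shows "sound I (rewrite_head R)"
proof -
  have "mon w - lin r \<in> I" if "rewrite_head R w = Some r" for w r
    using assms(2) that
  proof (induction R w rule: rewrite_head.induct)
    case (2 l r' R w)
    show ?case
    proof (cases "strip l w")
      case None with 2 show ?thesis by (auto simp: rules_of_def)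
    next
      case (Some q)
      then have "mon w - lin r = (mon l - lin r') * mon q"
        using 2 by (auto dest!: strip_Some simp: lin_expand algebra_simps single_mult simp flip: one_eq_mon)
      then show ?thesis using 2 two_sidedD(4)[OF assms(1)] by (simp add: rules_of_def)
    qed
  qed simp
  then show ?thesis by (simp add: sound_def)
qed

lemma rewrite_sound:
  assumes "two_sided I" "sound I h" "rewrite h w = Some r"
  shows "mon w - lin r \<in> I"
  using assms(2,3)
proof (induction h w arbitrary: r rule: rewrite.induct)
  case (2 h a w)
  show ?case
  proof (cases "h (a # w)")
    case None
    with 2 obtain r' where r': "rewrite h w = Some r'" "r = expand [a] [] 1 r'"
      by (auto split: option.splits)
    have "mon [a] * (mon w - lin r') \<in> I"
      using 2 None r' two_sidedD(3)[OF assms(1)] by simp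
    then show ?thesis using r' by (simp add: lin_expand algebra_simps single_mult flip: one_eq_mon)
  qed (use 2 in \<open>auto simp: sound_def\<close>)
qed simp

lemma reduce_sound:
  assumes "two_sided I" "sound I h"
  shows "lin xs - lin (reduce h n xs) \<in> I"
  using assms(2)
proof (induction h n xs rule: reduce.induct)
  case (3 h n c w xs)
  note I = two_sidedD[OF assms(1)]
  let ?r = "case rewrite h w of None \<Rightarrow> [(c, w)] | Some r \<Rightarrow> reduce h n (expand [] [] c r)"
  have "Poly_Mapping.single w c - lin ?r \<in> I"
  proof (cases "rewrite h w")
    case (Some r)
    have "Poly_Mapping.single [] c * (mon w - lin r) \<in> I"
      using Some rewrite_sound[OF assms(1)] 3 I(3) by blast
    moreover have "lin (expand [] [] c r) - lin (reduce h n (expand [] [] c r)) \<in> I"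
      using 3 Some by simp
    moreover have "lin (expand [] [] c r) = Poly_Mapping.single [] c * lin r"
      by (simp add: lin_expand flip: one_eq_mon)
    ultimately show ?thesis
      using I(2) Some by (fastforce simp: algebra_simps single_mult)
  qed (use I(1) in \<open>simp add: lin_Cons\<close>)
  from I(2)[OF this 3(2)] 3(3) show ?case
    by (simp add: lin_Cons lin_append algebra_simps)
qed (use two_sidedD(1)[OF assms(1)] in simp_all)

section \<open>Comparing coefficients when the reduced words are a basis\<close>

definition all_reduced :: "('k::comm_ring_1 \<times> letter list) list \<Rightarrow> bool" where
  "all_reduced xs \<longleftrightarrow> list_all (\<lambda>p. reduced (snd p)) xs"

text \<open>Reducedness stands as a premise, so that agreement can be proved for every value of the
  counter of \<open>reduce\<close>. Evaluation discharges the premise when the counter was large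
  enough.\<close>

definition rows_agree :: "letter list list \<Rightarrow> ('k::comm_ring_1 \<times> letter list) list \<Rightarrow> ('k \<times> letter list) list \<Rightarrow> bool" where
  "rows_agree ts xs ys \<longleftrightarrow> (all_reduced xs \<longrightarrow> all_reduced ys \<longrightarrow> list_all (\<lambda>t. coef t xs = coef t ys) ts)"

text \<open>What the algebraic half of the proof uses of the general fibre: the reduced words are a
  basis of the quotient, and normal forms keep the bidegree.\<close>

locale reduced_basis =
  fixes I :: "'k::field free_alg set"
  assumes two_sided: "two_sided I"
    and reduced_independent: "f \<in> I \<Longrightarrow> \<forall>w\<in>keys f. reduced w \<Longrightarrow> f = 0"
    and reduced_span: "\<exists>n. mon w - n \<in> I \<and> keys n \<subseteq> reduced_words (bidegree w)"
begin

lemmas I_zero = two_sidedD(1)[OF two_sided]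
  and I_add = two_sidedD(2)[OF two_sided]
  and I_left = two_sidedD(3)[OF two_sided]
  and I_right = two_sidedD(4)[OF two_sided]
  and I_uminus = two_sidedD(5)[OF two_sided]
  and I_diff = two_sidedD(6)[OF two_sided]

text \<open>The choice is in fact unique: two candidates differ by an element of \<open>I\<close>
  supported on reduced words.\<close>

definition nf :: "letter list \<Rightarrow> 'k free_alg" where
  "nf w = (SOME n. mon w - n \<in> I \<and> keys n \<subseteq> reduced_words (bidegree w))"

lemma nf: "mon w - nf w \<in> I" "keys (nf w) \<subseteq> reduced_words (bidegree w)"
  using someI_ex[OF reduced_span[of w]] by (simp_all add: nf_def)

lemma lin_lookup:
  assumes "distinct vs" "keys f \<subseteq> set vs"
  shows "lin (map (\<lambda>v. (lookup f v, v)) vs) = f"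
proof (rule poly_mapping_eqI)
  fix t
  have "coef t (map (\<lambda>v. (lookup f v, v)) vs) = (if t \<in> set vs then lookup f t else 0)"
    using assms(1) by (induction vs) auto
  then show "lookup (lin (map (\<lambda>v. (lookup f v, v)) vs)) t = lookup f t"
    using assms(2) by (auto simp: lookup_lin in_keys_iff)
qed

lemma nf_rule:
  assumes "distinct vs" "set vs = reduced_words (bidegree l)"
  shows "rules_of I [(l, map (\<lambda>v. (lookup (nf l) v, v)) vs)]"
  using nf[of l] lin_lookup[OF assms(1), of "nf l"] assms(2) by (simp add: rules_of_def)

lemma rules_of_Cons: "rules_of I (r # R) \<longleftrightarrow> rules_of I [r] \<and> rules_of I R"
  by (simp add: rules_of_def)

lemma reduced_coef_cong:
  assumes "lin xs - lin ys \<in> I" "all_reduced xs" "all_reduced ys"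
  shows "coef t xs = coef t ys"
proof -
  have "reduced w" if "w \<in> keys (lin zs)" "all_reduced zs" for w and zs :: "('k \<times> letter list) list"
    using that
    by (induction zs) (auto simp: all_reduced_def lin_Cons split: if_splits dest!: subsetD[OF keys_add])
  then have "lin xs - lin ys = 0"
    using reduced_independent[OF assms(1)] keys_diff[of "lin xs" "lin ys"] assms(2,3) by blast
  then show ?thesis by (metis eq_iff_diff_eq_0 lookup_lin)
qed

lemma rule_context:
  assumes "rules_of I R" "(l, r) \<in> set R"
  shows "mon (p @ l @ q) - lin (expand p q 1 r) \<in> I"
proof -
  have "mon p * (mon l - lin r) * mon q \<in> I"
    using assms by (intro I_left I_right) (auto simp: rules_of_def)
  then show ?thesis by (simp add: lin_expand algebra_simps single_mult)
qed

lemma rows_agree_reduce: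
  assumes "sound I h" "lin xs - lin ys \<in> I"
  shows "rows_agree ts (reduce h n xs) (reduce h n ys)"
proof -
  have "lin xs - lin (reduce h n xs) \<in> I" "lin ys - lin (reduce h n ys) \<in> I"
    using reduce_sound[OF two_sided assms(1)] by auto
  from I_add[OF I_diff[OF assms(2) this(1)] this(2)]
  have "lin (reduce h n xs) - lin (reduce h n ys) \<in> I"
    by (simp add: algebra_simps)
  then show ?thesis
    unfolding rows_agree_def list_all_iff using reduced_coef_cong by blast
qed

text \<open>Two ways of rewriting the same word differ by an element of \<open>I\<close>, so their
  reduced forms have equal coefficients. All equations between the unknown coefficients arise in
  this way.\<close>

lemma overlap:
  assumes "rules_of I R" "h = rewrite_head R" "(l1, r1) \<in> set R" "(l2, r2) \<in> set R"
    and "p1 @ l1 @ q1 = p2 @ l2 @ q2"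
  shows "rows_agree ts (reduce h n (expand p1 q1 1 r1)) (reduce h n (expand p2 q2 1 r2))"
proof (rule rows_agree_reduce)
  show "sound I h"
    using assms(1,2) rewrite_head_sound[OF two_sided] by simp
  show "lin (expand p1 q1 1 r1) - lin (expand p2 q2 1 r2) \<in> I"
    using I_diff[OF rule_context[OF assms(1,4), of p2 q2] rule_context[OF assms(1,3), of p1 q1]] assms(5)
    by (simp add: algebra_simps)
qed

end

text \<open>The right-hand sides stay opaque constants during evaluation: otherwise the simplifier
  would traverse the long tails at every rewriting step.\<close>

definition head2 where "head2 r1 r2 = rewrite_head [(wd ''xxy'', r1), (wd ''xyyy'', r2)]"
definition head3 where "head3 r1 r2 r3 = rewrite_head [(wd ''xxy'', r1), (wd ''xyyy'', r2), (wd ''xyxyxyy'', r3)]"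
definition head4 where "head4 r1 r2 r3 r4 = rewrite_head [(wd ''xxy'', r1), (wd ''xyyy'', r2), (wd ''xyxyxyy'', r3),
   (wd ''xyxyyxyyxyy'', r4)]"
definition head5 where "head5 r1 r2 r3 r4 r5 = rewrite_head [(wd ''xxy'', r1), (wd ''xyyy'', r2), (wd ''xyxyxyy'', r3),
   (wd ''xyxyyxyyxyy'', r4), (wd ''xyxyyxyxyyxyy'', r5)]"

lemma head_Ly:
  "head2 r1 r2 (Ly # w) = None"  "head3 r1 r2 r3 (Ly # w) = None"
  "head4 r1 r2 r3 r4 (Ly # w) = None"  "head5 r1 r2 r3 r4 r5 (Ly # w) = None"
  by (simp_all add: head2_def head3_def head4_def head5_def)

lemma head_Lx:
  "head2 r1 r2 (Lx # w) = (case strip (wd ''xy'') w of Some q \<Rightarrow> Some (expand [] q 1 r1) | None \<Rightarrow>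
     (case strip (wd ''yyy'') w of Some q \<Rightarrow> Some (expand [] q 1 r2) | None \<Rightarrow> None))"
  "head3 r1 r2 r3 (Lx # w) = (case strip (wd ''xy'') w of Some q \<Rightarrow> Some (expand [] q 1 r1) | None \<Rightarrow>
     (case strip (wd ''yyy'') w of Some q \<Rightarrow> Some (expand [] q 1 r2) | None \<Rightarrow>
     (case strip (wd ''yxyxyy'') w of Some q \<Rightarrow> Some (expand [] q 1 r3) | None \<Rightarrow> None)))"
  "head4 r1 r2 r3 r4 (Lx # w) = (case strip (wd ''xy'') w of Some q \<Rightarrow> Some (expand [] q 1 r1) | None \<Rightarrow>
     (case strip (wd ''yyy'') w of Some q \<Rightarrow> Some (expand [] q 1 r2) | None \<Rightarrow>
     (case strip (wd ''yxyxyy'') w of Some q \<Rightarrow> Some (expand [] q 1 r3) | None \<Rightarrow>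
     (case strip (wd ''yxyyxyyxyy'') w of Some q \<Rightarrow> Some (expand [] q 1 r4) | None \<Rightarrow> None))))"
  "head5 r1 r2 r3 r4 r5 (Lx # w) = (case strip (wd ''xy'') w of Some q \<Rightarrow> Some (expand [] q 1 r1) | None \<Rightarrow>
     (case strip (wd ''yyy'') w of Some q \<Rightarrow> Some (expand [] q 1 r2) | None \<Rightarrow>
     (case strip (wd ''yxyxyy'') w of Some q \<Rightarrow> Some (expand [] q 1 r3) | None \<Rightarrow>
     (case strip (wd ''yxyyxyyxyy'') w of Some q \<Rightarrow> Some (expand [] q 1 r4) | None \<Rightarrow>
     (case strip (wd ''yxyyxyxyyxyy'') w of Some q \<Rightarrow> Some (expand [] q 1 r5) | None \<Rightarrow> None)))))"
  by (simp_all add: head2_def head3_def head4_def head5_def split: option.split)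

lemma wd_code: "wd (CHR ''x'' # s) = Lx # wd s" "wd (CHR ''y'' # s) = Ly # wd s" by simp_all

lemmas head_Lx_eval = head_Lx[unfolded wd_code wd.simps(1)]
lemmas lead_prefix_Lx_eval = lead_prefix_Lx[unfolded wd_code wd.simps(1)]

lemmas code = wd.simps(1) wd_code strip.simps head_Ly head_Lx_eval rewrite.simps reduce_numeral
  pred_numeral_simps arith_simps expand_simps
  option.case append.simps letter.distinct letter.simps if_True if_False all_reduced_def list.pred_inject o_apply
  reduced_Cons lead_prefix_Lx_eval lead_prefix_Ly
  simp_thms add_0_left add_0_right mult_1_left mult_1_right reduced_Nil fst_conv snd_conv list.map list.inject list.distinct coef.simps  prod.case
  Cons_prefix_Cons Nil_prefix prefix_Nil rows_agree_def

section \<open>Coefficient equations from the overlaps of the rules\<close>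

context reduced_basis
begin

text \<open>The overlap is \<open>xxyyy = xxy.yy = x.xyyy\<close>. The five equations are the
  coefficients of the five listed words, in the same order. They leave two cases:
  \<open>a = 0\<close>, or \<open>a = c\<close> nonzero with \<open>b = d = e = 0\<close>.\<close>

lemma overlap_2_3:
  assumes R: "rules_of I [(wd ''xxy'', [(a, wd ''xyx''), (b, wd ''yxx'')]),
    (wd ''xyyy'', [(c, wd ''yxyy''), (d, wd ''yyxy''), (e, wd ''yyyx'')])]"
  shows "a = c \<and> d = 0 \<and> a * b = 0 \<and> e * c = 0 \<and> b * b * b = e * e"
proof -
  define r1 where "r1 = [(a, wd ''xyx''), (b, wd ''yxx'')]"
  define r2 where "r2 = [(c, wd ''yxyy''), (d, wd ''yyxy''), (e, wd ''yyyx'')]"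
  have ex: "expand u w k r1 = [(k * a, u @ wd ''xyx'' @ w), (k * b, u @ wd ''yxx'' @ w)]"
    "expand u w k r2 = [(k * c, u @ wd ''yxyy'' @ w), (k * d, u @ wd ''yyxy'' @ w), (k * e, u @ wd ''yyyx'' @ w)]"
    for u w k by (simp_all add: r1_def r2_def)
  have "rows_agree [wd ''xyxyy'', wd ''xyyxy'', wd ''yxyxy'', wd ''yxyyx'', wd ''yyyxx'']
    (reduce (head2 r1 r2) 15 (expand [] (wd ''yy'') 1 r1)) (reduce (head2 r1 r2) 15 (expand (wd ''x'') [] 1 r2))"
    by (rule overlap[OF R[folded r1_def r2_def], of _ "wd ''xxy''" _ "wd ''xyyy''"]) (simp_all add: head2_def)
  then show ?thesis
    by (simp (no_asm_use) only: code ex) (auto simp: mult.assoc)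
qed

text \<open>In the overlap \<open>xyxyxyyy\<close> each of the three letters \<open>x\<close> moves
  past \<open>yyy\<close>, giving \<open>e * e * e\<close>; on the other side stands a product of
  two coefficients of the third rule. The overlap \<open>xxyxyxyy\<close> kills one factor, so
  \<open>e = 0\<close>, and then \<open>b = 0\<close>.\<close>

lemma overlap_3_4_a0:
  assumes R: "rules_of I [(wd ''xxy'', [(b, wd ''yxx'')]), (wd ''xyyy'', [(e, wd ''yyyx'')]),
     (wd ''xyxyxyy'', map (\<lambda>v. (p v, v)) tails34)]"
    and be: "b * b * b = e * e"
  shows "b = 0" "e = 0"
proof -
  define r1 where "r1 = [(b, wd ''yxx'')]"
  define r2 where "r2 = [(e, wd ''yyyx'')]"
  define r3 where "r3 = map (\<lambda>v. (p v, v)) tails34"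
  note R = R[folded r1_def r2_def r3_def]
  have ex: "expand u w k r1 = [(k * b, u @ wd ''yxx'' @ w)]" "expand u w k r2 = [(k * e, u @ wd ''yyyx'' @ w)]"
    "expand u w k r3 = map (\<lambda>v. (k * p v, u @ v @ w)) tails34" for u w k
    by (simp_all add: r1_def r2_def r3_def expand_def)
  have "rows_agree [wd ''yyyxyxyx'']
    (reduce (head3 r1 r2 r3) 25 (expand [] (wd ''y'') 1 r3)) (reduce (head3 r1 r2 r3) 25 (expand (wd ''xyxy'') [] 1 r2))"
    by (rule overlap[OF R, of _ "wd ''xyxyxyy''" _ "wd ''xyyy''"]) (simp_all add: head3_def)
  then have 1: "p (wd ''yxyxyxy'') * p (wd ''yyxyxyx'') = e * e * e"
    by (simp (no_asm_use) only: code ex tails34_def)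
  have "rows_agree [wd ''xyxyxyxy'']
    (reduce (head3 r1 r2 r3) 25 (expand (wd ''x'') [] 1 r3)) (reduce (head3 r1 r2 r3) 25 (expand [] (wd ''xyxyy'') 1 r1))"
    by (rule overlap[OF R, of _ "wd ''xyxyxyy''" _ "wd ''xxy''"]) (simp_all add: head3_def)
  then have 2: "p (wd ''yxyxyxy'') = 0"
    by (simp (no_asm_use) only: code ex tails34_def)
  show "e = 0" "b = 0"
    using 1 2 be by simp_all
qed

text \<open>The third lead overlaps the second in \<open>xyxyxyyy\<close> and the first in
  \<open>xxyxyxyy\<close>. Together, after division by \<open>a\<close>, these determine all ten
  coefficients. The outcome says that \<open>xy\<close> annihilates \<open>xyxyy - a xyyxy\<close>
  on the right.\<close>

lemma overlap_3_4:
  assumes R: "rules_of I [(wd ''xxy'', [(a, wd ''xyx'')]), (wd ''xyyy'', [(a, wd ''yxyy'')]),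
     (wd ''xyxyxyy'', map (\<lambda>v. (p v, v)) tails34)]"
    and a: "a \<noteq> 0"
  shows "\<forall>v\<in>set tails34. p v = (if v = wd ''xyxyyxy'' then a else 0)"
proof -
  define r1 where "r1 = [(a, wd ''xyx'')]"
  define r2 where "r2 = [(a, wd ''yxyy'')]"
  define r3 where "r3 = map (\<lambda>v. (p v, v)) tails34"
  note R = R[folded r1_def r2_def r3_def]
  have ex: "expand u w k r1 = [(k * a, u @ wd ''xyx'' @ w)]" "expand u w k r2 = [(k * a, u @ wd ''yxyy'' @ w)]"
    "expand u w k r3 = map (\<lambda>v. (k * p v, u @ v @ w)) tails34" for u w k
    by (simp_all add: r1_def r2_def r3_def expand_def)
  have "rows_agree [wd ''xyxyyxyy'', wd ''xyyxyxyy'', wd ''xyyxyyxy'', wd ''yxyxyyxy'']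
    (reduce (head3 r1 r2 r3) 25 (expand [] (wd ''y'') 1 r3)) (reduce (head3 r1 r2 r3) 25 (expand (wd ''xyxy'') [] 1 r2))"
    by (rule overlap[OF R, of _ "wd ''xyxyxyy''" _ "wd ''xyyy''"]) (simp_all add: head3_def)
  then have 1: "p (wd ''xyxyyxy'') = a \<and> p (wd ''xyyxyxy'') = 0 \<and> p (wd ''xyyxyyx'') = 0 \<and>
      p (wd ''yxyxyxy'') * p (wd ''xyxyyxy'') + p (wd ''yxyxyyx'') = 0"
    by (simp (no_asm_use) only: code ex tails34_def)
  have "rows_agree [wd ''xyxyxyxy'', wd ''xyxyyxyx'', wd ''xyyxyxyx'', wd ''xyyxyyxx'', wd ''yxyyxyxx'', wd ''yyxyyxxx'']
    (reduce (head3 r1 r2 r3) 25 (expand (wd ''x'') [] 1 r3)) (reduce (head3 r1 r2 r3) 25 (expand [] (wd ''xyxyy'') 1 r1))"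
    by (rule overlap[OF R, of _ "wd ''xyxyxyy''" _ "wd ''xxy''"]) (simp_all add: head3_def)
  then show ?thesis using 1 a
    by (simp (no_asm_use) only: code ex tails34_def) auto
qed

text \<open>The three vanishing coefficients are those of all words of \<open>tails47\<close> that
  end in \<open>yyx\<close>; no others matter for \<phi>. The last equation is kept for the case in
  which the overlap of the third and fourth rules does not yield the fifth relation.\<close>

lemma overlap_4_7:
  assumes R: "rules_of I [(wd ''xxy'', [(a, wd ''xyx'')]), (wd ''xyyy'', [(a, wd ''yxyy'')]),
     (wd ''xyxyxyy'', [(a, wd ''xyxyyxy'')]), (wd ''xyxyyxyyxyy'', map (\<lambda>v. (q v, v)) tails47)]"
    and a: "a \<noteq> 0"
  shows "q (wd ''yxyyxyyxyyx'') = 0" "q (wd ''yyxyxyyxyyx'') = 0" "q (wd ''yyxyyxyxyyx'') = 0"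
    "q (wd ''xyyxyyxyyxy'') = a * a * a - a * a * q (wd ''xyyxyxyyxyy'') - a * q (wd ''xyyxyyxyxyy'')"
proof -
  define r1 where "r1 = [(a, wd ''xyx'')]"
  define r2 where "r2 = [(a, wd ''yxyy'')]"
  define r3 where "r3 = [(a, wd ''xyxyyxy'')]"
  define r4 where "r4 = map (\<lambda>v. (q v, v)) tails47"
  note R = R[folded r1_def r2_def r3_def r4_def]
  have ex: "expand u w k r1 = [(k * a, u @ wd ''xyx'' @ w)]" "expand u w k r2 = [(k * a, u @ wd ''yxyy'' @ w)]"
    "expand u w k r3 = [(k * a, u @ wd ''xyxyyxy'' @ w)]"
    "expand u w k r4 = map (\<lambda>v. (k * q v, u @ v @ w)) tails47" for u w k
    by (simp_all add: r1_def r2_def r3_def r4_def expand_def)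
  have "rows_agree [wd ''xyyxyyxyyxyy'', wd ''yxyyxyyxyyxy'']
    (reduce (head4 r1 r2 r3 r4) 35 (expand [] (wd ''y'') 1 r4)) (reduce (head4 r1 r2 r3 r4) 35 (expand (wd ''xyxyyxyy'') [] 1 r2))"
    by (rule overlap[OF R, of _ "wd ''xyxyyxyyxyy''" _ "wd ''xyyy''"]) (simp_all add: head4_def)
  then have 1: "q (wd ''xyyxyyxyyxy'') = a * a * a - a * a * q (wd ''xyyxyxyyxyy'') - a * q (wd ''xyyxyyxyxyy'') \<and>
    q (wd ''yxyyxyyxyyx'') = - (a * q (wd ''yxyxyyxyxyy'') + q (wd ''yxyxyyxyyxy'')) * q (wd ''xyyxyyxyyxy'')"
    by (simp (no_asm_use) only: code ex tails47_def) (auto simp: algebra_simps eq_neg_iff_add_eq_0)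
  have "rows_agree [wd ''yxyxyyxyxyyx'', wd ''yxyxyyxyyxyx'', wd ''xyyxyxyyxyyx'', wd ''xyyxyyxyxyyx'']
    (reduce (head4 r1 r2 r3 r4) 35 (expand (wd ''x'') [] 1 r4)) (reduce (head4 r1 r2 r3 r4) 35 (expand [] (wd ''xyyxyyxyy'') 1 r1))"
    by (rule overlap[OF R, of _ "wd ''xyxyyxyyxyy''" _ "wd ''xxy''"]) (simp_all add: head4_def)
  then have 2: "q (wd ''yxyyxyyxyyx'') * q (wd ''yxyxyyxyxyy'') = 0 \<and> q (wd ''yxyyxyyxyyx'') * q (wd ''yxyxyyxyyxy'') = 0 \<and>
    q (wd ''yxyyxyyxyyx'') * q (wd ''xyyxyxyyxyy'') + q (wd ''yyxyxyyxyyx'') = 0 \<and>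
    q (wd ''yxyyxyyxyyx'') * q (wd ''xyyxyyxyxyy'') + q (wd ''yyxyyxyxyyx'') = 0"
    by (simp (no_asm_use) only: code ex tails47_def)
  \<comment> \<open>This coefficient is a combination of two coefficients that it annihilates, so
    its square is zero.\<close>
  have "q (wd ''yxyyxyyxyyx'') * q (wd ''yxyyxyyxyyx'') = - (a * (q (wd ''yxyyxyyxyyx'') * q (wd ''yxyxyyxyxyy''))
      + q (wd ''yxyyxyyxyyx'') * q (wd ''yxyxyyxyyxy'')) * q (wd ''xyyxyyxyyxy'')"
    by (subst (2) conjunct2[OF 1]) (simp add: algebra_simps)
  also have "\<dots> = 0" using 2 by auto
  finally have 3: "q (wd ''yxyyxyyxyyx'') = 0" by simp
  show "q (wd ''yxyyxyyxyyx'') = 0" "q (wd ''yyxyxyyxyyx'') = 0" "q (wd ''yyxyyxyxyyx'') = 0"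
    using 2 3 by simp_all
  show "q (wd ''xyyxyyxyyxy'') = a * a * a - a * a * q (wd ''xyyxyxyyxyy'') - a * q (wd ''xyyxyyxyxyy'')"
    using 1 by blast
qed

text \<open>Rewriting \<open>xyxyxyyxyyxyy\<close> by the third rule gives \<open>a\<close> times
  the fifth lead; by the fourth rule the fifth lead appears with the coefficient of
  \<open>xyyxyxyyxyy\<close>. The hypothesis makes both terms cancel, whatever \<open>r\<close> is,
  and the remaining terms determine the fourth rule.\<close>

lemma overlap_3_4_4_7:
  assumes R: "rules_of I [(wd ''xxy'', [(a, wd ''xyx'')]), (wd ''xyyy'', [(a, wd ''yxyy'')]),
     (wd ''xyxyxyy'', [(a, wd ''xyxyyxy'')]), (wd ''xyxyyxyyxyy'', map (\<lambda>v. (q v, v)) tails47),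
     (wd ''xyxyyxyxyyxyy'', map (\<lambda>v. (r v, v)) tails58)]"
    and a: "a \<noteq> 0" "q (wd ''xyyxyxyyxyy'') = a"
    "q (wd ''xyyxyyxyyxy'') = a * a * a - a * a * q (wd ''xyyxyxyyxyy'') - a * q (wd ''xyyxyyxyxyy'')"
  shows "\<forall>v\<in>set tails47. q v = (if v = wd ''xyyxyxyyxyy'' then a else 0)"
proof -
  define r1 where "r1 = [(a, wd ''xyx'')]"
  define r2 where "r2 = [(a, wd ''yxyy'')]"
  define r3 where "r3 = [(a, wd ''xyxyyxy'')]"
  define r4 where "r4 = map (\<lambda>v. (q v, v)) tails47"
  define r5 where "r5 = map (\<lambda>v. (r v, v)) tails58"
  note R = R[folded r1_def r2_def r3_def r4_def r5_def]
  have ex: "expand u w k r1 = [(k * a, u @ wd ''xyx'' @ w)]" "expand u w k r2 = [(k * a, u @ wd ''yxyy'' @ w)]"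
    "expand u w k r3 = [(k * a, u @ wd ''xyxyyxy'' @ w)]"
    "expand u w k r4 = map (\<lambda>v. (k * q v, u @ v @ w)) tails47"
    "expand u w k r5 = map (\<lambda>v. (k * r v, u @ v @ w)) tails58" for u w k
    by (simp_all add: r1_def r2_def r3_def r4_def r5_def expand_def)
  have rows: "rows_agree tails58
    (reduce (head5 r1 r2 r3 r4 r5) 35 (expand [] (wd ''xyyxyy'') 1 r3)) (reduce (head5 r1 r2 r3 r4 r5) 35 (expand (wd ''xy'') [] 1 r4))"
    by (rule overlap[OF R, of _ "wd ''xyxyxyy''" _ "wd ''xyxyyxyyxyy''"]) (simp_all add: head5_def)
  have "rows_agree [wd ''xyxyyxyyxyxyy'']
    (reduce (head5 r1 r2 r3 r4 r5) 35 (expand [] (wd ''xyyxyy'') 1 r3)) (reduce (head5 r1 r2 r3 r4 r5) 35 (expand (wd ''xy'') [] 1 r4))"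
    by (rule overlap[OF R, of _ "wd ''xyxyxyy''" _ "wd ''xyxyyxyyxyy''"]) (simp_all add: head5_def)
  then have 1: "q (wd ''xyyxyyxyxyy'') = 0" using a(2)
    by (simp (no_asm_use) only: code ex tails47_def tails58_def) simp
  \<comment> \<open>This has to be known before the full comparison: \<open>xy\<close> followed by
    \<open>xyyxyyxyyxy\<close> contains the fourth lead, and rewriting it brings in quadratic
    terms.\<close>
  then have 2: "q (wd ''xyyxyyxyyxy'') = 0"
    using a by simp
  show ?thesis using rows a(1,2) 1 2
    by (simp (no_asm_use) only: code ex tails47_def tails58_def) auto
qed

text \<open>These are all words of \<open>tails58\<close> ending in \<open>yyx\<close>. The overlap
  \<open>xyxyyxyxyyxyyy\<close> with the second rule gives the first equation; the overlap
  \<open>xyxyxyyxyxyyxyy\<close> with the third rule gives the others after division by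
  \<open>a\<close>.\<close>

lemma overlap_5_8:
  assumes R: "rules_of I [(wd ''xxy'', [(a, wd ''xyx'')]), (wd ''xyyy'', [(a, wd ''yxyy'')]),
     (wd ''xyxyxyy'', [(a, wd ''xyxyyxy'')]), (wd ''xyxyyxyyxyy'', [(a, wd ''xyyxyxyyxyy'')]),
     (wd ''xyxyyxyxyyxyy'', map (\<lambda>v. (r v, v)) tails58)]"
    and a: "a \<noteq> 0"
  shows "r (wd ''xyyxyyxyyxyyx'') = 0" "r (wd ''yxyyxyxyyxyyx'') = 0"
     "r (wd ''yxyyxyyxyxyyx'') = 0"  "r (wd ''yyxyxyyxyxyyx'') = 0"
proof -
  define r1 where "r1 = [(a, wd ''xyx'')]"
  define r2 where "r2 = [(a, wd ''yxyy'')]"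
  define r3 where "r3 = [(a, wd ''xyxyyxy'')]"
  define r4 where "r4 = [(a, wd ''xyyxyxyyxyy'')]"
  define r5 where "r5 = map (\<lambda>v. (r v, v)) tails58"
  note R = R[folded r1_def r2_def r3_def r4_def r5_def]
  have ex: "expand u w k r1 = [(k * a, u @ wd ''xyx'' @ w)]" "expand u w k r2 = [(k * a, u @ wd ''yxyy'' @ w)]"
    "expand u w k r3 = [(k * a, u @ wd ''xyxyyxy'' @ w)]"
    "expand u w k r4 = [(k * a, u @ wd ''xyyxyxyyxyy'' @ w)]"
    "expand u w k r5 = map (\<lambda>v. (k * r v, u @ v @ w)) tails58" for u w k
    by (simp_all add: r1_def r2_def r3_def r4_def r5_def expand_def)
  have "rows_agree [wd ''xyyxyyxyyxyyxy'']
    (reduce (head5 r1 r2 r3 r4 r5) 35 (expand [] (wd ''y'') 1 r5)) (reduce (head5 r1 r2 r3 r4 r5) 35 (expand (wd ''xyxyyxyxyy'') [] 1 r2))"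
    by (rule overlap[OF R, of _ "wd ''xyxyyxyxyyxyy''" _ "wd ''xyyy''"]) (simp_all add: head5_def)
  then have 1: "r (wd ''xyyxyyxyyxyyx'') = 0"
    by (simp (no_asm_use) only: code ex tails58_def)
  have "rows_agree [wd ''xyyxyyxyxyyxyyx'', wd ''xyyxyyxyyxyxyyx'', wd ''yxyyxyxyyxyxyyx'']
    (reduce (head5 r1 r2 r3 r4 r5) 35 (expand [] (wd ''xyxyyxyy'') 1 r3)) (reduce (head5 r1 r2 r3 r4 r5) 35 (expand (wd ''xy'') [] 1 r5))"
    by (rule overlap[OF R, of _ "wd ''xyxyxyy''" _ "wd ''xyxyyxyxyyxyy''"]) (simp_all add: head5_def)
  then have "r (wd ''yxyyxyxyyxyyx'') = 0 \<and> r (wd ''yxyyxyyxyxyyx'') = 0 \<and> r (wd ''yyxyxyyxyxyyx'') = 0"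
    using 1 a by (simp (no_asm_use) only: code ex tails58_def) simp
  then show "r (wd ''yxyyxyxyyxyyx'') = 0" "r (wd ''yxyyxyyxyxyyx'') = 0" "r (wd ''yyxyxyyxyxyyx'') = 0"
    by blast+
  show "r (wd ''xyyxyyxyyxyyx'') = 0" by (fact 1)
qed

end

section \<open>Maps on the augmentation ideal\<close>

text \<open>The empty word gets the default value 0, which makes \<open>phi\<close> additive on the
  whole free algebra.\<close>

definition phi_mon :: "'k::comm_ring_1 free_alg \<Rightarrow> 'k free_alg \<Rightarrow> letter list \<Rightarrow> 'k free_alg" where
  "phi_mon u v w = (if w = [] then 0 else mon (butlast w) * (if last w = Lx then u else v))"

text \<open>On elements \<open>p x + q y\<close> without constant term this is the left linear map sending \<open>x\<close> to \<open>u\<close>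
  and \<open>y\<close> to \<open>v\<close>.\<close>

definition phi :: "'k::comm_ring_1 free_alg \<Rightarrow> 'k free_alg \<Rightarrow> 'k free_alg \<Rightarrow> 'k free_alg" where
  "phi u v f = (\<Sum>w\<in>keys f. Poly_Mapping.single [] (lookup f w) * phi_mon u v w)"

lemma phi_superset:
  assumes "finite A" "keys f \<subseteq> A"
  shows "phi u v f = (\<Sum>w\<in>A. Poly_Mapping.single [] (lookup f w) * phi_mon u v w)"
  unfolding phi_def using assms by (intro sum.mono_neutral_left) (auto simp: in_keys_iff)

lemma phi_zero [simp]: "phi u v 0 = 0"
  by (simp add: phi_def)

lemma phi_add: "phi u v (f + g) = phi u v f + phi u v g"
proof -
  let ?A = "keys f \<union> keys g"
  have "keys (f + g) \<subseteq> ?A" by (rule keys_add)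
  then show ?thesis
    by (simp add: phi_superset[of ?A] lookup_add single_add distrib_right sum.distrib)
qed

lemma phi_single: "phi u v (Poly_Mapping.single w c) = Poly_Mapping.single [] c * phi_mon u v w"
  by (cases "c = 0") (simp_all add: phi_def)

lemma phi_uminus: "phi u v (- f) = - phi u v f"
  using phi_add[of u v f "- f"] by (simp add: eq_neg_iff_add_eq_0 add.commute)

lemma phi_diff: "phi u v (f - g) = phi u v f - phi u v g"
  using phi_add[of u v f "- g"] by (simp add: phi_uminus)

lemma single_Nil_commute: "Poly_Mapping.single [] c * f = f * Poly_Mapping.single [] c"
  for f :: "'k::comm_ring_1 free_alg"
  by (induction f rule: free_alg_induct) (simp_all add: distrib_left distrib_right single_mult mult.commute)

lemma lookup_scalar: "lookup (Poly_Mapping.single [] c * f) w = c * lookup f w"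
  for f :: "'k::comm_ring_1 free_alg"
  by (induction f rule: free_alg_induct)
    (simp_all add: distrib_left lookup_add single_mult lookup_single when_def)

definition aug :: "'k::comm_ring_1 free_alg set" where
  "aug = {f. lookup f [] = 0}"

lemma aug_induct [consumes 1, case_names zero single add]:
  fixes f :: "'k::comm_ring_1 free_alg"
  assumes "f \<in> aug" "P 0" "\<And>w c. w \<noteq> [] \<Longrightarrow> P (Poly_Mapping.single w c)" "\<And>f g. P f \<Longrightarrow> P g \<Longrightarrow> P (f + g)"
  shows "P f"
proof -
  have "P (\<Sum>w\<in>A. Poly_Mapping.single w (lookup f w))" if "finite A" "[] \<notin> A" for A
    using that by (induction A) (auto simp: assms)
  moreover have "[] \<notin> keys f"
    using assms(1) by (simp add: aug_def in_keys_iff)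
  ultimately show ?thesis by (subst free_alg_sum) simp
qed

text \<open>A nonempty word keeps its last letter under left multiplication. The constant term is
  excluded because the empty word has no last letter to carry along.\<close>

lemma phi_left:
  assumes "f \<in> aug"
  shows "phi u v (g * f) = g * phi u v f"
  using assms
proof (induction rule: aug_induct)
  case (single w c)
  then have "phi_mon u v (p @ w) = mon p * phi_mon u v w" for p
    by (simp add: phi_mon_def butlast_append single_mult flip: mult.assoc)
  then show ?case
    by (induction g rule: free_alg_induct)
      (simp_all add: distrib_right phi_add phi_single single_mult flip: mult.assoc)
qed (simp_all add: phi_add distrib_left)

text \<open>The appended letter becomes the last one, so \<open>f\<close> itself is kept as a left
  factor. In particular elements of an ideal, followed by a letter, are sent into the ideal.\<close>

lemma phi_right: "phi u v (f * mon [l]) = f * (if l = Lx then u else v)"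
  by (induction f rule: free_alg_induct)
    (simp_all add: distrib_right phi_add phi_single single_mult phi_mon_def flip: mult.assoc)

lemma phi_scalar: "phi u v (Poly_Mapping.single [] c * f) = Poly_Mapping.single [] c * phi u v f"
  by (induction f rule: free_alg_induct)
    (simp_all add: distrib_left phi_add phi_single single_mult flip: mult.assoc)

text \<open>The value of \<open>w\<close> as a binary number, \<open>x\<close> and \<open>y\<close> being the digits 0 and 1.  Rewriting increases it,
  since each word of \<open>W\<^sub>6\<close> is smaller than all reduced words of its bidegree.\<close>

fun val :: "letter list \<Rightarrow> nat" where
  "val [] = 0"
| "val (l # w) = (if l = Ly then 2 ^ length w else 0) + val w"

lemma val_less: "val w < 2 ^ length w"
  by (induction w) auto

lemma val_append: "val (u @ v) = val u * 2 ^ length v + val v"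
  by (induction u) (auto simp: power_add algebra_simps)

lemma val_context: "val v < val v' \<Longrightarrow> length v = length v' \<Longrightarrow> val (p @ v @ q) < val (p @ v' @ q)"
  by (simp add: val_append)

lemma length_bidegree: "length w = fst (bidegree w) + snd (bidegree w)"
proof (induction w)
  case (Cons l w) then show ?case by (cases l) (simp_all add: bidegree_def)
qed (simp add: bidegree_def)

lemmas tails_def = tails21_def tails13_def tails34_def tails47_def tails58_def

lemma reduced_words_bidegree_leads:
  "reduced_words (bidegree (wd ''xxy'')) = set tails21"
  "reduced_words (bidegree (wd ''xyyy'')) = set tails13"
  "reduced_words (bidegree (wd ''xyxyxyy'')) = set tails34"
  "reduced_words (bidegree (wd ''xyxyyxyyxyy'')) = set tails47"
  "reduced_words (bidegree (wd ''xyxyyxyxyyxyy'')) = set tails58"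
  by (simp_all add: set_tails bidegree_def eval_nat_numeral)

lemma lead_smallest:
  assumes "l \<in> set leads" "v \<in> reduced_words (bidegree l)"
  shows "val l < val v"
proof -
  \<comment> \<open>The numbers 1, 7, 43, 731, 2907 are the values of the five leads.\<close>
  have "\<forall>v\<in>set tails21. 1 < val v" "\<forall>v\<in>set tails13. 7 < val v" "\<forall>v\<in>set tails34. 43 < val v"
    "\<forall>v\<in>set tails47. 731 < val v" "\<forall>v\<in>set tails58. 2907 < val v"
    by (simp_all add: tails_def)
  then show ?thesis
    using assms by (auto simp: leads_def reduced_words_bidegree_leads simp del: wd.simps) (auto)
qed

section \<open>From the five relations to the whole ideal\<close>

context reduced_basis
begin

lemma lookup_Ly_mult: "lookup (mon [Ly] * f) (Ly # w) = lookup f w"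
  by (induction f rule: free_alg_induct)
    (simp_all add: distrib_left lookup_add single_mult lookup_single when_def)

lemma keys_Ly_mult: "keys (mon [Ly] * f) \<subseteq> (#) Ly ` keys f"
  using keys_mult[of "mon [Ly]" f] by (auto simp: plus_list_def split: if_splits)

lemma I_sum: "(\<And>w. w \<in> A \<Longrightarrow> f w \<in> I) \<Longrightarrow> (\<Sum>w\<in>A. f w) \<in> I"
  by (induction A rule: infinite_finite_induct) (auto simp: I_zero I_add)

lemma exists_reduced: "\<exists>n. f - n \<in> I \<and> (\<forall>w\<in>keys n. reduced w)"
proof (induction f rule: free_alg_induct)
  case zero
  then show ?case by (intro exI[of _ 0]) (simp add: I_zero)
next
  case (single w c)
  have "Poly_Mapping.single [] c * (mon w - nf w) \<in> I"
    by (rule I_left[OF nf(1)])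
  moreover have "keys (Poly_Mapping.single [] c * nf w) \<subseteq> keys (nf w)"
    by (auto simp: in_keys_iff lookup_scalar)
  ultimately show ?case
    using nf(2)[of w]
    by (intro exI[of _ "Poly_Mapping.single [] c * nf w"]) (auto simp: algebra_simps single_mult reduced_words_def)
next
  case (add f g)
  then obtain m n where "f - m \<in> I" "\<forall>w\<in>keys m. reduced w" "g - n \<in> I" "\<forall>w\<in>keys n. reduced w"
    by blast
  moreover from this have "f + g - (m + n) \<in> I"
    using I_add[of "f - m" "g - n"] by (simp add: algebra_simps)
  moreover from calculation have "\<forall>w\<in>keys (m + n). reduced w"
    using keys_add[of m n] by blast
  ultimately show ?case by blast
qed

text \<open>No relation starts with \<open>y\<close>.\<close>

lemma Ly_left_regular:
  assumes "mon [Ly] * f \<in> I"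
  shows "f \<in> I"
proof -
  obtain n where n: "f - n \<in> I" "\<forall>w\<in>keys n. reduced w"
    using exists_reduced by blast
  have "mon [Ly] * f - mon [Ly] * (f - n) \<in> I"
    by (intro I_diff assms I_left n(1))
  then have "mon [Ly] * n \<in> I"
    by (simp add: algebra_simps)
  moreover have "\<forall>w\<in>keys (mon [Ly] * n). reduced w"
    using keys_Ly_mult[of n] n(2) by (auto simp: reduced_Cons)
  ultimately have "mon [Ly] * n = 0"
    by (rule reduced_independent)
  then have "n = 0"
    by (intro poly_mapping_eqI) (metis lookup_Ly_mult lookup_zero)
  then show ?thesis using n(1) by simp
qed

context
  fixes u v :: "'k free_alg"
begin

definition compatible :: "'k free_alg set" where
  "compatible = {f \<in> I. phi u v f \<in> I}"

lemma compatible_add: "f \<in> compatible \<Longrightarrow> g \<in> compatible \<Longrightarrow> f + g \<in> compatible"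
  by (simp add: compatible_def I_add phi_add)

lemma compatible_zero: "0 \<in> compatible"
  by (simp add: compatible_def I_zero)

lemma compatible_scalar: "f \<in> compatible \<Longrightarrow> Poly_Mapping.single [] c * f \<in> compatible"
  by (simp add: compatible_def I_left phi_scalar)

text \<open>On the left \<open>phi\<close> is linear. On the right it is not, but a nonempty right
  factor absorbs the difference: only its last letter is replaced, and \<open>f\<close> stays as a
  factor in \<open>I\<close>.\<close>

lemma compatible_context:
  assumes "f \<in> compatible" "f \<in> aug"
  shows "mon p * f * mon q \<in> compatible"
proof (cases q rule: rev_cases)
  case Nil
  then show ?thesis
    using assms by (simp add: compatible_def I_left phi_left flip: one_eq_mon)
next
  case (snoc q' l)
  have "mon p * f * mon q = mon p * f * mon q' * mon [l]"
    using snoc by (simp add: single_mult mult.assoc)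
  moreover have "mon p * f * mon q' \<in> I"
    using assms by (simp add: compatible_def I_left I_right)
  ultimately show ?thesis
    by (simp add: compatible_def phi_right I_right)
qed

text \<open>Reduction to normal form modulo \<open>compatible\<close> instead of \<open>I\<close>:
  the rewriting has to use only relations that \<open>phi\<close> maps into
  \<open>I\<close>.\<close>

definition reducible :: "'k free_alg set" where
  "reducible = {f. \<exists>n. f - n \<in> compatible \<and> (\<forall>w\<in>keys n. reduced w)}"

lemma reducible_add:
  assumes "f \<in> reducible" "g \<in> reducible"
  shows "f + g \<in> reducible"
proof -
  obtain m n where "f - m \<in> compatible" "\<forall>w\<in>keys m. reduced w" "g - n \<in> compatible" "\<forall>w\<in>keys n. reduced w"
    using assms by (auto simp: reducible_def)
  moreover from this have "f + g - (m + n) \<in> compatible"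
    using compatible_add[of "f - m" "g - n"] by (simp add: algebra_simps)
  moreover from calculation have "\<forall>w\<in>keys (m + n). reduced w"
    using keys_add[of m n] by blast
  ultimately show ?thesis
    unfolding reducible_def by blast
qed

lemma reducible_scalar:
  assumes "f \<in> reducible"
  shows "Poly_Mapping.single [] c * f \<in> reducible"
proof -
  obtain n where n: "f - n \<in> compatible" "\<forall>w\<in>keys n. reduced w"
    using assms by (auto simp: reducible_def)
  have "keys (Poly_Mapping.single [] c * n) \<subseteq> keys n"
    by (auto simp: in_keys_iff lookup_scalar)
  moreover have "Poly_Mapping.single [] c * f - Poly_Mapping.single [] c * n \<in> compatible"
    using compatible_scalar[OF n(1)] by (simp add: algebra_simps)
  ultimately show ?thesis
    unfolding reducible_def using n(2) by blast
qed

lemma compatible_reducible: "f \<in> compatible \<Longrightarrow> f \<in> reducible"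
  unfolding reducible_def by (rule CollectI, rule exI[of _ 0]) simp

lemma rule_aug: "l \<in> set leads \<Longrightarrow> mon l - nf l \<in> aug"
proof -
  assume l: "l \<in> set leads"
  have "[] \<notin> keys (nf l)"
  proof
    assume "[] \<in> keys (nf l)"
    then have "bidegree [] = bidegree l"
      using nf(2)[of l] by (auto simp: reduced_words_def)
    then show False
      using l length_bidegree[of l] length_bidegree[of "[]"] leads_nonempty by auto
  qed
  then show ?thesis
    using leads_nonempty[OF l] by (simp add: aug_def lookup_minus lookup_single in_keys_iff)
qed

text \<open>Rewriting raises \<open>val\<close>, which stays below \<open>2 ^ length w\<close>, so
  induction on the gap applies. Only words of the same length and at least the same value are met;
  hence it is enough that the leads in \<open>L\<close> suffice for those. This generality serves
  the proof that the fifth relation is redundant, where that relation may not be used.\<close>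

lemma reducible_word:
  assumes L: "L \<subseteq> set leads" "\<And>l. l \<in> L \<Longrightarrow> mon l - nf l \<in> compatible"
    and w: "\<And>w'. length w' = length w \<Longrightarrow> val w \<le> val w' \<Longrightarrow> \<not> reduced w' \<Longrightarrow> \<exists>l\<in>L. sublist l w'"
  shows "mon w \<in> reducible"
  using w
proof (induction "2 ^ length w - val w" arbitrary: w rule: less_induct)
  case less
  show ?case
  proof (cases "reduced w")
    case True
    then show ?thesis
      unfolding reducible_def by (intro CollectI exI[of _ "mon w"]) (simp add: compatible_zero)
  next
    case False
    then obtain l p q where l: "l \<in> L" and w: "w = p @ l @ q"
      using less.prems[of w] by (auto simp: sublist_def)
    have "mon (p @ v @ q) \<in> reducible" if v: "v \<in> keys (nf l)" for v
    proof (rule less.hyps)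
      have "v \<in> reduced_words (bidegree l)" using v nf(2)[of l] by blast
      then have 1: "val l < val v" "length v = length l"
        using lead_smallest[of l v] l L(1) length_bidegree[of v] length_bidegree[of l]
        by (auto simp: reduced_words_def)
      then have 2: "val w < val (p @ v @ q)" "length (p @ v @ q) = length w"
        using val_context[of l v p q] by (simp_all add: w)
      then show "2 ^ length (p @ v @ q) - val (p @ v @ q) < 2 ^ length w - val w"
        using val_less[of "p @ v @ q"] by simp
      show "\<exists>l\<in>L. sublist l w'" if "length w' = length (p @ v @ q)" "val (p @ v @ q) \<le> val w'" "\<not> reduced w'" for w'
        using less.prems[of w'] that 2 by simp
    qed
    then have *: "Poly_Mapping.single [] c * mon (p @ v @ q) \<in> reducible" if "v \<in> keys (nf l)" for v c
      using that reducible_scalar by blast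
    have "(\<Sum>v\<in>A. Poly_Mapping.single [] (lookup (nf l) v) * mon (p @ v @ q)) \<in> reducible"
      if "finite A" "A \<subseteq> keys (nf l)" for A
      using that
    proof (induction A)
      case empty
      then show ?case using compatible_reducible[OF compatible_zero] by simp
    next
      case (insert v A)
      then show ?case using reducible_add[OF *[of v] insert.IH] by simp
    qed
    from this[of "keys (nf l)"] have "(\<Sum>v\<in>keys (nf l). Poly_Mapping.single [] (lookup (nf l) v) * mon (p @ v @ q)) \<in> reducible"
      by simp
    moreover have "(\<Sum>v\<in>keys (nf l). Poly_Mapping.single [] (lookup (nf l) v) * mon (p @ v @ q)) = mon p * nf l * mon q"
      using arg_cong[OF free_alg_sum[of "nf l"], of "\<lambda>f. mon p * f * mon q"]
      by (simp add: sum_distrib_left sum_distrib_right single_mult)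
    moreover have "mon p * (mon l - nf l) * mon q \<in> reducible"
      using L l rule_aug compatible_context compatible_reducible by blast
    ultimately have "mon p * (mon l - nf l) * mon q + mon p * nf l * mon q \<in> reducible"
      using reducible_add by simp
    then show ?thesis
      by (simp add: w algebra_simps single_mult)
  qed
qed

text \<open>Reduce \<open>f\<close> by compatible relations to a combination \<open>n\<close> of
  reduced words. As \<open>f\<close> lies in \<open>I\<close>, so does \<open>n\<close>, hence
  \<open>n = 0\<close> and \<open>f\<close> itself is compatible.\<close>

lemma all_compatible:
  assumes "\<And>l. l \<in> set leads \<Longrightarrow> phi u v (mon l - nf l) \<in> I"
    and "f \<in> I"
  shows "phi u v f \<in> I"
proof -
  have "mon w \<in> reducible" for w
  proof (rule reducible_word[of "set leads"])
    show "mon l - nf l \<in> compatible" if "l \<in> set leads" for l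
      using that assms(1) nf(1) by (simp add: compatible_def)
  qed (auto simp: reduced_def)
  then have "Poly_Mapping.single w c \<in> reducible" for w c
    using reducible_scalar[of "mon w" c] by (simp add: single_mult)
  then have "f \<in> reducible"
    by (induction f rule: free_alg_induct) (auto intro: reducible_add compatible_reducible compatible_zero)
  then obtain n where n: "f - n \<in> compatible" "\<forall>w\<in>keys n. reduced w"
    by (auto simp: reducible_def)
  then have "f - n \<in> I" by (simp add: compatible_def)
  from I_diff[OF assms(2) this] have "n = 0"
    using reduced_independent n(2) by simp
  then show ?thesis using n(1) by (simp add: compatible_def)
qed

end
end

section \<open>Classes in the first Ext group that are not annihilated by \<open>x\<close>\<close>

context reduced_basis
begin

text \<open>The map \<open>phi u v\<close> on the augmentation ideal of the quotient is a class in \<open>Ext\<^sup>1\<close>, homogeneous and not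
  annihilated by \<open>x\<close>.\<close>

definition obstruction :: "'k free_alg \<Rightarrow> 'k free_alg \<Rightarrow> bool" where
  "obstruction u v \<longleftrightarrow> (\<forall>f\<in>I. phi u v f \<in> I) \<and> (\<exists>k. \<forall>w\<in>keys u \<union> keys v. length w = k) \<and>
     \<not> (\<exists>g. u * mon [Lx] - mon [Lx] * g \<in> I \<and> v * mon [Lx] - mon [Ly] * g \<in> I)"

text \<open>Write \<open>w\<close> as \<open>p x\<close> followed by letters \<open>y\<close> only;
  these commute with \<open>yyy\<close>, which can therefore be moved next to the last
  \<open>x\<close>.\<close>

lemma word_yyy:
  assumes "mon (wd ''xyyy'') \<in> I" "Lx \<in> set w"
  shows "mon (w @ wd ''yyy'') \<in> I"
proof -
  have "\<exists>p k. w = p @ Lx # replicate k Ly"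
    using assms(2)
  proof (induction w rule: rev_induct)
    case (snoc l w)
    show ?case
    proof (cases l)
      case Lx
      then show ?thesis by (intro exI[of _ w] exI[of _ 0]) simp
    next
      case Ly
      then obtain p k where "w = p @ Lx # replicate k Ly"
        using snoc by auto
      then show ?thesis
        using Ly by (intro exI[of _ p] exI[of _ "Suc k"]) (simp add: replicate_append_same)
    qed
  qed simp
  then obtain p k where "w = p @ Lx # replicate k Ly" by blast
  moreover have "replicate k Ly @ wd ''yyy'' = wd ''yyy'' @ replicate k Ly"
    by (induction k) simp_all
  ultimately have "(mon (w @ wd ''yyy'') :: 'k free_alg) = mon p * mon (wd ''xyyy'') * mon (replicate k Ly)"
    by (simp add: single_mult)
  then show ?thesis
    using I_right[OF I_left[OF assms(1), of "mon p"], of "mon (replicate k Ly)"] by (simp del: wd.simps)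
qed

text \<open>If \<open>x y\<^sup>3 = 0\<close> then \<open>y\<^sup>3\<close> is killed by the ideal generated by \<open>x\<close>.\<close>

lemma obstruction_xyyy:
  assumes "mon (wd ''xyyy'') \<in> I"
  shows "obstruction 0 (mon (wd ''yyy''))"
proof -
  let ?v = "mon (wd ''yyy'') :: 'k free_alg"
  \<comment> \<open>A word ending in \<open>x\<close> is sent to 0. If it ends in \<open>y\<close>,
    an \<open>x\<close> remains before that letter and \<open>word_yyy\<close> applies.\<close>
  have word: "phi_mon 0 ?v w \<in> I" if "fst (bidegree w) > 0" for w
  proof (cases w rule: rev_cases)
    case (snoc w' l)
    show ?thesis
    proof (cases l)
      case Ly
      then have "Lx \<in> set w'"
        using that snoc by (auto simp: bidegree_def intro: ccontr)
      then show ?thesis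
        using word_yyy[OF assms, of w'] snoc Ly by (simp add: phi_mon_def single_mult)
    qed (use snoc I_zero in \<open>simp add: phi_mon_def\<close>)
  qed (use I_zero in \<open>simp add: phi_mon_def\<close>)
  have "phi 0 ?v (mon l - nf l) \<in> I" if "l \<in> set leads" for l
  proof -
    have l: "fst (bidegree l) > 0"
      using that by (auto simp: leads_def bidegree_def)
    have "phi 0 ?v (nf l) \<in> I"
      unfolding phi_def
    proof (rule I_sum)
      show "Poly_Mapping.single [] (lookup (nf l) w) * phi_mon 0 ?v w \<in> I" if "w \<in> keys (nf l)" for w
        using that nf(2)[of l] l by (intro I_left word) (auto simp: reduced_words_def)
    qed
    then show ?thesis
      using I_diff[OF I_left[OF word[OF l], of "mon []"]] by (simp add: phi_diff phi_single)
  qed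
  then have 1: "\<forall>f\<in>I. phi 0 ?v f \<in> I"
    using all_compatible by blast
  have "\<not> (?v * mon [Lx] - mon [Ly] * g \<in> I \<and> 0 * mon [Lx] - mon [Lx] * g \<in> I)" for g
  proof
    assume g: "?v * mon [Lx] - mon [Ly] * g \<in> I \<and> 0 * mon [Lx] - mon [Lx] * g \<in> I"
    \<comment> \<open>Cancelling \<open>y\<close> forces \<open>g\<close> to be \<open>yyx\<close>
      modulo \<open>I\<close>, and then \<open>x g\<close> is the reduced word \<open>xyyx\<close>,
      which is not 0.\<close>
    have "mon [Ly] * (mon (wd ''yyx'') - g) \<in> I"
      using g by (simp add: single_mult algebra_simps)
    then have "mon [Lx] * (mon (wd ''yyx'') - g) \<in> I"
      using Ly_left_regular I_left by blast
    from I_diff[OF this conjunct2[OF g]] have "mon (wd ''xyyx'') \<in> I"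
      by (simp add: single_mult algebra_simps)
    then have "mon (wd ''xyyx'') = (0::'k free_alg)"
      by (rule reduced_independent) (simp add: reduced_Cons lead_prefix_Lx)
    from arg_cong[OF this, of keys] show False by simp
  qed
  then show ?thesis
    using 1 unfolding obstruction_def by (auto intro!: exI[of _ 3])
qed

text \<open>The third relation with the prefix \<open>xy\<close> removed. By the first rule
  \<open>x\<close> kills it too: both terms of \<open>x u\<close> become multiples of
  \<open>xyxyxy\<close>, and they cancel.\<close>

definition u_elt :: "'k \<Rightarrow> 'k free_alg" where
  "u_elt a = lin [(1, wd ''xyxyy''), (- a, wd ''xyyxy'')]"

text \<open>With \<open>v = 0\<close> only words \<open>w' x\<close> count, and they go to
  \<open>w' u\<close>. If \<open>w'\<close> ends in \<open>x\<close> or in \<open>xy\<close>, this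
  is in \<open>I\<close>; the remaining ending \<open>yy\<close> is excluded by the assumption on
  \<open>c\<close>. The bound on the length provides the two letters before the last one.\<close>

lemma phi_nf_term:
  assumes u: "mon [Lx] * u \<in> I" "mon (wd ''xy'') * u \<in> I"
    and w: "length w \<ge> 3" "\<And>w'. w = w' @ wd ''yyx'' \<Longrightarrow> c = 0"
  shows "Poly_Mapping.single [] c * phi_mon u 0 w \<in> I"
proof (cases "c = 0 \<or> last w = Ly")
  case True
  then show ?thesis using I_zero by (auto simp: phi_mon_def)
next
  case False
  then have x: "last w = Lx" "c \<noteq> 0" by (cases "last w", auto)
  have "Suc (Suc (Suc 0)) \<le> length (rev w)" using w(1) by simp
  then obtain l3 l2 l1 ws where "rev w = l3 # l2 # l1 # ws"
    unfolding Suc_le_length_iff by blast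
  then have "w = rev ws @ [l1, l2, l3]"
    by (simp add: rev_eq_Cons_iff)
  then obtain w1 where w1: "w = w1 @ [l1, l2, Lx]"
    using x(1) by simp
  have "mon (w1 @ [l1, l2]) * u \<in> I"
  proof (cases l2)
    case Lx
    then show ?thesis
      using I_left[OF u(1), of "mon (w1 @ [l1])"] by (simp add: single_mult flip: mult.assoc)
  next
    case Ly
    then have "l1 = Lx"
      using w(2)[of w1] x(2) w1 by (cases l1) auto
    then show ?thesis
      using Ly I_left[OF u(2), of "mon w1"] by (simp add: single_mult flip: mult.assoc)
  qed
  then show ?thesis
    using I_left by (simp add: w1 phi_mon_def butlast_append)
qed

text \<open>The lead ends in \<open>y\<close> and is sent to 0, so only the normal form has to be
  checked, and there only the words ending in \<open>yyx\<close>.\<close>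

lemma phi_nf:
  assumes "mon [Lx] * u \<in> I" "mon (wd ''xy'') * u \<in> I"
    and "l \<in> set leads" "last l = Ly"
    and "\<And>w. w @ wd ''yyx'' \<in> reduced_words (bidegree l) \<Longrightarrow> lookup (nf l) (w @ wd ''yyx'') = 0"
  shows "phi u 0 (mon l - nf l) \<in> I"
proof -
  have "phi u 0 (nf l) \<in> I"
    unfolding phi_def
  proof (rule I_sum)
    fix w assume "w \<in> keys (nf l)"
    then have w: "w \<in> reduced_words (bidegree l)" using nf(2) by blast
    then have "length w = length l"
      using length_bidegree[of w] length_bidegree[of l] by (simp add: reduced_words_def)
    moreover have "length l \<ge> 3" using assms(3) by (auto simp: leads_def)
    ultimately show "Poly_Mapping.single [] (lookup (nf l) w) * phi_mon u 0 w \<in> I"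
      using assms w by (intro phi_nf_term) auto
  qed
  then show ?thesis
    using assms(4) leads_nonempty[OF assms(3)] I_uminus by (simp add: phi_diff phi_single phi_mon_def)
qed

lemma rules_of_lin_cong: "rules_of I [(l, r)] \<Longrightarrow> lin r = lin r' \<Longrightarrow> rules_of I [(l, r')]"
  by (simp add: rules_of_def)

lemma reducible_lin: "list_all (\<lambda>p. mon (snd p) \<in> reducible u v) xs \<Longrightarrow> lin xs \<in> reducible u v"
proof (induction xs)
  case Nil
  then show ?case using compatible_reducible[OF compatible_zero] by simp
next
  case (Cons p xs)
  then show ?case
    using reducible_scalar[of "mon (snd p)" u v "fst p"] by (simp add: lin_Cons reducible_add single_mult)
qed

lemma lin_nf:
  assumes "distinct vs" "reduced_words (bidegree l) = set vs"
  shows "lin (map (\<lambda>v. (lookup (nf l) v, v)) vs) = nf l"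
  using nf(2)[of l] assms by (intro lin_lookup) auto

text \<open>If the overlap of the third and fourth relation involves \<open>f\<^sub>6\<close>, then the fifth relation is
  a consequence of the others.\<close>

lemma fifth_relation_redundant:
  assumes rel: "mon (wd ''xyxyxyy'') - lin [(a, wd ''xyxyyxy'')] \<in> I"
    and l: "\<And>l. l \<in> set leads \<Longrightarrow> l \<noteq> wd ''xyxyyxyxyyxyy'' \<Longrightarrow> mon l - nf l \<in> compatible u v"
    and a: "lookup (nf (wd ''xyxyyxyyxyy'')) (wd ''xyyxyxyyxyy'') \<noteq> a"
  shows "mon (wd ''xyxyyxyxyyxyy'') - nf (wd ''xyxyyxyxyyxyy'') \<in> compatible u v"
proof -
  let ?l3 = "wd ''xyxyxyy''" and ?l4 = "wd ''xyxyyxyyxyy''" and ?l5 = "wd ''xyxyyxyxyyxyy''"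
  let ?first = "wd ''xyyxyxyyxyy''" and ?xy = "wd ''xy''" and ?w = "wd ''xyyxyy''"
  define q where "q = lookup (nf ?l4)"
  have leads: "?l3 \<in> set leads" "?l4 \<in> set leads" "?l5 \<in> set leads"
    by (simp_all add: leads_def)
  have "lin [(a, wd ''xyxyyxy'')] - nf ?l3 \<in> I"
    using I_diff[OF nf(1)[of ?l3] rel] by simp
  moreover have "keys (lin [(a, wd ''xyxyyxy'')] - nf ?l3) \<subseteq> {wd ''xyxyyxy''} \<union> keys (nf ?l3)"
    using keys_diff[of "lin [(a, wd ''xyxyyxy'')]" "nf ?l3"] by (auto simp: lin_Cons split: if_splits)
  moreover have "reduced (wd ''xyxyyxy'')"
    by (simp add: reduced_Cons lead_prefix_Lx)
  ultimately have "lin [(a, wd ''xyxyyxy'')] - nf ?l3 = 0"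
    using nf(2)[of ?l3] by (intro reduced_independent) (auto simp: reduced_words_def)
  then have nf3: "nf ?l3 = lin [(a, wd ''xyxyyxy'')]" by simp
  have tl: "tails47 = ?first # tl tails47"
    by (simp only: tails_def list.map list.sel)
  have nf4: "nf ?l4 = Poly_Mapping.single ?first (q ?first) + lin (map (\<lambda>v. (q v, v)) (tl tails47))"
    unfolding q_def using lin_nf[of tails47 ?l4] reduced_words_bidegree_leads(4)
    by (subst (asm) (2) tl) (simp add: lin_Cons tails_def)
  define rest where "rest = lin (expand ?xy [] 1 (map (\<lambda>v. (q v, v)) (tl tails47)))"
  have "mon ?xy * (mon ?l4 - nf ?l4) * mon [] \<in> compatible u v" "mon [] * (mon ?l3 - nf ?l3) * mon ?w \<in> compatible u v"
    by (intro compatible_context l rule_aug leads; simp)+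
  then have "mon ?xy * (mon ?l4 - nf ?l4) * mon [] + Poly_Mapping.single [] (- 1) * (mon [] * (mon ?l3 - nf ?l3) * mon ?w) \<in> compatible u v"
    by (intro compatible_add compatible_scalar)
  \<comment> \<open>The two leading words coincide and cancel. Both \<open>xy\<close> followed by
    \<open>?first\<close> and \<open>xyxyyxy\<close> followed by \<open>xyyxyy\<close> spell the
    fifth lead, so what remains is that lead with coefficient \<open>a - q ?first\<close>, nonzero
    by assumption, and the other tails.\<close>
  also have "mon ?xy * (mon ?l4 - nf ?l4) * mon [] + Poly_Mapping.single [] (- 1) * (mon [] * (mon ?l3 - nf ?l3) * mon ?w)
     = Poly_Mapping.single [] (a - q ?first) * mon ?l5 - rest"
    unfolding nf3 nf4 rest_def lin_expand
    by (simp add: lin_Cons single_mult algebra_simps single_diff single_uminus flip: one_eq_mon)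
  finally have 1: "Poly_Mapping.single [] (a - q ?first) * mon ?l5 - rest \<in> reducible u v"
    by (rule compatible_reducible)
  have "rest \<in> reducible u v"
    unfolding rest_def
  proof (rule reducible_lin)
    have "mon (?xy @ w) \<in> reducible u v" if w: "w \<in> set (tl tails47)" for w
    proof (rule reducible_word[of "set leads - {?l5}"])
      fix w' assume w': "length w' = length (?xy @ w)" "val (?xy @ w) \<le> val w'" "\<not> reduced w'"
      \<comment> \<open>Words of the length of the fifth lead contain it only if they are equal to
        it. All words here have a larger value, and rewriting increases the value further, so the
        fifth relation is never called for.\<close>
      have "list_all (\<lambda>w. length (?xy @ w) = length ?l5 \<and> val ?l5 < val (?xy @ w)) (tl tails47)"
        by (simp add: tails_def)
      then have "length w' = length ?l5" "val ?l5 < val w'"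
        using w w' unfolding list_all_iff by fastforce+
      then have "\<not> sublist ?l5 w'"
        by (auto simp: sublist_def simp del: wd.simps)
      then show "\<exists>l\<in>set leads - {?l5}. sublist l w'"
        using w'(3) by (auto simp: reduced_def)
    qed (use l in auto)
    then show "list_all (\<lambda>p. mon (snd p) \<in> reducible u v) (expand ?xy [] 1 (map (\<lambda>v. (q v, v)) (tl tails47)))"
      by (auto simp: list_all_iff expand_def)
  qed
  from reducible_add[OF 1 this] have "Poly_Mapping.single [] (a - q ?first) * mon ?l5 \<in> reducible u v"
    by simp
  from reducible_scalar[OF this, of "inverse (a - q ?first)"] have "mon ?l5 \<in> reducible u v"
    using a by (simp add: q_def single_mult del: wd.simps)
  then obtain n where n: "mon ?l5 - n \<in> compatible u v" "\<forall>w\<in>keys n. reduced w"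
    by (auto simp: reducible_def)
  have "mon ?l5 - n \<in> I"
    using n(1) by (simp add: compatible_def)
  from I_diff[OF this nf(1)[of ?l5]] have "nf ?l5 - n \<in> I" by simp
  moreover have "\<forall>w\<in>keys (nf ?l5 - n). reduced w"
    using n(2) nf(2)[of ?l5] keys_diff[of "nf ?l5" n] by (auto simp: reduced_words_def)
  ultimately have "nf ?l5 - n = 0" by (rule reduced_independent)
  then show ?thesis using n(1) by simp
qed

lemma obstruction_exists: "\<exists>u v. obstruction u v"
proof -
  let ?l1 = "wd ''xxy''" and ?l2 = "wd ''xyyy''"
  let ?l3 = "wd ''xyxyxyy''" and ?l4 = "wd ''xyxyyxyyxyy''" and ?l5 = "wd ''xyxyyxyxyyxyy''"
  define p where "p = lookup (nf ?l3)"
  define q where "q = lookup (nf ?l4)"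
  define r where "r = lookup (nf ?l5)"
  define a b c d e where "a = lookup (nf ?l1) (wd ''xyx'')" and "b = lookup (nf ?l1) (wd ''yxx'')"
    and "c = lookup (nf ?l2) (wd ''yxyy'')" and "d = lookup (nf ?l2) (wd ''yyxy'')" and "e = lookup (nf ?l2) (wd ''yyyx'')"
  have N1: "rules_of I [(?l1, [(a, wd ''xyx''), (b, wd ''yxx'')])]"
    using nf_rule[of tails21 ?l1] reduced_words_bidegree_leads(1)
    by (simp add: tails21_def a_def b_def del: wd.simps) (simp add: a_def)
  have N2: "rules_of I [(?l2, [(c, wd ''yxyy''), (d, wd ''yyxy''), (e, wd ''yyyx'')])]"
    using nf_rule[of tails13 ?l2] reduced_words_bidegree_leads(2)
    by (simp add: tails13_def c_def d_def e_def)
  have N3: "rules_of I [(?l3, map (\<lambda>v. (p v, v)) tails34)]"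
    using nf_rule[of tails34 ?l3] reduced_words_bidegree_leads(3) by (simp add: p_def tails_def)
  have N4: "rules_of I [(?l4, map (\<lambda>v. (q v, v)) tails47)]"
    using nf_rule[of tails47 ?l4] reduced_words_bidegree_leads(4) by (simp add: q_def tails_def)
  have N5: "rules_of I [(?l5, map (\<lambda>v. (r v, v)) tails58)]"
    using nf_rule[of tails58 ?l5] reduced_words_bidegree_leads(5) by (simp add: r_def tails_def)
  note cons = rules_of_Cons[THEN iffD2, OF conjI]
  have abcde: "a = c" "d = 0" "a * b = 0" "e * c = 0" "b * b * b = e * e"
    using overlap_2_3[OF cons[OF N1 N2]] by auto
  show ?thesis
  proof (cases "a = 0")
    case True
    have N1': "rules_of I [(?l1, [(b, wd ''yxx'')])]" and N2': "rules_of I [(?l2, [(e, wd ''yyyx'')])]"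
      using rules_of_lin_cong[OF N1] rules_of_lin_cong[OF N2] True abcde(1,2) by (simp_all add: lin_Cons)
    have "e = 0"
      by (rule overlap_3_4_a0(2)[OF cons[OF N1' cons[OF N2' N3]] abcde(5)])
    then have "mon (wd ''xyyy'') \<in> I"
      using N2' by (simp add: rules_of_def lin_Cons)
    then show ?thesis using obstruction_xyyy by blast
  next
    case False
    then have "b = 0" "c = a" "d = 0" "e = 0" using abcde by auto
    then have N1': "rules_of I [(?l1, [(a, wd ''xyx'')])]" and N2': "rules_of I [(?l2, [(a, wd ''yxyy'')])]"
      using rules_of_lin_cong[OF N1] rules_of_lin_cong[OF N2] by (simp_all add: lin_Cons)
    have p: "\<forall>v\<in>set tails34. p v = (if v = wd ''xyxyyxy'' then a else 0)"
      by (rule overlap_3_4[OF cons[OF N1' cons[OF N2' N3]] False])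
    then have "lin (map (\<lambda>v. (p v, v)) tails34) = lin [(a, wd ''xyxyyxy'')]"
      by (simp add: tails_def lin_Cons)
    from rules_of_lin_cong[OF N3 this] have N3': "rules_of I [(?l3, [(a, wd ''xyxyyxy'')])]" .
    note q = overlap_4_7[OF cons[OF N1' cons[OF N2' cons[OF N3' N4]]] False]
    define u where "u = u_elt a"
    have xu: "mon [Lx] * u \<in> I" "mon (wd ''xy'') * u \<in> I"
    proof -
      define r1 where "r1 = [(a, wd ''xyx'')]"
      define r2 where "r2 = [(a, wd ''yxyy'')]"
      define r3 where "r3 = [(a, wd ''xyxyyxy'')]"
      have ex: "expand v w k r1 = [(k * a, v @ wd ''xyx'' @ w)]" "expand v w k r2 = [(k * a, v @ wd ''yxyy'' @ w)]"
        "expand v w k r3 = [(k * a, v @ wd ''xyxyyxy'' @ w)]" for v w k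
        by (simp_all add: r1_def r2_def r3_def)
      have "sound I (head3 r1 r2 r3)"
        using rewrite_head_sound[OF two_sided cons[OF N1' cons[OF N2' N3']]]
        by (simp add: head3_def r1_def r2_def r3_def)
      note reduce = reduce_sound[OF two_sided this]
      have "reduce (head3 r1 r2 r3) 15 [(1, wd ''xxyxyy''), (- a, wd ''xxyyxy'')] =
          [(a * a, wd ''xyxyxy''), (- a * a, wd ''xyxyxy'')]"
        by (simp only: code ex)
      then show "mon [Lx] * u \<in> I"
        using reduce[of "[(1, wd ''xxyxyy''), (- a, wd ''xxyyxy'')]" 15]
        by (simp add: u_def u_elt_def lin_Cons single_mult algebra_simps flip: single_add)
      have "reduce (head3 r1 r2 r3) 15 [(1, wd ''xyxyxyy''), (- a, wd ''xyxyyxy'')] =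
          [(a, wd ''xyxyyxy''), (- a, wd ''xyxyyxy'')]"
        by (simp only: code ex)
      then show "mon (wd ''xy'') * u \<in> I"
        using reduce[of "[(1, wd ''xyxyxyy''), (- a, wd ''xyxyyxy'')]" 15]
        by (simp add: u_def u_elt_def lin_Cons single_mult algebra_simps flip: single_add)
    qed
    \<comment> \<open>This turns the condition on words ending in \<open>yyx\<close> into a finite
      check on the list of tails.\<close>
    have *: "lookup (nf l) (w @ wd ''yyx'') = 0"
      if "list_all (\<lambda>v. take 3 (rev v) = rev (wd ''yyx'') \<longrightarrow> lookup (nf l) v = 0) vs"
        "w @ wd ''yyx'' \<in> reduced_words (bidegree l)" "reduced_words (bidegree l) = set vs" for l w vs
      using that by (auto simp: list_all_iff)
    have phi1: "phi u 0 (mon ?l1 - nf ?l1) \<in> I"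
      by (rule phi_nf[OF xu _ _ *[of _ tails21, OF _ _ reduced_words_bidegree_leads(1)]])
        (simp_all add: leads_def tails_def)
    have phi2: "phi u 0 (mon ?l2 - nf ?l2) \<in> I"
      using \<open>e = 0\<close> unfolding e_def by (intro phi_nf[OF xu _ _ *[of _ tails13, OF _ _ reduced_words_bidegree_leads(2)]])
        (simp_all add: leads_def tails_def)
    have phi3: "phi u 0 (mon ?l3 - nf ?l3) \<in> I"
      using p unfolding p_def by (intro phi_nf[OF xu _ _ *[of _ tails34, OF _ _ reduced_words_bidegree_leads(3)]])
        (simp_all add: leads_def tails_def)
    have phi4: "phi u 0 (mon ?l4 - nf ?l4) \<in> I"
      using q unfolding q_def by (intro phi_nf[OF xu _ _ *[of _ tails47, OF _ _ reduced_words_bidegree_leads(4)]])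
        (simp_all add: leads_def tails_def)
    have phi5: "phi u 0 (mon ?l5 - nf ?l5) \<in> I"
    \<comment> \<open>Equality means that the fifth lead cancels in the overlap of the third and
      fourth rules. Otherwise the overlap can be solved for it.\<close>
    proof (cases "q (wd ''xyyxyxyyxyy'') = a")
      case True
      have q': "\<forall>v\<in>set tails47. q v = (if v = wd ''xyyxyxyyxyy'' then a else 0)"
        by (rule overlap_3_4_4_7[OF cons[OF N1' cons[OF N2' cons[OF N3' cons[OF N4 N5]]]] False True q(4)])
      then have "lin (map (\<lambda>v. (q v, v)) tails47) = lin [(a, wd ''xyyxyxyyxyy'')]"
        by (simp add: tails_def lin_Cons)
      from rules_of_lin_cong[OF N4 this] have N4': "rules_of I [(?l4, [(a, wd ''xyyxyxyyxyy'')])]" .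
      note overlap_5_8[OF cons[OF N1' cons[OF N2' cons[OF N3' cons[OF N4' N5]]]] False]
      then show ?thesis
        unfolding r_def by (intro phi_nf[OF xu _ _ *[of _ tails58, OF _ _ reduced_words_bidegree_leads(5)]])
          (simp_all add: leads_def tails_def)
    next
      case False
      have "mon ?l5 - nf ?l5 \<in> compatible u 0"
      proof (rule fifth_relation_redundant)
        show "mon ?l3 - lin [(a, wd ''xyxyyxy'')] \<in> I"
          using N3' by (simp add: rules_of_def)
        show "mon l - nf l \<in> compatible u 0" if "l \<in> set leads" "l \<noteq> ?l5" for l
        proof -
          have "l = ?l1 \<or> l = ?l2 \<or> l = ?l3 \<or> l = ?l4"
            using that by (simp only: leads_def list.set insert_iff empty_iff simp_thms)
          then have "phi u 0 (mon l - nf l) \<in> I"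
            by (elim disjE) (simp_all only: phi1 phi2 phi3 phi4)
          then show ?thesis
            using nf(1) by (simp add: compatible_def)
        qed
      qed (use False in \<open>simp add: q_def\<close>)
      then show ?thesis by (simp add: compatible_def)
    qed
    have "\<forall>f\<in>I. phi u 0 f \<in> I"
    proof (rule ballI, rule all_compatible)
      show "phi u 0 (mon l - nf l) \<in> I" if "l \<in> set leads" for l
      proof -
        have "l = ?l1 \<or> l = ?l2 \<or> l = ?l3 \<or> l = ?l4 \<or> l = ?l5"
          using that by (simp only: leads_def list.set insert_iff empty_iff simp_thms)
        then show ?thesis
          by (elim disjE) (simp_all only: phi1 phi2 phi3 phi4 phi5)
      qed
    qed
    moreover have "\<forall>w\<in>keys u \<union> keys 0. length w = 5"
      unfolding u_def u_elt_def using keys_add[of "mon (wd ''xyxyy'')" "Poly_Mapping.single (wd ''xyyxy'') (- a)"]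
      by (auto simp: lin_Cons split: if_splits)
    \<comment> \<open>Left cancellation of \<open>y\<close> puts \<open>g\<close> into
      \<open>I\<close>. Then \<open>u x\<close> would lie in \<open>I\<close>, although it is a
      combination of two distinct reduced words with a coefficient 1.\<close>
    moreover have "\<not> (u * mon [Lx] - mon [Lx] * g \<in> I \<and> 0 * mon [Lx] - mon [Ly] * g \<in> I)" for g
    proof
      assume g: "u * mon [Lx] - mon [Lx] * g \<in> I \<and> 0 * mon [Lx] - mon [Ly] * g \<in> I"
      then have "mon [Ly] * g \<in> I"
        using I_uminus[of "- (mon [Ly] * g)"] by simp
      then have "mon [Lx] * g \<in> I"
        using Ly_left_regular I_left by blast
      from I_add[OF conjunct1[OF g] this] have "u * mon [Lx] \<in> I" by simp
      then have "lin [(1, wd ''xyxyyx''), (- a, wd ''xyyxyx'')] - lin [] \<in> I"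
        by (simp add: u_def u_elt_def lin_Cons algebra_simps single_mult)
      from reduced_coef_cong[OF this, of "wd ''xyxyyx''"]
      show False
        by (simp add: all_reduced_def reduced_Cons lead_prefix_Lx)
    qed
    ultimately show ?thesis unfolding obstruction_def by blast
  qed
qed

end

section \<open>Cosets and generated ideals of the free algebra\<close>

lemma two_sided_Idl: "two_sided (Idl\<^bsub>free_ring\<^esub> (S :: 'k::comm_ring_1 free_alg set))"
  and Idl_superset: "S \<subseteq> Idl\<^bsub>free_ring\<^esub> S"
  and Idl_least: "two_sided I \<Longrightarrow> S \<subseteq> I \<Longrightarrow> Idl\<^bsub>free_ring\<^esub> S \<subseteq> I"
proof -
  interpret ring "free_ring :: 'k free_alg ring" by (rule ring_ring_of_type_algebra)
  show "two_sided (Idl\<^bsub>free_ring\<^esub> S)" "S \<subseteq> Idl\<^bsub>free_ring\<^esub> S"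
    "two_sided I \<Longrightarrow> S \<subseteq> I \<Longrightarrow> Idl\<^bsub>free_ring\<^esub> S \<subseteq> I"
    using genideal_ideal[of S] genideal_self[of S] genideal_minimal[of I S]
    by (simp_all add: ideal_free_ring_iff)
qed

lemma coset_eq: "I +>\<^bsub>free_ring\<^esub> f = (\<lambda>i. i + f) ` I" for f :: "'k::comm_ring_1 free_alg"
  by (auto simp: a_r_coset_def')

lemma coset_eq_iff:
  assumes "two_sided I"
  shows "I +>\<^bsub>free_ring\<^esub> f = I +>\<^bsub>free_ring\<^esub> g \<longleftrightarrow> f - g \<in> I"
proof
  assume "I +>\<^bsub>free_ring\<^esub> f = I +>\<^bsub>free_ring\<^esub> g"
  moreover have "f \<in> I +>\<^bsub>free_ring\<^esub> f"
    using two_sidedD(1)[OF assms] by (force simp: coset_eq)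
  ultimately show "f - g \<in> I" by (auto simp: coset_eq)
next
  have *: "I +>\<^bsub>free_ring\<^esub> f \<subseteq> I +>\<^bsub>free_ring\<^esub> g" if "f - g \<in> I" for f g
  proof
    fix h assume "h \<in> I +>\<^bsub>free_ring\<^esub> f"
    then have "h - g \<in> I"
      using two_sidedD(2)[OF assms _ that] by (fastforce simp: coset_eq algebra_simps)
    then show "h \<in> I +>\<^bsub>free_ring\<^esub> g"
      by (auto simp: coset_eq intro!: image_eqI[of _ _ "h - g"])
  qed
  assume "f - g \<in> I"
  then show "I +>\<^bsub>free_ring\<^esub> f = I +>\<^bsub>free_ring\<^esub> g"
    using * two_sidedD(5)[OF assms, of "f - g"] by force
qed

lemma coset_zero: "I +>\<^bsub>free_ring\<^esub> 0 = (I :: 'k::comm_ring_1 free_alg set)"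
  by (simp add: coset_eq)

lemma Quot_simps:
  fixes I :: "'k::comm_ring_1 free_alg set"
  assumes "two_sided I"
  shows "carrier (free_ring Quot I) = range (\<lambda>f. I +>\<^bsub>free_ring\<^esub> f)"
    "\<zero>\<^bsub>free_ring Quot I\<^esub> = I +>\<^bsub>free_ring\<^esub> 0"
    "\<one>\<^bsub>free_ring Quot I\<^esub> = I +>\<^bsub>free_ring\<^esub> 1"
    "(I +>\<^bsub>free_ring\<^esub> f) \<oplus>\<^bsub>free_ring Quot I\<^esub> (I +>\<^bsub>free_ring\<^esub> g) = I +>\<^bsub>free_ring\<^esub> (f + g)"
    "(I +>\<^bsub>free_ring\<^esub> f) \<otimes>\<^bsub>free_ring Quot I\<^esub> (I +>\<^bsub>free_ring\<^esub> g) = I +>\<^bsub>free_ring\<^esub> (f * g)"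
proof -
  interpret ideal I "free_ring :: 'k free_alg ring"
    using assms by (simp add: ideal_free_ring_iff)
  show "carrier (free_ring Quot I) = range (\<lambda>f. I +>\<^bsub>free_ring\<^esub> f)"
    by (auto simp: FactRing_def A_RCOSETS_def')
  show "\<zero>\<^bsub>free_ring Quot I\<^esub> = I +>\<^bsub>free_ring\<^esub> 0" "\<one>\<^bsub>free_ring Quot I\<^esub> = I +>\<^bsub>free_ring\<^esub> 1"
    by (simp_all add: FactRing_def coset_zero)
  show "(I +>\<^bsub>free_ring\<^esub> f) \<oplus>\<^bsub>free_ring Quot I\<^esub> (I +>\<^bsub>free_ring\<^esub> g) = I +>\<^bsub>free_ring\<^esub> (f + g)"
    using a_rcos_sum[of f g] by (simp add: FactRing_def)
  show "(I +>\<^bsub>free_ring\<^esub> f) \<otimes>\<^bsub>free_ring Quot I\<^esub> (I +>\<^bsub>free_ring\<^esub> g) = I +>\<^bsub>free_ring\<^esub> (f * g)"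
    using rcoset_mult_add[of f g] by (simp add: FactRing_def)
qed

section \<open>Bihomogeneous components and change of coefficients\<close>

lemma lookup_map: "g 0 = 0 \<Longrightarrow> lookup (Poly_Mapping.map g f) w = g (lookup f w)"
  by (simp add: map.rep_eq when_def)

lemma map_free_alg_hom:
  fixes g :: "'a::comm_ring_1 \<Rightarrow> 'b::comm_ring_1" and f h :: "'a free_alg"
  assumes g: "g 0 = 0" "\<And>a b. g (a + b) = g a + g b" "\<And>a b. g (a * b) = g a * g b"
  shows "Poly_Mapping.map g (f + h) = Poly_Mapping.map g f + Poly_Mapping.map g h"
    "Poly_Mapping.map g (f * h) = Poly_Mapping.map g f * Poly_Mapping.map g h"
proof -
  show add: "Poly_Mapping.map g (f + h) = Poly_Mapping.map g f + Poly_Mapping.map g h" for f h :: "'a free_alg"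
    by (rule poly_mapping_eqI) (simp add: lookup_map g lookup_add)
  have single: "Poly_Mapping.map g (Poly_Mapping.single w c) = Poly_Mapping.single w (g c)" for w :: "letter list" and c
    by (rule poly_mapping_eqI) (simp add: lookup_map g lookup_single when_def)
  have zero: "Poly_Mapping.map g (0::'a free_alg) = 0"
    by (rule poly_mapping_eqI) (simp add: lookup_map g)
  have "Poly_Mapping.map g (Poly_Mapping.single w c * h) = Poly_Mapping.single w (g c) * Poly_Mapping.map g h" for w c
    by (induction h rule: free_alg_induct) (simp_all add: zero single add distrib_left single_mult g)
  then show "Poly_Mapping.map g (f * h) = Poly_Mapping.map g f * Poly_Mapping.map g h"
    by (induction f rule: free_alg_induct) (simp_all add: zero single add distrib_right)
qed

definition comp :: "nat \<times> nat \<Rightarrow> 'k::comm_ring_1 free_alg \<Rightarrow> 'k free_alg" where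
  "comp b f = (\<Sum>w\<in>{w\<in>keys f. bidegree w = b}. Poly_Mapping.single w (lookup f w))"

lemma lookup_comp: "lookup (comp b f) w = (if bidegree w = b then lookup f w else 0)"
  by (auto simp: comp_def lookup_sum lookup_single when_def in_keys_iff)

lemma comp_bihomogeneous: "comp b f \<in> bihomogeneous b"
  by (auto simp: bihomogeneous_def in_keys_iff lookup_comp split: if_splits)

lemma comp_id: "f \<in> bihomogeneous b \<Longrightarrow> comp b' f = (if b' = b then f else 0)"
  by (intro poly_mapping_eqI) (auto simp: lookup_comp bihomogeneous_def in_keys_iff)

lemma comp_add: "comp b (f + g) = comp b f + comp b g"
  by (intro poly_mapping_eqI) (auto simp: lookup_comp lookup_add)

lemma comp_zero [simp]: "comp b 0 = 0"
  by (simp add: comp_def)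

lemma comp_single: "comp b (Poly_Mapping.single w c) = (if bidegree w = b then Poly_Mapping.single w c else 0)"
  by (intro poly_mapping_eqI) (auto simp: lookup_comp lookup_single when_def)

lemma comp_left: "comp b (Poly_Mapping.single u c * f) = (if fst (bidegree u) \<le> fst b \<and> snd (bidegree u) \<le> snd b
    then Poly_Mapping.single u c * comp (fst b - fst (bidegree u), snd b - snd (bidegree u)) f else 0)"
  by (induction f rule: free_alg_induct)
    (auto simp: distrib_left comp_add comp_single single_mult bidegree_append prod_eq_iff)

lemma comp_right: "comp b (f * Poly_Mapping.single u c) = (if fst (bidegree u) \<le> fst b \<and> snd (bidegree u) \<le> snd b
    then comp (fst b - fst (bidegree u), snd b - snd (bidegree u)) f * Poly_Mapping.single u c else 0)"
  by (induction f rule: free_alg_induct)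
    (auto simp: distrib_right comp_add comp_single single_mult bidegree_append prod_eq_iff)

text \<open>The elements all of whose components lie in \<open>J\<close> form a two-sided ideal,
  which contains the bihomogeneous generators.\<close>

lemma bihomogeneous_ideal_comp:
  assumes "bihomogeneous_ideal J" "f \<in> J"
  shows "comp b f \<in> J"
proof -
  have J: "two_sided J" "J = Idl\<^bsub>free_ring\<^esub> (\<Union>b. J \<inter> bihomogeneous b)"
    using assms(1) by (simp_all add: bihomogeneous_ideal_def ideal_free_ring_iff)
  note D = two_sidedD[OF J(1)]
  let ?I = "{f. \<forall>b. comp b f \<in> J}"
  have mult: "g * f \<in> ?I" "f * g \<in> ?I" if "f \<in> ?I" for f g
    using that by (induction g rule: free_alg_induct)
      (auto simp: distrib_left distrib_right comp_add comp_left comp_right D)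
  have "two_sided ?I"
    unfolding two_sided_def using mult D(1,2) by (simp add: comp_add)
  moreover have "(\<Union>b. J \<inter> bihomogeneous b) \<subseteq> ?I"
    using D(1) by (auto simp: comp_id)
  ultimately have "J \<subseteq> ?I"
    using Idl_least J(2) by blast
  then show ?thesis using assms(2) by blast
qed

text \<open>A monomial ideal is spanned by the words that contain a generator as a factor.\<close>

lemma F6_ideal_eq: "F6_ideal = {f :: 'k::field free_alg. \<forall>w\<in>keys f. \<not> reduced w}"
proof
  let ?I = "{f :: 'k free_alg. \<forall>w\<in>keys f. \<not> reduced w}"
  have mult: "\<not> reduced (u @ w)" "\<not> reduced (w @ u)" if "\<not> reduced w" for u w
    using that unfolding reduced_def by (meson sublist_appendI sublist_append_leftI sublist_append_rightI sublist_order.order.trans)+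
  have "two_sided ?I"
    unfolding two_sided_def
  proof (intro conjI ballI allI)
    fix f g assume "f \<in> ?I" "g \<in> ?I"
    then show "f + g \<in> ?I" using keys_add[of f g] by blast
  next
    fix f g :: "'k free_alg" assume "f \<in> ?I"
    have *: "\<exists>u v. w = u @ v \<and> u \<in> keys g \<and> v \<in> keys h" if "w \<in> keys (g * h)" for w and g h :: "'k free_alg"
      using that keys_mult[of g h] by (auto simp: plus_list_def)
    from \<open>f \<in> ?I\<close> show "g * f \<in> ?I" "f * g \<in> ?I"
      using mult by (auto dest!: *)
  qed simp
  moreover have "(\<lambda>w. mon w) ` fib_W6 \<subseteq> ?I"
    by (auto simp: reduced_def set_leads)
  ultimately show "F6_ideal \<subseteq> ?I"
    unfolding F6_ideal_def by (rule Idl_least)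
  have D: "two_sided (F6_ideal :: 'k free_alg set)"
    unfolding F6_ideal_def by (rule two_sided_Idl)
  have "Poly_Mapping.single w c \<in> (F6_ideal :: 'k free_alg set)" if w: "\<not> reduced w" for w c
  proof -
    obtain l p q where "l \<in> fib_W6" "w = p @ l @ q"
      using w by (auto simp: reduced_def sublist_def set_leads)
    moreover from this have "mon l \<in> (F6_ideal :: 'k free_alg set)"
      unfolding F6_ideal_def by (intro subsetD[OF Idl_superset] imageI)
    then have "Poly_Mapping.single p c * mon l * mon q \<in> (F6_ideal :: 'k free_alg set)"
      by (intro two_sidedD(3,4)[OF D])
    ultimately show ?thesis by (simp add: single_mult)
  qed
  moreover have "sum h A \<in> (F6_ideal :: 'k free_alg set)" if "\<And>w. w \<in> A \<Longrightarrow> h w \<in> F6_ideal" for h :: "letter list \<Rightarrow> 'k free_alg" and A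
    using that by (induction A rule: infinite_finite_induct) (auto simp: two_sidedD[OF D])
  ultimately have "(\<Sum>w\<in>keys f. Poly_Mapping.single w (lookup f w)) \<in> F6_ideal" if "f \<in> ?I" for f
    using that by simp
  then show "?I \<subseteq> F6_ideal"
    unfolding free_alg_sum[symmetric] by blast
qed

section \<open>The general fibre has the reduced words as a basis\<close>

lemma bigraded_component_simps:
  fixes J :: "'k::comm_ring_1 free_alg set"
  assumes J: "two_sided J"
  shows "carrier (bigraded_component J b) = (\<lambda>p. J +>\<^bsub>free_ring\<^esub> p) ` bihomogeneous b"
    "\<zero>\<^bsub>bigraded_component J b\<^esub> = J +>\<^bsub>free_ring\<^esub> 0"
    "(J +>\<^bsub>free_ring\<^esub> f) \<oplus>\<^bsub>bigraded_component J b\<^esub> (J +>\<^bsub>free_ring\<^esub> g) = J +>\<^bsub>free_ring\<^esub> (f + g)"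
    "c \<odot>\<^bsub>bigraded_component J b\<^esub> (J +>\<^bsub>free_ring\<^esub> f) = J +>\<^bsub>free_ring\<^esub> (Poly_Mapping.single [] c * f)"
  by (simp_all add: bigraded_component_def module_of_def Quot_simps[OF J])

lemma bihomogeneous_closed:
  shows "0 \<in> bihomogeneous b" "f \<in> bihomogeneous b \<Longrightarrow> g \<in> bihomogeneous b \<Longrightarrow> f + g \<in> bihomogeneous b"
    "f \<in> bihomogeneous b \<Longrightarrow> Poly_Mapping.single [] c * f \<in> bihomogeneous b"
    "f \<in> bihomogeneous b \<Longrightarrow> - f \<in> bihomogeneous b"
  using keys_add[of f g] by (auto simp: bihomogeneous_def in_keys_iff lookup_scalar)

lemma abelian_monoid_bigraded_component:
  assumes J: "two_sided J"
  shows "abelian_monoid (bigraded_component J b)"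
  by (rule abelian_monoidI)
    (auto simp: bigraded_component_simps[OF J] image_iff add_ac intro: bihomogeneous_closed)

lemma finsum_bigraded_component:
  assumes J: "two_sided J" and A: "finite A" "\<And>u. u \<in> A \<Longrightarrow> r u \<in> bihomogeneous b \<and> u = J +>\<^bsub>free_ring\<^esub> r u"
  shows "(\<Oplus>\<^bsub>bigraded_component J b\<^esub>u\<in>A. c u \<odot>\<^bsub>bigraded_component J b\<^esub> u) =
    J +>\<^bsub>free_ring\<^esub> (\<Sum>u\<in>A. Poly_Mapping.single [] (c u) * r u) \<and> (\<Sum>u\<in>A. Poly_Mapping.single [] (c u) * r u) \<in> bihomogeneous b"
  using A
proof (induction A)
  case empty
  then show ?case
    by (simp add: abelian_monoid.finsum_empty[OF abelian_monoid_bigraded_component[OF J]] bigraded_component_simps[OF J] bihomogeneous_closed)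
next
  case (insert u A)
  let ?M = "bigraded_component J b"
  have u: "c v \<odot>\<^bsub>?M\<^esub> v = J +>\<^bsub>free_ring\<^esub> (Poly_Mapping.single [] (c v) * r v)" "c v \<odot>\<^bsub>?M\<^esub> v \<in> carrier ?M"
    if "v \<in> insert u A" for v
    using insert.prems[OF that] bigraded_component_simps(4)[OF J, where b = b and c = "c v" and f = "r v"]
    by (auto simp: bigraded_component_simps(1)[OF J] intro!: bihomogeneous_closed)
  have "(\<Oplus>\<^bsub>?M\<^esub>v\<in>insert u A. c v \<odot>\<^bsub>?M\<^esub> v) = c u \<odot>\<^bsub>?M\<^esub> u \<oplus>\<^bsub>?M\<^esub> (\<Oplus>\<^bsub>?M\<^esub>v\<in>A. c v \<odot>\<^bsub>?M\<^esub> v)"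
    by (rule abelian_monoid.finsum_insert[OF abelian_monoid_bigraded_component[OF J]]) (use insert.hyps u(2) in auto)
  then show ?case
    using insert u(1)[of u] by (simp add: bigraded_component_simps(3)[OF J] bihomogeneous_closed)
qed

text \<open>If the class of \<open>f\<close> has coordinates \<open>a u\<close>, that of
  \<open>c f\<close> has coordinates \<open>c * a u\<close>. The latter class is 0, so by uniqueness
  of coordinates all \<open>c * a u\<close> vanish, hence all \<open>a u\<close>.\<close>

lemma torsion_free:
  fixes J :: "'k::idom free_alg set"
  assumes J: "two_sided J" and free: "free_finite_rank ring_of_type_algebra (bigraded_component J b)"
    and f: "f \<in> bihomogeneous b" "Poly_Mapping.single [] c * f \<in> J" "c \<noteq> 0"
  shows "f \<in> J"
proof -
  let ?M = "bigraded_component J b"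
  let ?P = "\<lambda>B m a. a \<in> B \<rightarrow>\<^sub>E carrier (ring_of_type_algebra :: 'k ring) \<and> m = (\<Oplus>\<^bsub>?M\<^esub>u\<in>B. a u \<odot>\<^bsub>?M\<^esub> u)"
  from free[unfolded free_finite_rank_def] obtain B where
    "finite B \<and> B \<subseteq> carrier ?M \<and> (\<forall>m\<in>carrier ?M. \<exists>!a. ?P B m a)" ..
  then have B: "finite B" "B \<subseteq> carrier ?M" and unique: "\<And>m. m \<in> carrier ?M \<Longrightarrow> \<exists>!a. ?P B m a"
    by blast+
  have UNIV: "carrier (ring_of_type_algebra :: 'k ring) = UNIV"
    by (simp add: ring_of_type_algebra_def)
  have "\<forall>u\<in>B. \<exists>r. r \<in> bihomogeneous b \<and> u = J +>\<^bsub>free_ring\<^esub> r"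
    using B(2) by (auto simp: bigraded_component_simps[OF J])
  then obtain r where r: "\<And>u. u \<in> B \<Longrightarrow> r u \<in> bihomogeneous b \<and> u = J +>\<^bsub>free_ring\<^esub> r u"
    by metis
  note sum = finsum_bigraded_component[OF J B(1) r, THEN conjunct1]
  have "J +>\<^bsub>free_ring\<^esub> f \<in> carrier ?M"
    using f(1) by (simp add: bigraded_component_simps[OF J])
  from ex1_implies_ex[OF unique[OF this]]
  obtain a where a: "J +>\<^bsub>free_ring\<^esub> f = (\<Oplus>\<^bsub>?M\<^esub>u\<in>B. a u \<odot>\<^bsub>?M\<^esub> u)"
    by (elim exE conjE)
  then have 1: "f - (\<Sum>u\<in>B. Poly_Mapping.single [] (a u) * r u) \<in> J"
    using sum[of a] coset_eq_iff[OF J] by simp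
  have "Poly_Mapping.single [] c * f - Poly_Mapping.single [] c * (f - (\<Sum>u\<in>B. Poly_Mapping.single [] (a u) * r u)) \<in> J"
    by (intro two_sidedD(3,6)[OF J] 1 f)
  then have "(\<Sum>u\<in>B. Poly_Mapping.single [] (c * a u) * r u) - 0 \<in> J"
    by (simp add: algebra_simps sum_distrib_left single_mult flip: mult.assoc)
  then have "J +>\<^bsub>free_ring\<^esub> (\<Sum>u\<in>B. Poly_Mapping.single [] (c * a u) * r u) = J +>\<^bsub>free_ring\<^esub> 0"
    using coset_eq_iff[OF J] by blast
  then have "J +>\<^bsub>free_ring\<^esub> 0 = (\<Oplus>\<^bsub>?M\<^esub>u\<in>B. (c * a u) \<odot>\<^bsub>?M\<^esub> u)" "J +>\<^bsub>free_ring\<^esub> 0 = (\<Oplus>\<^bsub>?M\<^esub>u\<in>B. 0 \<odot>\<^bsub>?M\<^esub> u)"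
    using sum[of "\<lambda>u. c * a u"] sum[of "\<lambda>u. 0"] by simp_all
  \<comment> \<open>Coordinates are unique only among extensional functions, hence the restriction
    to \<open>B\<close>.\<close>
  moreover have "(\<Oplus>\<^bsub>?M\<^esub>u\<in>B. h u \<odot>\<^bsub>?M\<^esub> u) = (\<Oplus>\<^bsub>?M\<^esub>u\<in>B. restrict h B u \<odot>\<^bsub>?M\<^esub> u)" for h
    using sum[of h] sum[of "restrict h B"] by simp
  ultimately have P: "?P B (J +>\<^bsub>free_ring\<^esub> 0) (restrict (\<lambda>u. c * a u) B)" "?P B (J +>\<^bsub>free_ring\<^esub> 0) (restrict (\<lambda>u. 0) B)"
    by (simp_all add: UNIV)
  have "J +>\<^bsub>free_ring\<^esub> 0 \<in> carrier ?M"
    by (simp add: bigraded_component_simps[OF J] imageI bihomogeneous_closed(1))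
  note unique = the1_equality[OF unique[OF this]]
  have "restrict (\<lambda>u. c * a u) B = restrict (\<lambda>u. 0) B"
    by (rule trans[OF unique[OF P(1), symmetric] unique[OF P(2)]])
  then have "a u = 0" if "u \<in> B" for u
    using that f(3) by (metis mult_eq_0_iff restrict_apply')
  then have "(\<Sum>u\<in>B. Poly_Mapping.single [] (a u) * r u) = 0"
    by simp
  then show ?thesis using 1 by simp
qed

section \<open>Clearing denominators between \<open>K[[t]]\<close> and \<open>K((t))\<close>\<close>

lemma scalar_mult_right: "Poly_Mapping.single [] c * (g * f) = g * (Poly_Mapping.single [] c * f)"
  for f g :: "'k::comm_ring_1 free_alg"
  by (metis mult.assoc single_Nil_commute)

definition to_fls :: "'k::field fps free_alg \<Rightarrow> 'k fls free_alg" where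
  "to_fls = Poly_Mapping.map fps_to_fls"

definition at_zero :: "'k::field fps free_alg \<Rightarrow> 'k free_alg" where
  "at_zero = Poly_Mapping.map (\<lambda>c. fps_nth c 0)"

lemma lookup_to_fls: "lookup (to_fls f) w = fps_to_fls (lookup f w)"
  and lookup_at_zero: "lookup (at_zero f) w = fps_nth (lookup f w) 0"
  by (simp_all add: to_fls_def at_zero_def lookup_map)

lemma to_fls_add: "to_fls (f + g) = to_fls f + to_fls g"
  and to_fls_mult: "to_fls (f * g) = to_fls f * to_fls g"
  unfolding to_fls_def by (intro map_free_alg_hom; simp add: fls_times_fps_to_fls)+

lemma fls_clear_denominator: "\<exists>n c'. fls_X ^ n * c = fps_to_fls c'" for c :: "'k::field fls"
proof -
  define n where "n = nat (- fls_subdegree c)"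
  have "int n \<ge> - fls_subdegree c" by (simp add: n_def)
  then obtain c' where c: "c = fls_shift (int n) (fps_to_fls c')"
    by (rule fls_as_fps)
  have "fls_X ^ n * c = fps_to_fls c'"
    unfolding fls_X_power_times_conv_shift by (subst c) simp
  then show ?thesis by blast
qed

lemma X_to_fls: "Poly_Mapping.single [] (fls_X ^ n) = to_fls (Poly_Mapping.single [] (fps_X ^ n) :: 'k::field fps free_alg)"
  by (rule poly_mapping_eqI) (simp add: lookup_to_fls lookup_single when_def fps_to_fls_power)

lemma clear_denominators: "\<exists>n g. Poly_Mapping.single [] (fls_X ^ n) * f = to_fls g" for f :: "'k::field fls free_alg"
proof (induction f rule: free_alg_induct)
  case zero
  have "to_fls 0 = (0 :: 'k fls free_alg)" by (rule poly_mapping_eqI) (simp add: lookup_to_fls)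
  then show ?case by (metis mult_zero_right)
next
  case (single w c)
  obtain n c' where "fls_X ^ n * c = fps_to_fls c'" using fls_clear_denominator by blast
  moreover have "to_fls (Poly_Mapping.single w c') = Poly_Mapping.single w (fps_to_fls c')"
    by (rule poly_mapping_eqI) (simp add: lookup_to_fls lookup_single when_def)
  ultimately show ?case by (metis append_Nil single_mult)
next
  case (add f g)
  then obtain m n f' g' where *: "Poly_Mapping.single [] (fls_X ^ m) * f = to_fls f'"
    "Poly_Mapping.single [] (fls_X ^ n) * g = to_fls g'" by blast
  have "Poly_Mapping.single [] (fls_X ^ (m + n)) * (f + g) =
      Poly_Mapping.single [] (fls_X ^ n) * (Poly_Mapping.single [] (fls_X ^ m) * f) +
      Poly_Mapping.single [] (fls_X ^ m) * (Poly_Mapping.single [] (fls_X ^ n) * g)"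
    by (simp add: distrib_left single_mult power_add mult.commute flip: mult.assoc)
  also have "\<dots> = to_fls (Poly_Mapping.single [] (fps_X ^ n) * f' + Poly_Mapping.single [] (fps_X ^ m) * g')"
    by (simp only: *) (simp only: to_fls_add to_fls_mult X_to_fls)
  finally show ?case by blast
qed

text \<open>The elements that some power of \<open>t\<close> carries into the image of
  \<open>J\<close> form a two-sided ideal containing that image. For closure under products the
  denominators of both factors are cleared.\<close>

lemma general_fibre_denominator:
  fixes J :: "'k::field fps free_alg set"
  assumes J: "two_sided J" and f: "f \<in> general_fibre J"
  shows "\<exists>n. \<exists>g\<in>J. Poly_Mapping.single [] (fls_X ^ n) * f = to_fls g"
proof -
  note D = two_sidedD[OF J]
  let ?I = "{f. \<exists>n. \<exists>g\<in>J. Poly_Mapping.single [] (fls_X ^ n) * f = to_fls g}"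
  have "two_sided ?I"
    unfolding two_sided_def
  proof (intro conjI ballI allI)
    have "to_fls 0 = (0 :: 'k fls free_alg)" by (rule poly_mapping_eqI) (simp add: lookup_to_fls)
    then show "0 \<in> ?I" using D(1) by (metis (mono_tags, lifting) mem_Collect_eq mult_zero_right)
  next
    fix f g assume "f \<in> ?I" "g \<in> ?I"
    then obtain m n f' g' where *: "f' \<in> J" "g' \<in> J" "Poly_Mapping.single [] (fls_X ^ m) * f = to_fls f'"
      "Poly_Mapping.single [] (fls_X ^ n) * g = to_fls g'" by blast
    have "Poly_Mapping.single [] (fls_X ^ (m + n)) * (f + g) =
        Poly_Mapping.single [] (fls_X ^ n) * (Poly_Mapping.single [] (fls_X ^ m) * f) +
        Poly_Mapping.single [] (fls_X ^ m) * (Poly_Mapping.single [] (fls_X ^ n) * g)"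
      by (simp add: distrib_left single_mult power_add mult.commute flip: mult.assoc)
    also have "\<dots> = to_fls (Poly_Mapping.single [] (fps_X ^ n) * f' + Poly_Mapping.single [] (fps_X ^ m) * g')"
      by (simp only: *) (simp only: to_fls_add to_fls_mult X_to_fls)
    finally show "f + g \<in> ?I" using D(2,3) * by blast
  next
    fix f h :: "'k fls free_alg" assume "f \<in> ?I"
    then obtain m f' where f: "f' \<in> J" "Poly_Mapping.single [] (fls_X ^ m) * f = to_fls f'" by blast
    obtain n h' where h: "Poly_Mapping.single [] (fls_X ^ n) * h = to_fls h'" using clear_denominators by blast
    have X: "Poly_Mapping.single [] (fls_X ^ (n + m)) =
        Poly_Mapping.single [] (fls_X ^ n) * (Poly_Mapping.single [] (fls_X ^ m) :: 'k fls free_alg)" for m n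
      by (simp add: single_mult power_add)
    have "Poly_Mapping.single [] (fls_X ^ (n + m)) * (h * f) =
        (Poly_Mapping.single [] (fls_X ^ n) * h) * (Poly_Mapping.single [] (fls_X ^ m) * f)"
      "Poly_Mapping.single [] (fls_X ^ (m + n)) * (f * h) =
        (Poly_Mapping.single [] (fls_X ^ m) * f) * (Poly_Mapping.single [] (fls_X ^ n) * h)"
      by (simp_all only: X mult.assoc scalar_mult_right[of _ h f] scalar_mult_right[of _ f h])
    then have "Poly_Mapping.single [] (fls_X ^ (n + m)) * (h * f) = to_fls (h' * f')"
      "Poly_Mapping.single [] (fls_X ^ (m + n)) * (f * h) = to_fls (f' * h')"
      by (simp_all add: f h to_fls_mult)
    then show "h * f \<in> ?I" "f * h \<in> ?I" using D(3,4)[OF f(1)] by blast+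
  qed
  moreover have "Poly_Mapping.map fps_to_fls ` J \<subseteq> ?I"
  proof
    fix f assume "f \<in> Poly_Mapping.map fps_to_fls ` J"
    then obtain g where "g \<in> J" "f = to_fls g" by (auto simp: to_fls_def)
    then have "g \<in> J" "Poly_Mapping.single [] (fls_X ^ 0) * f = to_fls g" by (simp_all flip: one_eq_mon)
    then show "f \<in> ?I" by blast
  qed
  ultimately show ?thesis
    using f Idl_least unfolding general_fibre_def by blast
qed

section \<open>Transfer of the monomial basis from the special to the general fibre\<close>

context
  fixes J :: "'k::field fps free_alg set"
  assumes deformation: "AS_regular_deformation F6_ideal J"
begin

lemma two_sided_J: "two_sided J"
  using deformation by (simp add: AS_regular_deformation_def bihomogeneous_ideal_def ideal_free_ring_iff)

lemma comp_J: "f \<in> J \<Longrightarrow> comp b f \<in> J"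
  using deformation bihomogeneous_ideal_comp[of J f b] by (simp add: AS_regular_deformation_def)

lemma free_J: "free_finite_rank ring_of_type_algebra (bigraded_component J b)"
  using deformation unfolding AS_regular_deformation_def by blast

lemma at_zero_J: "at_zero ` J = F6_ideal"
  using deformation by (simp add: AS_regular_deformation_def special_fibre_def at_zero_def)

text \<open>Take a nonzero bihomogeneous component and divide it by the largest power of
  \<open>t\<close> dividing all its coefficients. The quotient stays in \<open>J\<close> because the
  component of the algebra is torsion-free, and modulo \<open>t\<close> it becomes a nonzero element
  of \<open>F6_ideal\<close> supported on reduced words, a contradiction.\<close>

lemma J_reduced_independent:
  assumes "f \<in> J" "\<forall>w\<in>keys f. reduced w"
  shows "f = 0"
proof (rule ccontr)
  assume "f \<noteq> 0"
  then obtain v where v: "v \<in> keys f" by (metis all_not_in_conv keys_eq_empty)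
  define g where "g = comp (bidegree v) f"
  have g: "g \<in> J" "g \<in> bihomogeneous (bidegree v)" "keys g \<subseteq> keys f" "v \<in> keys g"
    using v comp_J[OF assms(1), of "bidegree v"] comp_bihomogeneous[of "bidegree v" f]
    by (auto simp: g_def in_keys_iff lookup_comp split: if_splits)
  define m where "m = Min ((\<lambda>w. subdegree (lookup g w)) ` keys g)"
  have m: "m \<in> (\<lambda>w. subdegree (lookup g w)) ` keys g" "\<And>w. w \<in> keys g \<Longrightarrow> m \<le> subdegree (lookup g w)"
    unfolding m_def using g(4) by (auto intro!: Min_in)
  define h where "h = Poly_Mapping.map (fps_shift m) g"
  have lookup_h: "lookup h w = fps_shift m (lookup g w)" for w
    by (simp add: h_def lookup_map)
  have "g = Poly_Mapping.single [] (fps_X ^ m) * h"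
  proof (rule poly_mapping_eqI)
    fix w show "lookup g w = lookup (Poly_Mapping.single [] (fps_X ^ m) * h) w"
      using m(2)[of w] fps_shift_times_fps_X_power[of m "lookup g w"]
      by (cases "w \<in> keys g") (auto simp: lookup_scalar lookup_h in_keys_iff mult.commute)
  qed
  moreover have "keys h \<subseteq> keys g"
    by (auto simp: in_keys_iff lookup_h)
  moreover from this have "h \<in> bihomogeneous (bidegree v)"
    using g(2) by (auto simp: bihomogeneous_def)
  ultimately have "h \<in> J"
    using torsion_free[OF two_sided_J free_J, of h "bidegree v" "fps_X ^ m"] g(1)
    by simp
  then have "at_zero h \<in> F6_ideal" using at_zero_J by blast
  moreover have "keys (at_zero h) \<subseteq> keys f"
  proof -
    have "keys (at_zero h) \<subseteq> keys h" by (auto simp: in_keys_iff lookup_at_zero)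
    then show ?thesis using \<open>keys h \<subseteq> keys g\<close> g(3) by blast
  qed
  ultimately have "keys (at_zero h) = {}"
    using assms(2) unfolding F6_ideal_eq by blast
  moreover obtain w where "w \<in> keys g" "m = subdegree (lookup g w)" using m(1) by blast
  then have "lookup (at_zero h) w \<noteq> 0"
    by (auto simp: lookup_at_zero lookup_h in_keys_iff)
  ultimately show False by (auto simp: in_keys_iff)
qed

lemma general_fibre_reduced_independent:
  assumes "f \<in> general_fibre J" "\<forall>w\<in>keys f. reduced w"
  shows "f = 0"
proof -
  obtain n g where g: "g \<in> J" "Poly_Mapping.single [] (fls_X ^ n) * f = to_fls g"
    using general_fibre_denominator[OF two_sided_J assms(1)] by blast
  have *: "fps_to_fls (lookup g w) = fls_X ^ n * lookup f w" for w
    using arg_cong[OF g(2), of "\<lambda>f. lookup f w"] by (simp add: lookup_scalar lookup_to_fls)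
  have "keys g \<subseteq> keys f"
    using * by (auto simp: in_keys_iff) (metis fps_to_fls_eq_0_iff mult_zero_right)
  then have "g = 0" using J_reduced_independent[OF g(1)] assms(2) by blast
  then show "f = 0"
    using * by (intro poly_mapping_eqI) (simp add: lookup_zero)
qed

text \<open>Gaussian elimination over the local ring \<open>K[[t]]\<close>: the coefficient matrix of the lifts of the
  nonreduced words is the identity modulo \<open>t\<close>.\<close>

lemma elimination:
  assumes "finite V" "V \<subseteq> {w. bidegree w = b \<and> \<not> reduced w}"
  shows "\<exists>g. \<forall>w. bidegree w = b \<and> \<not> reduced w \<longrightarrow> g w \<in> J \<and> g w \<in> bihomogeneous b \<and>
    (\<forall>v. fps_nth (lookup (g w) v) 0 = (if v = w then 1 else 0)) \<and> (\<forall>v\<in>V. lookup (g w) v = (if v = w then 1 else 0))"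
  using assms
proof (induction V)
  case empty
  have "\<exists>g. g \<in> J \<and> g \<in> bihomogeneous b \<and> (\<forall>v. fps_nth (lookup g v) 0 = (if v = w then 1 else 0))"
    if "bidegree w = b" "\<not> reduced w" for w
  proof -
    have "mon w \<in> (F6_ideal :: 'k free_alg set)" using that by (simp add: F6_ideal_eq)
    then obtain f where f: "f \<in> J" "at_zero f = mon w" using at_zero_J by (metis imageE)
    have "fps_nth (lookup f v) 0 = (if v = w then 1 else 0)" for v
      using arg_cong[OF f(2), of "\<lambda>f. lookup f v"] by (simp add: lookup_at_zero lookup_single when_def)
    then show ?thesis
      using that comp_J[OF f(1), of b] comp_bihomogeneous[of b f]
      by (intro exI[of _ "comp b f"]) (auto simp: lookup_comp)
  qed
  then have "\<forall>w. \<exists>g. bidegree w = b \<and> \<not> reduced w \<longrightarrow> g \<in> J \<and> g \<in> bihomogeneous b \<and>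
      (\<forall>v. fps_nth (lookup g v) 0 = (if v = w then 1 else 0))"
    by blast
  from choice[OF this] show ?case by simp
next
  case (insert u V)
  then obtain g where g: "\<And>w. bidegree w = b \<Longrightarrow> \<not> reduced w \<Longrightarrow> g w \<in> J \<and> g w \<in> bihomogeneous b \<and>
    (\<forall>v. fps_nth (lookup (g w) v) 0 = (if v = w then 1 else 0)) \<and> (\<forall>v\<in>V. lookup (g w) v = (if v = w then 1 else 0))"
    by auto
  note D = two_sidedD[OF two_sided_J]
  \<comment> \<open>The pivot has constant term 1 and so is a unit of \<open>K[[t]]\<close>.\<close>
  define h where "h = Poly_Mapping.single [] (inverse (lookup (g u) u)) * g u"
  have u: "bidegree u = b" "\<not> reduced u" using insert.prems by auto
  note gu = g[OF u]
  have inv: "inverse (lookup (g u) u) * lookup (g u) u = 1"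
    using gu by (intro inverse_mult_eq_1) simp
  have h: "h \<in> J" "h \<in> bihomogeneous b" "\<And>v. fps_nth (lookup h v) 0 = (if v = u then 1 else 0)"
    "lookup h u = 1" "\<And>v. v \<in> V \<Longrightarrow> lookup h v = 0"
    using gu inv insert.hyps by (auto simp: h_def D bihomogeneous_closed lookup_scalar)
  \<comment> \<open>For \<open>w \<noteq> u\<close> the coefficient of \<open>u\<close> in
    \<open>g w\<close> is divisible by \<open>t\<close>. Subtracting this multiple of
    \<open>h\<close> therefore keeps the matrix equal to the identity modulo
    \<open>t\<close>.\<close>
  define g' where "g' w = (if w = u then h else g w - Poly_Mapping.single [] (lookup (g w) u) * h)" for w
  have "g' w \<in> J \<and> g' w \<in> bihomogeneous b \<and> (\<forall>v. fps_nth (lookup (g' w) v) 0 = (if v = w then 1 else 0)) \<and>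
    (\<forall>v\<in>insert u V. lookup (g' w) v = (if v = w then 1 else 0))" if w: "bidegree w = b" "\<not> reduced w" for w
  proof (cases "w = u")
    case False
    have "g w + - (Poly_Mapping.single [] (lookup (g w) u) * h) \<in> bihomogeneous b"
      using g[OF w] h by (intro bihomogeneous_closed) auto
    then show ?thesis
      using False g[OF w] h insert.hyps by (auto simp: g'_def D lookup_minus lookup_scalar)
  qed (use h insert.hyps in \<open>auto simp: g'_def\<close>)
  then show ?case by blast
qed

lemma two_sided_general_fibre: "two_sided (general_fibre J)"
  unfolding general_fibre_def by (rule two_sided_Idl)

text \<open>Eliminate with respect to all nonreduced words of the bidegree, of which there are
  finitely many. The row belonging to \<open>w\<close> then contains \<open>w\<close> as its only
  nonreduced word, so subtracting it from \<open>w\<close> leaves a normal form.\<close>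

lemma general_fibre_span: "\<exists>n. mon w - n \<in> general_fibre J \<and> keys n \<subseteq> reduced_words (bidegree w)"
proof (cases "reduced w")
  case True
  then show ?thesis
    using two_sidedD(1)[OF two_sided_general_fibre]
    by (intro exI[of _ "mon w"]) (simp add: reduced_words_def)
next
  case False
  have letters: "l = Lx \<or> l = Ly" for l by (cases l) auto
  have "{v. bidegree v = bidegree w} \<subseteq> {v. set v \<subseteq> {Lx, Ly} \<and> length v = length w}"
    using letters by (auto simp: length_bidegree)
  then have "finite {v. bidegree v = bidegree w \<and> \<not> reduced v}"
    using finite_lists_length_eq[of "{Lx, Ly}" "length w"] by (auto intro: finite_subset)
  from elimination[OF this order.refl] obtain h where
    "\<forall>v. bidegree v = bidegree w \<and> \<not> reduced v \<longrightarrow> h v \<in> J \<and> h v \<in> bihomogeneous (bidegree w) \<and>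
      (\<forall>u. fps_nth (lookup (h v) u) 0 = (if u = v then 1 else 0)) \<and>
      (\<forall>u\<in>{u. bidegree u = bidegree w \<and> \<not> reduced u}. lookup (h v) u = (if u = v then 1 else 0))" ..
  from spec[OF this, of w] False obtain g where g: "g \<in> J" "g \<in> bihomogeneous (bidegree w)"
    "\<forall>v. bidegree v = bidegree w \<and> \<not> reduced v \<longrightarrow> lookup g v = (if v = w then 1 else 0)"
    by auto
  have "to_fls g \<in> general_fibre J"
    unfolding general_fibre_def to_fls_def using g(1) by (intro subsetD[OF Idl_superset] imageI)
  moreover have "keys (mon w - to_fls g) \<subseteq> reduced_words (bidegree w)"
  proof
    fix v assume v: "v \<in> keys (mon w - to_fls g)"
    then have "v = w \<or> v \<in> keys g"
      by (auto simp: in_keys_iff lookup_minus lookup_to_fls lookup_single when_def split: if_splits)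
    then have "bidegree v = bidegree w" using g(2) by (auto simp: bihomogeneous_def)
    moreover have "reduced v"
    proof (rule ccontr)
      assume "\<not> reduced v"
      then have "lookup g v = (if v = w then 1 else 0)"
        using g(3) \<open>bidegree v = bidegree w\<close> by blast
      then have "lookup (mon w - to_fls g) v = 0"
        by (simp add: lookup_minus lookup_to_fls lookup_single when_def)
      then show False using v by (simp add: in_keys_iff)
    qed
    ultimately show "v \<in> reduced_words (bidegree w)" by (simp add: reduced_words_def)
  qed
  ultimately show ?thesis
    by (intro exI[of _ "mon w - to_fls g"]) simp
qed

lemma general_fibre_reduced_basis: "reduced_basis (general_fibre J)"
  by unfold_locales (fact two_sided_general_fibre general_fibre_reduced_independent general_fibre_span)+

end

section \<open>Graded groups\<close>

locale graded_group = abelian_group M for M :: "('m, 'r) ring_scheme" (structure) +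
  fixes g :: "int \<Rightarrow> 'm set"
  assumes grading: "direct_sum_grading M g"
begin

definition cmp :: "'m \<Rightarrow> int \<Rightarrow> 'm" where
  "cmp m = (THE c. (\<forall>i. c i \<in> g i) \<and> finite {i. c i \<noteq> \<zero>} \<and> m = (\<Oplus>i\<in>{i. c i \<noteq> \<zero>}. c i))"

lemma subgroup_component: "additive_subgroup (g i) M"
  using grading by (simp add: direct_sum_grading_def)

lemmas component_subset = additive_subgroup.a_subset[OF subgroup_component]
  and component_zero = additive_subgroup.zero_closed[OF subgroup_component]
  and component_add = additive_subgroup.a_closed[OF subgroup_component]

lemma component_carrier: "x \<in> g i \<Longrightarrow> x \<in> carrier M"
  using component_subset by blast

lemma
  assumes "m \<in> carrier M"
  shows cmp_component: "cmp m i \<in> g i"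
    and cmp_finite: "finite {i. cmp m i \<noteq> \<zero>}"
    and cmp_sum: "m = (\<Oplus>i\<in>{i. cmp m i \<noteq> \<zero>}. cmp m i)"
    and cmp_unique: "\<And>c. (\<And>i. c i \<in> g i) \<Longrightarrow> finite {i. c i \<noteq> \<zero>} \<Longrightarrow> m = (\<Oplus>i\<in>{i. c i \<noteq> \<zero>}. c i) \<Longrightarrow> cmp m = c"
proof -
  have ex: "\<exists>!c. (\<forall>i. c i \<in> g i) \<and> finite {i. c i \<noteq> \<zero>} \<and> m = (\<Oplus>i\<in>{i. c i \<noteq> \<zero>}. c i)"
    using grading assms unfolding direct_sum_grading_def by blast
  from theI'[OF ex] show "cmp m i \<in> g i" "finite {i. cmp m i \<noteq> \<zero>}" "m = (\<Oplus>i\<in>{i. cmp m i \<noteq> \<zero>}. cmp m i)"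
    unfolding cmp_def by blast+
  show "cmp m = c" if "\<And>i. c i \<in> g i" "finite {i. c i \<noteq> \<zero>}" "m = (\<Oplus>i\<in>{i. c i \<noteq> \<zero>}. c i)" for c
    unfolding cmp_def by (rule the1_equality[OF ex]) (use that in blast)
qed

lemma cmp_carrier: "m \<in> carrier M \<Longrightarrow> cmp m i \<in> carrier M"
  using cmp_component component_carrier by blast

lemma finsum_support:
  assumes "finite S" "{i. c i \<noteq> \<zero>} \<subseteq> S" "\<And>i. c i \<in> carrier M"
  shows "(\<Oplus>i\<in>{i. c i \<noteq> \<zero>}. c i) = (\<Oplus>i\<in>S. c i)"
  using assms by (intro add.finprod_mono_neutral_cong_left) auto

lemma cmp_unique':
  assumes "finite S" "\<And>i. c i \<in> g i" "\<And>i. i \<notin> S \<Longrightarrow> c i = \<zero>" "m = (\<Oplus>i\<in>S. c i)"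
  shows "cmp m = c"
proof -
  have c: "c i \<in> carrier M" for i using assms(2) component_carrier by blast
  have "m \<in> carrier M" unfolding assms(4) using c by (intro finsum_closed) auto
  moreover have "{i. c i \<noteq> \<zero>} \<subseteq> S" using assms(3) by blast
  moreover from this have "m = (\<Oplus>i\<in>{i. c i \<noteq> \<zero>}. c i)"
    unfolding assms(4) using finsum_support[OF assms(1)] c by simp
  ultimately show ?thesis
    using assms(1,2) by (intro cmp_unique) (auto intro: finite_subset)
qed

lemma cmp_homogeneous: "x \<in> g i \<Longrightarrow> cmp x = (\<lambda>k. if k = i then x else \<zero>)"
  by (rule cmp_unique'[of "{i}"]) (auto simp: component_zero component_carrier)

lemma graded_induct [consumes 1, case_names homogeneous add]:
  assumes "x \<in> carrier M" "\<And>i x. x \<in> g i \<Longrightarrow> P x"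
    "\<And>x y. x \<in> carrier M \<Longrightarrow> y \<in> carrier M \<Longrightarrow> P x \<Longrightarrow> P y \<Longrightarrow> P (x \<oplus> y)"
  shows "P x"
proof -
  have c: "cmp x i \<in> carrier M" for i using assms(1) cmp_carrier by blast
  have "P (\<Oplus>i\<in>S. cmp x i)" if "finite S" for S
    using that
  proof (induction S)
    case empty
    then show ?case using assms(2)[OF component_zero] by simp
  next
    case (insert i S)
    then show ?case
      using assms(2)[OF cmp_component[OF assms(1)]] assms(3) c by (simp add: Pi_iff)
  qed
  then show ?thesis
    using cmp_sum[OF assms(1)] cmp_finite[OF assms(1)] by metis
qed

end

lemma additive_zero:
  assumes "abelian_group M" "abelian_group N"
    and f: "\<And>x y. x \<in> carrier M \<Longrightarrow> y \<in> carrier M \<Longrightarrow> f (x \<oplus>\<^bsub>M\<^esub> y) = f x \<oplus>\<^bsub>N\<^esub> f y" "f \<in> carrier M \<rightarrow> carrier N"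
  shows "f \<zero>\<^bsub>M\<^esub> = \<zero>\<^bsub>N\<^esub>"
proof -
  interpret M: abelian_group M by fact
  interpret N: abelian_group N by fact
  have z: "f \<zero>\<^bsub>M\<^esub> \<in> carrier N" using f(2) by auto
  then have "f \<zero>\<^bsub>M\<^esub> \<oplus>\<^bsub>N\<^esub> f \<zero>\<^bsub>M\<^esub> = f \<zero>\<^bsub>M\<^esub> \<oplus>\<^bsub>N\<^esub> \<zero>\<^bsub>N\<^esub>"
    using f(1)[of "\<zero>\<^bsub>M\<^esub>" "\<zero>\<^bsub>M\<^esub>"] by simp
  then show ?thesis using z by (simp add: N.add.l_cancel del: N.r_zero)
qed

lemma additive_finsum:
  assumes M: "abelian_group M" and N: "abelian_group N"
    and f: "\<And>x y. x \<in> carrier M \<Longrightarrow> y \<in> carrier M \<Longrightarrow> f (x \<oplus>\<^bsub>M\<^esub> y) = f x \<oplus>\<^bsub>N\<^esub> f y" "f \<in> carrier M \<rightarrow> carrier N"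
    and "finite S" and c: "\<And>i. i \<in> S \<Longrightarrow> c i \<in> carrier M"
  shows "f (\<Oplus>\<^bsub>M\<^esub>i\<in>S. c i) = (\<Oplus>\<^bsub>N\<^esub>i\<in>S. f (c i))"
proof -
  interpret M: abelian_group M by fact
  interpret N: abelian_group N by fact
  show ?thesis
    using assms(5) c
  proof (induction S)
    case (insert i S)
    then have "c \<in> S \<rightarrow> carrier M" "c i \<in> carrier M" "(\<lambda>i. f (c i)) \<in> S \<rightarrow> carrier N" "f (c i) \<in> carrier N"
      using f(2) by auto
    then show ?case
      using insert f(1)[of "c i" "finsum M c S"] M.finsum_closed[of c S] by simp
  qed (simp add: additive_zero[OF M N f])
qed

text \<open>Applying \<open>f\<close> to the decomposition of \<open>x\<close> gives a decomposition
  of \<open>f x\<close>, shifted by \<open>k\<close>; decompositions are unique. This serves for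
  multiplication by homogeneous elements and for maps of degree zero.\<close>

lemma cmp_additive:
  assumes M: "graded_group M g" and N: "graded_group N h"
    and f: "\<And>x y. x \<in> carrier M \<Longrightarrow> y \<in> carrier M \<Longrightarrow> f (x \<oplus>\<^bsub>M\<^esub> y) = f x \<oplus>\<^bsub>N\<^esub> f y" "f \<in> carrier M \<rightarrow> carrier N"
    and deg: "\<And>i. f ` g i \<subseteq> h (i + k)" and x: "x \<in> carrier M"
  shows "graded_group.cmp N h (f x) (i + k) = f (graded_group.cmp M g x i)"
proof -
  interpret M: graded_group M g by fact
  interpret N: graded_group N h by fact
  note f0 = additive_zero[OF M.abelian_group_axioms N.abelian_group_axioms f]
  let ?S = "{i. M.cmp x i \<noteq> \<zero>\<^bsub>M\<^esub>}"
  have "N.cmp (f x) = (\<lambda>i. f (M.cmp x (i - k)))"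
  proof (rule N.cmp_unique')
    show "finite ((\<lambda>i. i + k) ` ?S)" using M.cmp_finite[OF x] by simp
    show "f (M.cmp x (i - k)) \<in> h i" for i
      using deg[of "i - k"] M.cmp_component[OF x, of "i - k"] by auto
    show "f (M.cmp x (i - k)) = \<zero>\<^bsub>N\<^esub>" if "i \<notin> (\<lambda>i. i + k) ` ?S" for i
    proof -
      have "M.cmp x (i - k) = \<zero>\<^bsub>M\<^esub>" using that by (force simp: image_iff)
      then show ?thesis using f0 by simp
    qed
    have "f x = (\<Oplus>\<^bsub>N\<^esub>i\<in>?S. f (M.cmp x i))"
      using additive_finsum[OF M.abelian_group_axioms N.abelian_group_axioms f M.cmp_finite[OF x], of "M.cmp x"]
        arg_cong[OF M.cmp_sum[OF x], of f] M.cmp_carrier[OF x] by simp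
    also have "\<dots> = (\<Oplus>\<^bsub>N\<^esub>i\<in>(\<lambda>i. i + k) ` ?S. f (M.cmp x (i - k)))"
      using f(2) M.cmp_carrier[OF x] by (subst N.add.finprod_reindex) (auto simp: inj_on_def)
    finally show "f x = (\<Oplus>\<^bsub>N\<^esub>i\<in>(\<lambda>i. i + k) ` ?S. f (M.cmp x (i - k)))" .
  qed
  then show ?thesis by simp
qed

lemma (in graded_group) cmp_add:
  assumes x: "x \<in> carrier M" and y: "y \<in> carrier M"
  shows "cmp (x \<oplus> y) i = cmp x i \<oplus> cmp y i"
proof -
  let ?S = "{i. cmp x i \<noteq> \<zero>} \<union> {i. cmp y i \<noteq> \<zero>}"
  have S: "finite ?S" using cmp_finite x y by simp
  have "cmp (x \<oplus> y) = (\<lambda>i. cmp x i \<oplus> cmp y i)"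
  proof (rule cmp_unique'[OF S])
    have "x = (\<Oplus>i\<in>?S. cmp x i)" "y = (\<Oplus>i\<in>?S. cmp y i)"
      using cmp_sum[OF x] cmp_sum[OF y] finsum_support[OF S, of "cmp x"] finsum_support[OF S, of "cmp y"]
        cmp_carrier x y by auto
    then show "x \<oplus> y = (\<Oplus>i\<in>?S. cmp x i \<oplus> cmp y i)"
      using finsum_addf[of "cmp x" ?S "cmp y"] cmp_carrier x y by (simp add: Pi_iff)
  qed (use cmp_component component_add x y in auto)
  then show ?thesis by simp
qed

lemma (in graded_group) cmp_ext:
  assumes "x \<in> carrier M" "y \<in> carrier M" "\<And>i. cmp x i = cmp y i"
  shows "x = y"
proof -
  have "cmp x = cmp y" using assms(3) by blast
  then show ?thesis using cmp_sum[OF assms(1)] cmp_sum[OF assms(2)] by simp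
qed

section \<open>The trivial module of a connected graded algebra\<close>

locale conn_graded =
  fixes A :: "'a ring" (structure) and G :: "int \<Rightarrow> 'a set"
  assumes conn: "connected_graded_algebra A G"

sublocale conn_graded \<subseteq> ring A
  using conn by (simp add: connected_graded_algebra_def)

sublocale conn_graded \<subseteq> graded_group A G
  using conn by unfold_locales (simp add: connected_graded_algebra_def)

context conn_graded
begin

abbreviation aug_ideal ("\<mm>") where "\<mm> \<equiv> augmentation_ideal A G"

lemma component_mult: "a \<in> G i \<Longrightarrow> b \<in> G j \<Longrightarrow> a \<otimes> b \<in> G (i + j)"
  using conn by (simp add: connected_graded_algebra_def)

lemma component_negative: "i < 0 \<Longrightarrow> G i = {\<zero>}"
  using conn by (simp add: connected_graded_algebra_def)

lemma subfield_0: "subfield (G 0) A"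
  using conn by (simp add: connected_graded_algebra_def)

lemma one_component: "\<one> \<in> G 0"
  by (rule subringE(3)[OF subfieldE(1)[OF subfield_0]])

lemma cmp_left:
  assumes "a \<in> G k" "x \<in> carrier A"
  shows "cmp (a \<otimes> x) (i + k) = a \<otimes> cmp x i"
proof (rule cmp_additive[OF graded_group_axioms graded_group_axioms _ _ _ assms(2)])
  show "(\<lambda>x. a \<otimes> x) ` G i \<subseteq> G (i + k)" for i
    using component_mult[OF assms(1)] by (auto simp: add.commute)
qed (use assms component_carrier in \<open>auto simp: r_distr\<close>)

lemma cmp_right:
  assumes "a \<in> G k" "x \<in> carrier A"
  shows "cmp (x \<otimes> a) (i + k) = cmp x i \<otimes> a"
proof (rule cmp_additive[OF graded_group_axioms graded_group_axioms _ _ _ assms(2)])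
  show "(\<lambda>x. x \<otimes> a) ` G i \<subseteq> G (i + k)" for i
    using component_mult[OF _ assms(1)] by auto
qed (use assms component_carrier in \<open>auto simp: l_distr\<close>)

lemma cmp_zero: "cmp \<zero> i = \<zero>"
  using cmp_homogeneous[OF component_zero, of 0] by simp

lemma cmp_uminus: "x \<in> carrier A \<Longrightarrow> cmp (\<ominus> x) i = \<ominus> cmp x i"
  using cmp_add[of "\<ominus> x" x i] cmp_zero cmp_carrier[of x i] cmp_carrier[of "\<ominus> x" i]
  by (simp add: l_neg minus_equality)

text \<open>The generated subgroup becomes a condition on a single component, since components of
  negative degree vanish and those of positive degree are generators.\<close>

lemma aug_ideal_eq: "\<mm> = {a \<in> carrier A. cmp a 0 = \<zero>}"
proof
  have gens: "(\<Union>i\<in>{0<..}. G i) \<subseteq> carrier A" using component_carrier by blast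
  have "subgroup {a \<in> carrier A. cmp a 0 = \<zero>} (add_monoid A)"
    by (rule add.subgroupI) (auto simp: cmp_add cmp_zero cmp_uminus simp flip: a_inv_def)
  moreover have "(\<Union>i\<in>{0<..}. G i) \<subseteq> {a \<in> carrier A. cmp a 0 = \<zero>}"
    using gens cmp_homogeneous by fastforce
  ultimately show "\<mm> \<subseteq> {a \<in> carrier A. cmp a 0 = \<zero>}"
    unfolding augmentation_ideal_def by (rule add.generate_subgroup_incl[rotated])
  have sub: "subgroup \<mm> (add_monoid A)"
    unfolding augmentation_ideal_def using gens by (intro add.generate_is_subgroup) simp
  show "{a \<in> carrier A. cmp a 0 = \<zero>} \<subseteq> \<mm>"
  proof
    fix a assume a: "a \<in> {a \<in> carrier A. cmp a 0 = \<zero>}"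
    have m: "cmp a i \<in> \<mm>" for i
    proof (cases "i > 0")
      case True
      then have "cmp a i \<in> (\<Union>i\<in>{0<..}. G i)" using cmp_component a by blast
      then show ?thesis unfolding augmentation_ideal_def by (rule generate.incl)
    next
      case False
      then have "cmp a i = \<zero>"
        using a cmp_component[of a i] component_negative[of i] by (cases "i = 0") auto
      then show ?thesis using subgroup.one_closed[OF sub] by simp
    qed
    have "(\<Oplus>i\<in>S. cmp a i) \<in> \<mm>" if "finite S" for S
      using that
    proof (induction S)
      case (insert i S)
      then show ?case
        using m subgroup.m_closed[OF sub] cmp_carrier a by (simp add: Pi_iff)
    qed (use subgroup.one_closed[OF sub] in simp)
    from this[OF cmp_finite[of a]] cmp_sum[of a] a show "a \<in> \<mm>"
      by (metis (no_types, lifting) mem_Collect_eq)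
  qed
qed

lemma component_aug: "0 < i \<Longrightarrow> G i \<subseteq> \<mm>"
  using component_carrier by (auto simp: aug_ideal_eq cmp_homogeneous)

lemma cmp_mult_aug:
  assumes a: "a \<in> carrier A" and x: "x \<in> \<mm>"
  shows "cmp (a \<otimes> x) 0 = \<zero>" "cmp (x \<otimes> a) 0 = \<zero>"
proof -
  have x': "x \<in> carrier A" "cmp x 0 = \<zero>" using x by (auto simp: aug_ideal_eq)
  \<comment> \<open>The degree-zero part of a product with \<open>b\<close> involves only
    \<open>cmp x (- k)\<close>. For \<open>k < 0\<close> the factor \<open>b\<close> is 0; for
    \<open>k \<ge> 0\<close> the component of \<open>x\<close> vanishes.\<close>
  have neg: "cmp x (- k) = \<zero> \<or> b = \<zero>" if "b \<in> G k" for b k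
    using that x' cmp_component[of x "- k"] component_negative[of k] component_negative[of "- k"]
    by (cases "k = 0"; cases "k < 0") auto
  show "cmp (a \<otimes> x) 0 = \<zero>"
    using a
  proof (induction rule: graded_induct)
    case (homogeneous k b)
    then show ?case
      using cmp_left[of b k x "- k"] neg[of b k] x' component_carrier[of b k] by (auto simp: cmp_zero)
  next
    case (add b c)
    then show ?case using x' by (simp add: l_distr cmp_add)
  qed
  show "cmp (x \<otimes> a) 0 = \<zero>"
    using a
  proof (induction rule: graded_induct)
    case (homogeneous k b)
    then show ?case
      using cmp_right[of b k x "- k"] neg[of b k] x' component_carrier[of b k] by (auto simp: cmp_zero)
  next
    case (add b c)
    then show ?case using x' by (simp add: r_distr cmp_add)
  qed
qed

lemma aug_left: "a \<in> carrier A \<Longrightarrow> x \<in> \<mm> \<Longrightarrow> a \<otimes> x \<in> \<mm>"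
  and aug_right: "a \<in> carrier A \<Longrightarrow> x \<in> \<mm> \<Longrightarrow> x \<otimes> a \<in> \<mm>"
  using cmp_mult_aug by (auto simp: aug_ideal_eq)

lemma aug_carrier: "x \<in> \<mm> \<Longrightarrow> x \<in> carrier A"
  by (simp add: aug_ideal_eq)

lemma ideal_aug: "ideal \<mm> A"
proof (rule idealI[OF ring_axioms])
  show "subgroup \<mm> (add_monoid A)"
    unfolding augmentation_ideal_def using component_carrier
    by (intro add.generate_is_subgroup) auto
qed (use aug_left aug_right in auto)

sublocale aug: ideal \<mm> A
  by (rule ideal_aug)

lemma minus_cmp_aug:
  assumes a: "a \<in> carrier A"
  shows "a \<ominus> cmp a 0 \<in> \<mm>"
proof -
  have c: "cmp a 0 \<in> carrier A" using a by (rule cmp_carrier)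
  have "cmp (a \<oplus> \<ominus> cmp a 0) 0 = cmp a 0 \<oplus> \<ominus> cmp (cmp a 0) 0"
    using a c by (simp only: cmp_add cmp_uminus a_inv_closed)
  also have "cmp (cmp a 0) 0 = cmp a 0"
    by (simp add: cmp_homogeneous[OF cmp_component[OF a, of 0]])
  also have "cmp a 0 \<oplus> \<ominus> cmp a 0 = \<zero>"
    by (rule r_neg[OF c])
  finally have "cmp (a \<oplus> \<ominus> cmp a 0) 0 = \<zero>" .
  moreover have "a \<oplus> \<ominus> cmp a 0 \<in> carrier A"
    using a c by (intro a_closed a_inv_closed)
  ultimately show ?thesis
    unfolding aug_ideal_eq a_minus_def by blast
qed

lemma regular_simps [simp]:
  "carrier (regular_module A) = carrier A" "\<zero>\<^bsub>regular_module A\<^esub> = \<zero>"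
  "x \<oplus>\<^bsub>regular_module A\<^esub> y = x \<oplus> y" "a \<odot>\<^bsub>regular_module A\<^esub> x = a \<otimes> x"
  by (simp_all add: regular_module_def module_of_def)

lemma regular_coset: "N +>\<^bsub>regular_module A\<^esub> x = N +> x"
  by (simp add: a_r_coset_def')

abbreviation triv where "triv \<equiv> trivial_module A G"

lemma coset_aug_iff:
  assumes "a \<in> carrier A" "b \<in> carrier A"
  shows "\<mm> +> a = \<mm> +> b \<longleftrightarrow> a \<ominus> b \<in> \<mm>"
  using quotient_eq_iff_same_a_r_cos[OF ideal_aug assms] by simp

lemma triv_simps:
  "carrier triv = (\<lambda>a. \<mm> +> a) ` carrier A" "\<zero>\<^bsub>triv\<^esub> = \<mm>"
  "a \<in> carrier A \<Longrightarrow> b \<in> carrier A \<Longrightarrow> (\<mm> +> a) \<oplus>\<^bsub>triv\<^esub> (\<mm> +> b) = \<mm> +> (a \<oplus> b)"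
  "a \<in> carrier A \<Longrightarrow> b \<in> carrier A \<Longrightarrow> a \<odot>\<^bsub>triv\<^esub> (\<mm> +> b) = \<mm> +> (a \<otimes> b)"
proof -
  show "carrier triv = (\<lambda>a. \<mm> +> a) ` carrier A"
    by (auto simp: trivial_module_def quotient_module_def module_of_def A_RCOSETS_def' regular_coset)
  show "\<zero>\<^bsub>triv\<^esub> = \<mm>"
    by (simp add: trivial_module_def quotient_module_def module_of_def)
  show "(\<mm> +> a) \<oplus>\<^bsub>triv\<^esub> (\<mm> +> b) = \<mm> +> (a \<oplus> b)" if "a \<in> carrier A" "b \<in> carrier A"
  proof -
    have "set_add (regular_module A) U V = set_add A U V" for U V
      by (simp add: set_add_def')
    then show ?thesis
      using aug.a_rcos_sum[OF that] by (simp add: trivial_module_def quotient_module_def module_of_def)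
  qed
  show "a \<odot>\<^bsub>triv\<^esub> (\<mm> +> b) = \<mm> +> (a \<otimes> b)" if "a \<in> carrier A" "b \<in> carrier A"
  proof -
    have "\<mm> +> (a \<otimes> x) = \<mm> +> (a \<otimes> b)" if x: "x \<in> \<mm> +> b" for x
    proof -
      obtain h where h: "h \<in> \<mm>" "x = h \<oplus> b" using x by (auto simp: a_r_coset_def')
      then have "a \<otimes> x \<ominus> a \<otimes> b = a \<otimes> h"
        using \<open>a \<in> carrier A\<close> \<open>b \<in> carrier A\<close> aug_carrier[of h] by (simp add: r_distr a_minus_def a_assoc r_neg)
      then show ?thesis
        using h \<open>a \<in> carrier A\<close> \<open>b \<in> carrier A\<close> aug_left aug_carrier coset_aug_iff by simp
    qed
    moreover have "b \<in> \<mm> +> b" using aug.a_rcos_self[OF that(2)] .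
    ultimately have "(\<Union>x\<in>\<mm> +> b. \<mm> +> (a \<otimes> x)) = \<mm> +> (a \<otimes> b)" by blast
    then show ?thesis
      by (simp add: trivial_module_def quotient_module_def module_of_def regular_coset)
  qed
qed

lemma coset_zero: "\<mm> +> \<zero> = \<mm>"
  by (rule a_coset_join2[OF zero_closed aug.a_subgroup aug.zero_closed])

lemma triv_zero_smult: "u \<in> carrier triv \<Longrightarrow> \<zero> \<odot>\<^bsub>triv\<^esub> u = \<mm>"
  using triv_simps(4)[of \<zero>] by (auto simp: triv_simps(1) coset_zero)

text \<open>Lifting along the surjection from \<open>A\<close> to \<open>triv\<close>. The summand
  \<open>P\<close> is first placed in a free module; there, representatives of the images of the
  basis elements are chosen and extended linearly.\<close>

lemma projective_lift:
  assumes P: "projective_module A P" and \<epsilon>: "\<epsilon> \<in> lmodule_hom A P triv"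
  obtains s where "s \<in> carrier P \<rightarrow> carrier A"
    "\<And>x y. x \<in> carrier P \<Longrightarrow> y \<in> carrier P \<Longrightarrow> s (x \<oplus>\<^bsub>P\<^esub> y) = s x \<oplus> s y"
    "\<And>a x. a \<in> carrier A \<Longrightarrow> x \<in> carrier P \<Longrightarrow> s (a \<odot>\<^bsub>P\<^esub> x) = a \<otimes> s x"
    "\<And>x. x \<in> carrier P \<Longrightarrow> \<mm> +> s x = \<epsilon> x"
proof -
  obtain B :: "'b set" and s' r where s': "s' \<in> lmodule_hom A P (free_module A B)"
    and r: "r \<in> lmodule_hom A (free_module A B) P" and rs: "\<And>x. x \<in> carrier P \<Longrightarrow> r (s' x) = x"
    using P by (auto simp: projective_module_def)
  let ?F = "free_module A B"
  define e where "e b = (\<lambda>b'\<in>B. if b' = b then \<one> else \<zero>)" for b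
  have F_simps: "carrier ?F = {f \<in> B \<rightarrow>\<^sub>E carrier A. finite {b \<in> B. f b \<noteq> \<zero>}}"
    "f \<oplus>\<^bsub>?F\<^esub> h = (\<lambda>b\<in>B. f b \<oplus> h b)" "c \<odot>\<^bsub>?F\<^esub> f = (\<lambda>b\<in>B. c \<otimes> f b)" for f h c
    by (simp_all add: free_module_def module_of_def)
  have e: "e b \<in> carrier ?F" if "b \<in> B" for b
  proof -
    have "{b' \<in> B. e b b' \<noteq> \<zero>} \<subseteq> {b}" by (auto simp: e_def)
    then show ?thesis by (auto simp: F_simps e_def finite_subset)
  qed
  define h where "h = \<epsilon> \<circ> r"
  have h: "h f \<in> carrier triv" "h (f \<oplus>\<^bsub>?F\<^esub> f') = h f \<oplus>\<^bsub>triv\<^esub> h f'" "h (c \<odot>\<^bsub>?F\<^esub> f) = c \<odot>\<^bsub>triv\<^esub> h f"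
    if "f \<in> carrier ?F" "f' \<in> carrier ?F" "c \<in> carrier A" for f f' c
    using that r \<epsilon> by (auto simp: h_def lmodule_hom_def PiE_iff)
  have "\<forall>b\<in>B. \<exists>a. a \<in> carrier A \<and> h (e b) = \<mm> +> a"
    using h(1)[OF e e zero_closed] by (fastforce simp: triv_simps(1))
  then obtain a where a: "\<And>b. b \<in> B \<Longrightarrow> a b \<in> carrier A" "\<And>b. b \<in> B \<Longrightarrow> h (e b) = \<mm> +> a b"
    by metis
  define t where "t f = (\<Oplus>b\<in>{b \<in> B. f b \<noteq> \<zero>}. f b \<otimes> a b)" for f
  have t_sum: "t f = (\<Oplus>b\<in>S. f b \<otimes> a b)" if "f \<in> B \<rightarrow> carrier A" "finite S" "S \<subseteq> B" "{b \<in> B. f b \<noteq> \<zero>} \<subseteq> S" for f S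
    unfolding t_def using that a(1) by (intro add.finprod_mono_neutral_cong_left) (auto simp: Pi_iff subset_iff)
  have t_closed: "t f \<in> carrier A" if "f \<in> B \<rightarrow> carrier A" for f
    unfolding t_def using that a(1) by (intro finsum_closed) auto
  have t_add: "t (f \<oplus>\<^bsub>?F\<^esub> f') = t f \<oplus> t f'" if "f \<in> carrier ?F" "f' \<in> carrier ?F" for f f'
  proof -
    let ?S = "{b \<in> B. f b \<noteq> \<zero>} \<union> {b \<in> B. f' b \<noteq> \<zero>}"
    have f: "f \<in> B \<rightarrow> carrier A" "f' \<in> B \<rightarrow> carrier A" "finite ?S" "?S \<subseteq> B"
      using that by (auto simp: F_simps)
    have "t (f \<oplus>\<^bsub>?F\<^esub> f') = (\<Oplus>b\<in>?S. (f \<oplus>\<^bsub>?F\<^esub> f') b \<otimes> a b)"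
      using f by (intro t_sum) (auto simp: F_simps)
    also have "\<dots> = (\<Oplus>b\<in>?S. f b \<otimes> a b \<oplus> f' b \<otimes> a b)"
      using f a(1) by (intro finsum_cong') (auto simp: F_simps Pi_iff l_distr)
    also have "\<dots> = (\<Oplus>b\<in>?S. f b \<otimes> a b) \<oplus> (\<Oplus>b\<in>?S. f' b \<otimes> a b)"
      using f a(1) by (intro finsum_addf) (auto simp: Pi_iff)
    also have "\<dots> = t f \<oplus> t f'"
      using t_sum[OF f(1,3,4)] t_sum[OF f(2,3,4)] by auto
    finally show ?thesis .
  qed
  have t_smult: "t (c \<odot>\<^bsub>?F\<^esub> f) = c \<otimes> t f" if "f \<in> carrier ?F" "c \<in> carrier A" for f c
  proof -
    let ?S = "{b \<in> B. f b \<noteq> \<zero>}"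
    have f: "f \<in> B \<rightarrow> carrier A" "finite ?S" "?S \<subseteq> B"
      using that by (auto simp: F_simps)
    have "t (c \<odot>\<^bsub>?F\<^esub> f) = (\<Oplus>b\<in>?S. (c \<odot>\<^bsub>?F\<^esub> f) b \<otimes> a b)"
      using f that(2) by (intro t_sum) (auto simp: F_simps)
    also have "\<dots> = (\<Oplus>b\<in>?S. c \<otimes> (f b \<otimes> a b))"
      using f a(1) that(2) by (intro finsum_cong') (auto simp: F_simps Pi_iff m_assoc)
    also have "\<dots> = c \<otimes> t f"
      unfolding t_def using f a(1) that(2) by (intro finsum_rdistr[symmetric]) (auto simp: Pi_iff)
    finally show ?thesis .
  qed
  \<comment> \<open>Induction on a finite set containing the support, splitting off one coordinate
    at a time, so that only additivity of \<open>h\<close> on two summands is used.\<close>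
  have h_t: "\<forall>f\<in>carrier ?F. {b \<in> B. f b \<noteq> \<zero>} \<subseteq> S \<longrightarrow> h f = \<mm> +> t f" if "finite S" "S \<subseteq> B" for S
    using that
  proof (induction S)
    case empty
    show ?case
    proof (intro ballI impI)
      fix f assume f: "f \<in> carrier ?F" "{b \<in> B. f b \<noteq> \<zero>} \<subseteq> {}"
      then have "f b = \<zero>" if "b \<in> B" for b using that by blast
      then have "f = \<zero> \<odot>\<^bsub>?F\<^esub> f"
        using f(1) by (intro ext) (auto simp: F_simps PiE_iff extensional_def)
      then have "h f = \<zero> \<odot>\<^bsub>triv\<^esub> h f"
        using h(3)[OF f(1) f(1) zero_closed] by simp
      then have "h f = \<mm>"
        using triv_zero_smult[OF h(1)[OF f(1) f(1) zero_closed]] by simp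
      moreover have "t f = \<zero>"
        using t_sum[of f "{}"] f by (auto simp: F_simps)
      ultimately show "h f = \<mm> +> t f" by (simp add: coset_zero)
    qed
  next
    case (insert b S)
    show ?case
    proof (intro ballI impI)
      fix f assume f: "f \<in> carrier ?F" "{b \<in> B. f b \<noteq> \<zero>} \<subseteq> insert b S"
      have b: "b \<in> B" "S \<subseteq> B" and fA: "f \<in> B \<rightarrow> carrier A" using insert.prems f(1) by (auto simp: F_simps)
      define f' where "f' = (\<lambda>b'\<in>B. if b' = b then \<zero> else f b')"
      have "{b' \<in> B. f' b' \<noteq> \<zero>} \<subseteq> {b' \<in> B. f b' \<noteq> \<zero>}" by (auto simp: f'_def)
      then have "finite {b' \<in> B. f' b' \<noteq> \<zero>}"
        by (rule finite_subset) (use f(1) in \<open>simp add: F_simps\<close>)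
      moreover have "f' \<in> B \<rightarrow>\<^sub>E carrier A" using fA by (auto simp: f'_def)
      ultimately have f': "f' \<in> carrier ?F" by (simp add: F_simps)
      have supp: "{b' \<in> B. f' b' \<noteq> \<zero>} \<subseteq> S" using f(2) by (auto simp: f'_def)
      have fb: "f b \<in> carrier A" using fA b by auto
      have eb: "f b \<odot>\<^bsub>?F\<^esub> e b \<in> carrier ?F"
      proof -
        have "{b' \<in> B. (f b \<odot>\<^bsub>?F\<^esub> e b) b' \<noteq> \<zero>} \<subseteq> {b}" using fb by (auto simp: F_simps e_def)
        then have "finite {b' \<in> B. (f b \<odot>\<^bsub>?F\<^esub> e b) b' \<noteq> \<zero>}"
          by (rule finite_subset) simp
        moreover have "f b \<odot>\<^bsub>?F\<^esub> e b \<in> B \<rightarrow>\<^sub>E carrier A"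
          using fb by (auto simp: F_simps e_def)
        ultimately show ?thesis by (simp only: F_simps(1)) blast
      qed
      have "f = f' \<oplus>\<^bsub>?F\<^esub> (f b \<odot>\<^bsub>?F\<^esub> e b)"
      proof
        fix b' show "f b' = (f' \<oplus>\<^bsub>?F\<^esub> (f b \<odot>\<^bsub>?F\<^esub> e b)) b'"
          using f(1) fb fA by (cases "b' \<in> B") (auto simp: F_simps f'_def e_def PiE_iff extensional_def Pi_iff)
      qed
      then have "h f = h f' \<oplus>\<^bsub>triv\<^esub> f b \<odot>\<^bsub>triv\<^esub> h (e b)"
        using h(2)[OF f' eb fb] h(3)[OF e[OF b(1)] e[OF b(1)] fb] by simp
      also have "h f' = \<mm> +> t f'"
        using insert.IH[OF b(2)] f' supp by blast
      also have "f b \<odot>\<^bsub>triv\<^esub> h (e b) = \<mm> +> (f b \<otimes> a b)"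
        using a[OF b(1)] fb by (simp add: triv_simps(4))
      also have "(\<mm> +> t f') \<oplus>\<^bsub>triv\<^esub> (\<mm> +> (f b \<otimes> a b)) = \<mm> +> (t f' \<oplus> f b \<otimes> a b)"
        using t_closed[of f'] f' a(1)[OF b(1)] fb by (intro triv_simps(3)) (auto simp: F_simps)
      also have "t f' \<oplus> f b \<otimes> a b = t f"
      proof -
        have "t f' = (\<Oplus>b\<in>S. f' b \<otimes> a b)"
          using f' supp b insert.hyps by (intro t_sum) (auto simp: F_simps)
        also have "\<dots> = (\<Oplus>b\<in>S. f b \<otimes> a b)"
          using insert.hyps b fA a(1) by (intro finsum_cong') (auto simp: f'_def Pi_iff subset_iff)
        moreover have "t f = (\<Oplus>b\<in>insert b S. f b \<otimes> a b)"
          using f fA b insert.hyps by (intro t_sum) auto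
        moreover have "\<dots> = f b \<otimes> a b \<oplus> (\<Oplus>b\<in>S. f b \<otimes> a b)"
          using insert.hyps fA a(1) b by (intro finsum_insert) (auto simp: Pi_iff subset_iff)
        moreover have "(\<Oplus>b\<in>S. f b \<otimes> a b) \<in> carrier A" "f b \<otimes> a b \<in> carrier A"
          using fA a(1) b fb by (auto intro!: finsum_closed simp: Pi_iff subset_iff)
        ultimately show ?thesis by (simp add: a_comm)
      qed
      finally show "h f = \<mm> +> t f" .
    qed
  qed
  show thesis
  proof
    have s'_F: "s' x \<in> carrier ?F" if "x \<in> carrier P" for x
      using s' that by (auto simp: lmodule_hom_def)
    then have "s' x \<in> B \<rightarrow> carrier A" if "x \<in> carrier P" for x
      using that by (auto simp: F_simps)
    then show "t \<circ> s' \<in> carrier P \<rightarrow> carrier A"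
      using t_closed by auto
    show "(t \<circ> s') (x \<oplus>\<^bsub>P\<^esub> y) = (t \<circ> s') x \<oplus> (t \<circ> s') y" if "x \<in> carrier P" "y \<in> carrier P" for x y
      using s' t_add s'_F that by (auto simp: lmodule_hom_def)
    show "(t \<circ> s') (c \<odot>\<^bsub>P\<^esub> x) = c \<otimes> (t \<circ> s') x" if "c \<in> carrier A" "x \<in> carrier P" for c x
      using s' t_smult s'_F that by (auto simp: lmodule_hom_def)
    show "\<mm> +> (t \<circ> s') x = \<epsilon> x" if "x \<in> carrier P" for x
    proof -
      have "h (s' x) = \<mm> +> t (s' x)"
        using h_t[of "{b \<in> B. s' x b \<noteq> \<zero>}"] s'_F[OF that] by (auto simp: F_simps)
      then show ?thesis using rs[OF that] by (simp add: h_def)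
    qed
  qed
qed

end

context conn_graded
begin

lemma component_triv:
  assumes "i \<noteq> 0" "u \<in> trivial_grading A G i"
  shows "u = \<mm>"
proof -
  obtain a where a: "a \<in> G i" "u = \<mm> +> a"
    using assms(2) by (auto simp: trivial_grading_def quotient_grading_def regular_coset)
  have "a \<in> \<mm>"
    using a(1) assms(1) component_negative[of i] component_aug[of i] aug.zero_closed
    by (cases "i < 0") auto
  then show ?thesis
    using a aug_carrier a_coset_join2[OF _ aug.a_subgroup] by simp
qed

text \<open>The augmentation of a graded projective module lifts to a map of degree zero: take the degree
  zero part of an arbitrary lift.\<close>

lemma graded_projective_lift:
  assumes P: "projective_module A P" and gP: "graded_module A G P p"
    and \<epsilon>: "\<epsilon> \<in> graded_hom 0 A P p triv (trivial_grading A G)"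
  obtains s where "s \<in> carrier P \<rightarrow> carrier A"
    "\<And>x y. x \<in> carrier P \<Longrightarrow> y \<in> carrier P \<Longrightarrow> s (x \<oplus>\<^bsub>P\<^esub> y) = s x \<oplus> s y"
    "\<And>a x. a \<in> carrier A \<Longrightarrow> x \<in> carrier P \<Longrightarrow> s (a \<odot>\<^bsub>P\<^esub> x) = a \<otimes> s x"
    "\<And>x. x \<in> carrier P \<Longrightarrow> \<mm> +> s x = \<epsilon> x"
    "\<And>i x. x \<in> p i \<Longrightarrow> s x \<in> G i"
proof -
  have \<epsilon>_hom: "\<epsilon> \<in> lmodule_hom A P triv" and \<epsilon>_deg: "\<And>i x. x \<in> p i \<Longrightarrow> \<epsilon> x \<in> trivial_grading A G i"
    using \<epsilon> by (auto simp: graded_hom_def)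
  obtain t where t: "t \<in> carrier P \<rightarrow> carrier A"
    "\<And>x y. x \<in> carrier P \<Longrightarrow> y \<in> carrier P \<Longrightarrow> t (x \<oplus>\<^bsub>P\<^esub> y) = t x \<oplus> t y"
    "\<And>a x. a \<in> carrier A \<Longrightarrow> x \<in> carrier P \<Longrightarrow> t (a \<odot>\<^bsub>P\<^esub> x) = a \<otimes> t x"
    "\<And>x. x \<in> carrier P \<Longrightarrow> \<mm> +> t x = \<epsilon> x"
    by (rule projective_lift[OF P \<epsilon>_hom]) blast
  interpret P: left_module A P using gP by (simp add: graded_module_def)
  interpret P: graded_group P p
    using gP by unfold_locales (simp add: graded_module_def)
  have deg: "a \<odot>\<^bsub>P\<^esub> x \<in> p (i + k)" if "a \<in> G i" "x \<in> p k" for a x i k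
    using gP that by (simp add: graded_module_def)
  define c where "c x i = cmp (t (P.cmp x i)) i" for x i
  have t_closed: "t x \<in> carrier A" if "x \<in> carrier P" for x using t(1) that by auto
  have t0: "t \<zero>\<^bsub>P\<^esub> = \<zero>"
    by (rule additive_zero[OF P.M.abelian_group_axioms abelian_group_axioms t(2,1)])
  have c_comp: "c x i \<in> G i" if "x \<in> carrier P" for x i
    unfolding c_def using that by (intro cmp_component t_closed P.cmp_carrier)
  have c_supp: "c x i = \<zero>" if "x \<in> carrier P" "P.cmp x i = \<zero>\<^bsub>P\<^esub>" for x i
    using that by (simp add: c_def t0 cmp_zero)
  define s where "s x = (\<Oplus>i\<in>{i. P.cmp x i \<noteq> \<zero>\<^bsub>P\<^esub>}. c x i)" for x
  have s_closed: "s x \<in> carrier A" if "x \<in> carrier P" for x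
    unfolding s_def using c_comp[OF that] component_carrier by (intro finsum_closed) blast
  have cmp_s: "cmp (s x) = c x" if "x \<in> carrier P" for x
    by (rule cmp_unique'[OF P.cmp_finite[OF that] c_comp[OF that]]) (use c_supp[OF that] in \<open>auto simp: s_def\<close>)
  have s_add: "s (x \<oplus>\<^bsub>P\<^esub> y) = s x \<oplus> s y" if "x \<in> carrier P" "y \<in> carrier P" for x y
  proof (rule cmp_ext)
    show "cmp (s (x \<oplus>\<^bsub>P\<^esub> y)) i = cmp (s x \<oplus> s y) i" for i
      using that s_closed t_closed P.cmp_carrier
      by (simp add: cmp_s cmp_add P.cmp_add t(2) c_def)
  qed (use that s_closed in auto)
  have s_smult_hom: "s (a \<odot>\<^bsub>P\<^esub> x) = a \<otimes> s x" if a: "a \<in> G k" and x: "x \<in> carrier P" for a x k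
  proof (rule cmp_ext)
    note aA = component_carrier[OF a]
    have ax: "a \<odot>\<^bsub>P\<^esub> x \<in> carrier P" using aA x by (rule P.smult_closed)
    show "cmp (s (a \<odot>\<^bsub>P\<^esub> x)) i = cmp (a \<otimes> s x) i" for i
    proof -
      have "P.cmp (a \<odot>\<^bsub>P\<^esub> x) (i - k + k) = a \<odot>\<^bsub>P\<^esub> P.cmp x (i - k)"
      proof (rule cmp_additive[OF P.graded_group_axioms P.graded_group_axioms _ _ _ x])
        show "(\<lambda>x. a \<odot>\<^bsub>P\<^esub> x) ` p i \<subseteq> p (i + k)" for i
          using deg[OF a] by (auto simp: add.commute)
      qed (use aA P.smult_closed P.smult_r_distr in auto)
      then have "cmp (s (a \<odot>\<^bsub>P\<^esub> x)) i = cmp (a \<otimes> t (P.cmp x (i - k))) (i - k + k)"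
        using ax aA x by (simp add: cmp_s c_def t(3) P.cmp_carrier)
      also have "\<dots> = a \<otimes> cmp (s x) (i - k)"
        using x by (subst cmp_left[OF a]) (simp_all add: cmp_s c_def t_closed P.cmp_carrier)
      also have "\<dots> = cmp (a \<otimes> s x) (i - k + k)"
        by (rule cmp_left[OF a s_closed[OF x], symmetric])
      finally show ?thesis by simp
    qed
  qed (use a x component_carrier s_closed P.smult_closed in auto)
  have s_smult: "s (a \<odot>\<^bsub>P\<^esub> x) = a \<otimes> s x" if "a \<in> carrier A" "x \<in> carrier P" for a x
    using that
  proof (induction rule: graded_induct)
    case (add a b)
    then show ?case
      using s_add[of "a \<odot>\<^bsub>P\<^esub> x" "b \<odot>\<^bsub>P\<^esub> x"] by (simp add: P.smult_l_distr P.smult_closed l_distr s_closed)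
  qed (rule s_smult_hom)
  have s_deg: "s x \<in> G i" if "x \<in> p i" for i x
  proof -
    have x: "x \<in> carrier P" using that by (rule P.component_carrier)
    have "cmp (s x) k = cmp (cmp (t x) i) k" for k
    proof -
      have "cmp (s x) k = c x k"
        using cmp_s[OF x] by (rule fun_cong)
      also have "\<dots> = (if k = i then cmp (t x) i else \<zero>)"
        unfolding c_def P.cmp_homogeneous[OF that] by (simp only: t0 cmp_zero split: if_split) simp
      also have "\<dots> = cmp (cmp (t x) i) k"
        using fun_cong[OF cmp_homogeneous[OF cmp_component[OF t_closed[OF x], of i]], of k] by (rule sym)
      finally show ?thesis .
    qed
    then have "s x = cmp (t x) i"
      by (rule cmp_ext[OF s_closed[OF x] cmp_carrier[OF t_closed[OF x]]])
    then show ?thesis using cmp_component[OF t_closed[OF x]] by simp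
  qed
  have s_\<epsilon>: "\<mm> +> s x = \<epsilon> x" if "x \<in> carrier P" for x
    using that
  proof (induction rule: P.graded_induct)
    case (homogeneous i x)
    note x = P.component_carrier[OF homogeneous]
    show ?case
    \<comment> \<open>Away from degree 0 both sides are the zero coset. In degree 0 the components
      of \<open>t x\<close> that were dropped lie in the augmentation ideal.\<close>
    proof (cases "i = 0")
      case False
      have "s x \<in> \<mm>"
        using s_deg[OF homogeneous] False component_aug[of i] component_negative[of i] aug.zero_closed
        by (cases "i < 0") auto
      then have "\<mm> +> s x = \<mm>"
        using s_closed[OF x] a_coset_join2[OF _ aug.a_subgroup] by simp
      then show ?thesis using component_triv[OF False \<epsilon>_deg[OF homogeneous]] by simp
    next
      case True
      have "s x = cmp (t x) 0"
      proof -
        have "s x = cmp (s x) 0"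
          using cmp_homogeneous[OF s_deg[OF homogeneous]] True by simp
        also have "\<dots> = cmp (t x) 0"
          using homogeneous True by (simp add: cmp_s[OF x] c_def P.cmp_homogeneous)
        finally show ?thesis .
      qed
      then have "t x \<ominus> s x \<in> \<mm>" using minus_cmp_aug[OF t_closed[OF x]] by simp
      then have "\<mm> +> t x = \<mm> +> s x"
        using coset_aug_iff[OF t_closed[OF x] s_closed[OF x]] by simp
      then show ?thesis using t(4)[OF x] by simp
    qed
  next
    case (add x y)
    have "\<epsilon> (x \<oplus>\<^bsub>P\<^esub> y) = \<epsilon> x \<oplus>\<^bsub>triv\<^esub> \<epsilon> y"
      using \<epsilon>_hom add by (auto simp: lmodule_hom_def)
    then show ?case
      using add s_add[of x y] triv_simps(3)[OF s_closed s_closed, of x y] by simp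
  qed
  show thesis
    by (rule that[of s]) (use s_closed s_add s_smult s_\<epsilon> s_deg in auto)
qed

end

section \<open>Right multiplication on Ext\<close>

context conn_graded
begin

lemma lmodule_hom_regular_iff:
  "\<phi> \<in> lmodule_hom A M (regular_module A) \<longleftrightarrow> \<phi> \<in> carrier M \<rightarrow>\<^sub>E carrier A \<and>
     (\<forall>x\<in>carrier M. \<forall>y\<in>carrier M. \<phi> (x \<oplus>\<^bsub>M\<^esub> y) = \<phi> x \<oplus> \<phi> y) \<and>
     (\<forall>a\<in>carrier A. \<forall>x\<in>carrier M. \<phi> (a \<odot>\<^bsub>M\<^esub> x) = a \<otimes> \<phi> x)"
  by (simp add: lmodule_hom_def)

lemma dual_simps:
  "carrier (dual_module A M) = lmodule_hom A M (regular_module A)"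
  "\<zero>\<^bsub>dual_module A M\<^esub> = (\<lambda>x\<in>carrier M. \<zero>)"
  "\<phi> \<oplus>\<^bsub>dual_module A M\<^esub> \<psi> = (\<lambda>x\<in>carrier M. \<phi> x \<oplus> \<psi> x)"
  "a \<odot>\<^bsub>dual_module A M\<^esub> \<phi> = (\<lambda>x\<in>carrier M. \<phi> x \<otimes> a)"
  by (simp_all add: dual_module_def module_of_def)

lemma graded_dual_simps:
  "\<zero>\<^bsub>graded_dual A G M h\<^esub> = \<zero>\<^bsub>dual_module A M\<^esub>"
  "\<phi> \<oplus>\<^bsub>graded_dual A G M h\<^esub> \<psi> = \<phi> \<oplus>\<^bsub>dual_module A M\<^esub> \<psi>"
  "a \<odot>\<^bsub>graded_dual A G M h\<^esub> \<phi> = a \<odot>\<^bsub>dual_module A M\<^esub> \<phi>"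
  by (simp_all add: graded_dual_def)

lemma dual_abelian_group:
  assumes "left_module A M"
  shows "abelian_group (dual_module A M)"
proof -
  interpret M: left_module A M by fact
  note hom = lmodule_hom_regular_iff
  have uminus: "(\<lambda>x\<in>carrier M. \<ominus> \<phi> x) \<in> lmodule_hom A M (regular_module A)"
    if "\<phi> \<in> lmodule_hom A M (regular_module A)" for \<phi>
    using that by (auto simp: hom PiE_iff M.smult_closed minus_add r_minus)
  show ?thesis
  proof (rule abelian_groupI)
    fix \<phi> assume \<phi>: "\<phi> \<in> carrier (dual_module A M)"
    then have \<phi>': "\<phi> \<in> lmodule_hom A M (regular_module A)" by (simp only: dual_simps)
    show "\<exists>\<psi>\<in>carrier (dual_module A M). \<psi> \<oplus>\<^bsub>dual_module A M\<^esub> \<phi> = \<zero>\<^bsub>dual_module A M\<^esub>"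
      unfolding dual_simps using uminus[OF \<phi>'] \<phi>'
      by (intro bexI[of _ "\<lambda>x\<in>carrier M. \<ominus> \<phi> x"])
        (auto simp: hom PiE_iff l_neg intro!: restrict_ext)
    show "\<zero>\<^bsub>dual_module A M\<^esub> \<oplus>\<^bsub>dual_module A M\<^esub> \<phi> = \<phi>"
      using \<phi>' by (auto simp: dual_simps hom PiE_iff extensional_def fun_eq_iff)
    fix \<psi> assume \<psi>: "\<psi> \<in> carrier (dual_module A M)"
    show "\<phi> \<oplus>\<^bsub>dual_module A M\<^esub> \<psi> \<in> carrier (dual_module A M)"
      using \<phi> \<psi> by (auto simp: dual_simps hom PiE_iff M.smult_closed r_distr a_ac)
    show "\<phi> \<oplus>\<^bsub>dual_module A M\<^esub> \<psi> = \<psi> \<oplus>\<^bsub>dual_module A M\<^esub> \<phi>"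
      using \<phi> \<psi> by (auto simp: dual_simps hom PiE_iff a_comm intro!: restrict_ext)
    fix \<chi> assume \<chi>: "\<chi> \<in> carrier (dual_module A M)"
    show "\<phi> \<oplus>\<^bsub>dual_module A M\<^esub> \<psi> \<oplus>\<^bsub>dual_module A M\<^esub> \<chi> = \<phi> \<oplus>\<^bsub>dual_module A M\<^esub> (\<psi> \<oplus>\<^bsub>dual_module A M\<^esub> \<chi>)"
      using \<phi> \<psi> \<chi> by (auto simp: dual_simps hom PiE_iff a_assoc intro!: restrict_ext)
  qed (auto simp: dual_simps hom M.smult_closed)
qed

context
  fixes M :: "('a, 'm) module" and h :: "int \<Rightarrow> 'm set"
  assumes graded: "graded_module A G M h"
begin

interpretation M: left_module A M
  using graded by (simp add: graded_module_def)

interpretation M: graded_group M h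
  using graded by unfold_locales (simp add: graded_module_def)

interpretation dual: abelian_group "dual_module A M"
  using M.left_module_axioms by (rule dual_abelian_group)

lemma dual_component_carrier: "dual_component A G M h j \<subseteq> carrier (dual_module A M)"
  by (auto simp: dual_component_def graded_hom_def dual_simps)

lemma subgroup_graded_dual: "subgroup (carrier (graded_dual A G M h)) (add_monoid (dual_module A M))"
  using dual_component_carrier by (auto simp: graded_dual_def intro!: dual.add.generate_is_subgroup)

lemma dual_component_subset: "dual_component A G M h j \<subseteq> carrier (graded_dual A G M h)"
  by (auto simp: graded_dual_def intro: generate.incl)

lemma graded_dual_hom: "\<phi> \<in> carrier (graded_dual A G M h) \<Longrightarrow> \<phi> \<in> lmodule_hom A M (regular_module A)"
  using subgroup.subset[OF subgroup_graded_dual] by (auto simp: dual_simps)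

lemma dual_smult_closed:
  assumes "\<phi> \<in> lmodule_hom A M (regular_module A)" "c \<in> carrier A"
  shows "c \<odot>\<^bsub>dual_module A M\<^esub> \<phi> \<in> lmodule_hom A M (regular_module A)"
  using assms by (auto simp: dual_simps lmodule_hom_regular_iff PiE_iff M.smult_closed l_distr m_assoc)

lemma dual_smult_add:
  assumes "\<phi> \<in> lmodule_hom A M (regular_module A)" "\<psi> \<in> lmodule_hom A M (regular_module A)" "c \<in> carrier A"
  shows "c \<odot>\<^bsub>dual_module A M\<^esub> (\<phi> \<oplus>\<^bsub>dual_module A M\<^esub> \<psi>) =
    c \<odot>\<^bsub>dual_module A M\<^esub> \<phi> \<oplus>\<^bsub>dual_module A M\<^esub> c \<odot>\<^bsub>dual_module A M\<^esub> \<psi>"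
  using assms by (auto simp: dual_simps lmodule_hom_regular_iff PiE_iff l_distr intro!: restrict_ext)

text \<open>Acting by \<open>c\<close> is additive and sends maps of degree \<open>j\<close> to maps
  of degree \<open>j + k\<close>. Hence the maps that stay in the graded dual form a subgroup
  containing the generators.\<close>

lemma graded_dual_smult:
  assumes c: "c \<in> G k" and \<phi>: "\<phi> \<in> carrier (graded_dual A G M h)"
  shows "c \<odot>\<^bsub>dual_module A M\<^esub> \<phi> \<in> carrier (graded_dual A G M h)"
proof -
  note cA = component_carrier[OF c]
  let ?S = "{\<phi> \<in> carrier (dual_module A M). c \<odot>\<^bsub>dual_module A M\<^esub> \<phi> \<in> carrier (graded_dual A G M h)}"
  note sub = subgroup_graded_dual
  have zero: "c \<odot>\<^bsub>dual_module A M\<^esub> \<zero>\<^bsub>dual_module A M\<^esub> = \<zero>\<^bsub>dual_module A M\<^esub>"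
    using cA by (auto simp: dual_simps intro!: restrict_ext)
  have "subgroup ?S (add_monoid (dual_module A M))"
  proof (rule dual.add.subgroupI)
    have "\<zero>\<^bsub>dual_module A M\<^esub> \<in> ?S"
      using subgroup.one_closed[OF sub] zero by simp
    then show "?S \<noteq> {}" by blast
  next
    fix \<phi> assume "\<phi> \<in> ?S"
    then have \<phi>: "\<phi> \<in> carrier (dual_module A M)" "c \<odot>\<^bsub>dual_module A M\<^esub> \<phi> \<in> carrier (graded_dual A G M h)" by auto
    let ?\<psi> = "\<ominus>\<^bsub>dual_module A M\<^esub> \<phi>"
    have \<psi>: "?\<psi> \<in> carrier (dual_module A M)" using \<phi>(1) by simp
    have "c \<odot>\<^bsub>dual_module A M\<^esub> ?\<psi> \<oplus>\<^bsub>dual_module A M\<^esub> c \<odot>\<^bsub>dual_module A M\<^esub> \<phi> = \<zero>\<^bsub>dual_module A M\<^esub>"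
      using dual_smult_add[of ?\<psi> \<phi> c] \<phi>(1) \<psi> cA dual.l_neg[OF \<phi>(1)] zero by (simp add: dual_simps(1))
    then have "\<ominus>\<^bsub>dual_module A M\<^esub> (c \<odot>\<^bsub>dual_module A M\<^esub> \<phi>) = c \<odot>\<^bsub>dual_module A M\<^esub> ?\<psi>"
      using dual_smult_closed \<phi>(1) \<psi> cA by (intro dual.minus_equality) (auto simp: dual_simps(1))
    then show "\<ominus>\<^bsub>dual_module A M\<^esub> \<phi> \<in> ?S"
      using subgroup.m_inv_closed[OF sub \<phi>(2)] \<psi> by (simp flip: a_inv_def)
  next
    fix \<phi> \<psi> assume "\<phi> \<in> ?S" "\<psi> \<in> ?S"
    then have \<phi>: "\<phi> \<in> carrier (dual_module A M)" "c \<odot>\<^bsub>dual_module A M\<^esub> \<phi> \<in> carrier (graded_dual A G M h)"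
      and \<psi>: "\<psi> \<in> carrier (dual_module A M)" "c \<odot>\<^bsub>dual_module A M\<^esub> \<psi> \<in> carrier (graded_dual A G M h)" by auto
    show "\<phi> \<oplus>\<^bsub>dual_module A M\<^esub> \<psi> \<in> ?S"
      using \<phi> \<psi> dual_smult_add[of \<phi> \<psi> c] subgroup.m_closed[OF sub \<phi>(2) \<psi>(2)] cA
        dual.a_closed[OF \<phi>(1) \<psi>(1)]
      by (simp add: dual_simps(1))
  qed blast
  moreover have "(\<Union>j. dual_component A G M h j) \<subseteq> ?S"
  proof
    fix \<phi> assume "\<phi> \<in> (\<Union>j. dual_component A G M h j)"
    then obtain j where \<phi>: "\<phi> \<in> dual_component A G M h j" by blast
    then have hom: "\<phi> \<in> lmodule_hom A M (regular_module A)" and deg: "\<And>i x. x \<in> h i \<Longrightarrow> \<phi> x \<in> G (i + j)"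
      by (auto simp: dual_component_def graded_hom_def)
    have "(c \<odot>\<^bsub>dual_module A M\<^esub> \<phi>) x \<in> G (i + (j + k))" if "x \<in> h i" for x i
      using component_mult[OF deg[OF that] c] M.component_carrier[OF that] by (simp add: dual_simps add.assoc)
    then have "c \<odot>\<^bsub>dual_module A M\<^esub> \<phi> \<in> dual_component A G M h (j + k)"
      using dual_smult_closed[OF hom cA] by (auto simp: dual_component_def graded_hom_def)
    then show "\<phi> \<in> ?S" using hom dual_component_subset by (auto simp: dual_simps(1))
  qed
  ultimately have "generate (add_monoid (dual_module A M)) (\<Union>j. dual_component A G M h j) \<subseteq> ?S"
    by (rule dual.add.generate_subgroup_incl[rotated])
  then show ?thesis using \<phi> by (auto simp: graded_dual_def)
qed

end

end

context conn_graded
begin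

text \<open>Over \<open>opposite A\<close> the action is multiplication by \<open>c\<close> on the
  right, and the product of anything with an element of the augmentation ideal stays in that
  ideal.\<close>

lemma trivial_opposite_smult:
  assumes U: "U \<in> carrier (trivial_module (opposite A) G)" and c: "c \<in> \<mm>"
  shows "c \<odot>\<^bsub>trivial_module (opposite A) G\<^esub> U = \<mm>"
proof -
  have aug: "augmentation_ideal (opposite A) G = \<mm>"
    by (simp add: augmentation_ideal_def opposite_def)
  have coset: "N +>\<^bsub>regular_module (opposite A)\<^esub> x = N +> x" for N x
    by (simp add: a_r_coset_def' regular_module_def module_of_def opposite_def)
  have op: "carrier (regular_module (opposite A)) = carrier A" "a \<odot>\<^bsub>regular_module (opposite A)\<^esub> x = x \<otimes> a" for a x
    by (simp_all add: regular_module_def module_of_def opposite_def)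
  obtain a where a: "a \<in> carrier A" "U = \<mm> +> a"
    using U by (auto simp: trivial_module_def quotient_module_def module_of_def A_RCOSETS_def' aug coset op)
  have "\<mm> +> (x \<otimes> c) = \<mm>" if "x \<in> U" for x
  proof -
    have "x \<in> carrier A" using that a_r_coset_subset_G[OF aug.a_subset a(1)] a(2) by blast
    then have "x \<otimes> c \<in> \<mm>" using c by (rule aug_left)
    then show ?thesis using aug_carrier a_coset_join2[OF _ aug.a_subgroup] by blast
  qed
  moreover have "a \<in> U" using aug.a_rcos_self[OF a(1)] a(2) by simp
  moreover have "c \<odot>\<^bsub>trivial_module (opposite A) G\<^esub> U = (\<Union>x\<in>U. \<mm> +> (x \<otimes> c))"
    by (simp add: trivial_module_def quotient_module_def module_of_def aug coset op)
  ultimately show ?thesis by blast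
qed

context
  fixes P :: "nat \<Rightarrow> ('a, 'm) module" and p :: "nat \<Rightarrow> int \<Rightarrow> 'm set" and \<delta> \<epsilon>
  assumes res: "graded_projective_resolution A G triv (trivial_grading A G) P p \<delta> \<epsilon>"
begin

lemma graded_P: "graded_module A G (P i) (p i)"
  using res by (simp add: graded_projective_resolution_def)

lemma \<delta>_hom: "\<delta> i \<in> lmodule_hom A (P (Suc i)) (P i)" "\<And>k x. x \<in> p (Suc i) k \<Longrightarrow> \<delta> i x \<in> p i k"
  using res by (fastforce simp: graded_projective_resolution_def graded_hom_def)+

lemma \<epsilon>_graded_hom: "\<epsilon> \<in> graded_hom 0 A (P 0) (p 0) triv (trivial_grading A G)"
  using res by (simp add: graded_projective_resolution_def)

lemma exact_0: "\<epsilon> ` carrier (P 0) = carrier triv" "\<delta> 0 ` carrier (P (Suc 0)) = {x \<in> carrier (P 0). \<epsilon> x = \<mm>}"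
  using res by (simp_all add: graded_projective_resolution_def projective_resolution_def triv_simps(2))

lemma \<delta>_closed: "x \<in> carrier (P (Suc i)) \<Longrightarrow> \<delta> i x \<in> carrier (P i)"
  using \<delta>_hom(1)[of i] by (auto simp: lmodule_hom_def)

lemma \<delta>_\<delta>: "x \<in> carrier (P (Suc (Suc i))) \<Longrightarrow> \<delta> i (\<delta> (Suc i) x) = \<zero>\<^bsub>P i\<^esub>"
  using res by (fastforce simp: graded_projective_resolution_def projective_resolution_def)

abbreviation D where "D i \<equiv> dual_module A (P i)"
abbreviation gD where "gD i \<equiv> carrier (graded_dual A G (P i) (p i))"
abbreviation B1 where "B1 \<equiv> coboundaries A G P p \<delta> (Suc 0)"
abbreviation Z1 where "Z1 \<equiv> cocycles A G P p \<delta> (Suc 0)"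
abbreviation Ext1 where "Ext1 \<equiv> Ext A G P p \<delta> (Suc 0)"

lemma abelian_group_D: "abelian_group (D i)"
  using graded_P by (intro dual_abelian_group) (simp add: graded_module_def)

lemma subgroup_gD: "subgroup (gD i) (add_monoid (D i))"
  using subgroup_graded_dual[OF graded_P] .

lemma gD_subset: "gD i \<subseteq> carrier (D i)"
  using subgroup.subset[OF subgroup_gD] by simp

lemma Z_subset: "Z1 \<subseteq> gD (Suc 0)"
  by (auto simp: cocycles_def)

lemma B_eq: "B1 = (\<lambda>\<phi>. \<lambda>x\<in>carrier (P (Suc 0)). \<phi> (\<delta> 0 x)) ` gD 0"
  by (simp add: coboundaries_def)

lemma subgroup_B: "subgroup B1 (add_monoid (D (Suc 0)))"
proof -
  interpret D0: abelian_group "D 0" by (rule abelian_group_D)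
  interpret D1: abelian_group "D (Suc 0)" by (rule abelian_group_D)
  interpret P1: left_module A "P (Suc 0)" using graded_P by (simp add: graded_module_def)
  have "group_hom (add_monoid (D 0)) (add_monoid (D (Suc 0))) (\<lambda>\<phi>. \<lambda>x\<in>carrier (P (Suc 0)). \<phi> (\<delta> 0 x))"
  proof (intro group_hom.intro group_hom_axioms.intro D0.a_group D1.a_group homI)
    fix \<phi> assume "\<phi> \<in> carrier (add_monoid (D 0))"
    then show "(\<lambda>x\<in>carrier (P (Suc 0)). \<phi> (\<delta> 0 x)) \<in> carrier (add_monoid (D (Suc 0)))"
      using \<delta>_hom(1)[of 0] \<delta>_closed[of _ 0]
      by (auto simp: dual_simps lmodule_hom_regular_iff lmodule_hom_def PiE_iff P1.smult_closed)
  qed (auto simp: dual_simps \<delta>_closed[of _ 0] intro!: restrict_ext)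
  from group_hom.subgroup_img_is_subgroup[OF this subgroup_gD] show ?thesis by (simp add: B_eq)
qed

lemma B_smult:
  assumes "c \<in> G k" "\<beta> \<in> B1"
  shows "c \<odot>\<^bsub>D (Suc 0)\<^esub> \<beta> \<in> B1"
proof -
  obtain \<phi> where \<phi>: "\<phi> \<in> gD 0" "\<beta> = (\<lambda>x\<in>carrier (P (Suc 0)). \<phi> (\<delta> 0 x))" using assms(2) by (auto simp: B_eq)
  have "c \<odot>\<^bsub>D (Suc 0)\<^esub> \<beta> = (\<lambda>x\<in>carrier (P (Suc 0)). (c \<odot>\<^bsub>D 0\<^esub> \<phi>) (\<delta> 0 x))"
    using \<delta>_closed[of _ 0] by (auto simp: \<phi> dual_simps intro!: restrict_ext)
  then show ?thesis using graded_dual_smult[OF graded_P assms(1) \<phi>(1)] by (auto simp: B_eq)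
qed

lemma Z_smult:
  assumes "c \<in> G k" "\<psi> \<in> Z1"
  shows "c \<odot>\<^bsub>D (Suc 0)\<^esub> \<psi> \<in> Z1"
  using assms graded_dual_smult[OF graded_P assms(1)] component_carrier \<delta>_closed[of _ "Suc 0"]
  by (auto simp: cocycles_def dual_simps)

lemma Ext_simps:
  "carrier Ext1 = (\<lambda>\<psi>. B1 +>\<^bsub>D (Suc 0)\<^esub> \<psi>) ` Z1" "\<zero>\<^bsub>Ext1\<^esub> = B1"
  "c \<odot>\<^bsub>Ext1\<^esub> U = (\<Union>\<psi>\<in>U. B1 +>\<^bsub>D (Suc 0)\<^esub> (c \<odot>\<^bsub>D (Suc 0)\<^esub> \<psi>))"
  by (auto simp: Ext_def quotient_module_def module_of_def A_RCOSETS_def' a_r_coset_def' graded_dual_simps)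

text \<open>The product is a union over the members of the coset. They all give the same coset,
  because \<open>c\<close> maps coboundaries to coboundaries.\<close>

lemma Ext_smult:
  assumes c: "c \<in> G k" and \<psi>: "\<psi> \<in> Z1"
  shows "c \<odot>\<^bsub>Ext1\<^esub> (B1 +>\<^bsub>D (Suc 0)\<^esub> \<psi>) = B1 +>\<^bsub>D (Suc 0)\<^esub> (c \<odot>\<^bsub>D (Suc 0)\<^esub> \<psi>)"
proof -
  interpret D: abelian_group "D (Suc 0)" by (rule abelian_group_D)
  note hom = subsetD[OF gD_subset, unfolded dual_simps(1)]
  have \<psi>': "\<psi> \<in> carrier (D (Suc 0))" "c \<odot>\<^bsub>D (Suc 0)\<^esub> \<psi> \<in> carrier (D (Suc 0))"
    using \<psi> Z_smult[OF c \<psi>] Z_subset gD_subset by blast+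
  have B1: "B1 \<subseteq> carrier (D (Suc 0))" using subgroup.subset[OF subgroup_B] by simp
  have "B1 +>\<^bsub>D (Suc 0)\<^esub> (c \<odot>\<^bsub>D (Suc 0)\<^esub> \<chi>) = B1 +>\<^bsub>D (Suc 0)\<^esub> (c \<odot>\<^bsub>D (Suc 0)\<^esub> \<psi>)" if \<chi>: "\<chi> \<in> B1 +>\<^bsub>D (Suc 0)\<^esub> \<psi>" for \<chi>
  proof -
    obtain \<beta> where \<beta>: "\<beta> \<in> B1" "\<chi> = \<beta> \<oplus>\<^bsub>D (Suc 0)\<^esub> \<psi>" using \<chi> by (auto simp: a_r_coset_def')
    have \<beta>': "c \<odot>\<^bsub>D (Suc 0)\<^esub> \<beta> \<in> B1" using B_smult[OF c \<beta>(1)] .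
    have "c \<odot>\<^bsub>D (Suc 0)\<^esub> \<chi> = c \<odot>\<^bsub>D (Suc 0)\<^esub> \<beta> \<oplus>\<^bsub>D (Suc 0)\<^esub> c \<odot>\<^bsub>D (Suc 0)\<^esub> \<psi>"
      unfolding \<beta>(2) using \<beta> \<psi>' B1 component_carrier[OF c]
      by (intro dual_smult_add[OF graded_P]) (auto simp flip: dual_simps(1))
    moreover have "(B1 +>\<^bsub>D (Suc 0)\<^esub> (c \<odot>\<^bsub>D (Suc 0)\<^esub> \<beta>)) +>\<^bsub>D (Suc 0)\<^esub> (c \<odot>\<^bsub>D (Suc 0)\<^esub> \<psi>) = B1 +>\<^bsub>D (Suc 0)\<^esub> (c \<odot>\<^bsub>D (Suc 0)\<^esub> \<beta> \<oplus>\<^bsub>D (Suc 0)\<^esub> c \<odot>\<^bsub>D (Suc 0)\<^esub> \<psi>)"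
      using B1 \<beta>' \<psi>'(2) by (intro D.a_coset_add_assoc) auto
    moreover have "B1 +>\<^bsub>D (Suc 0)\<^esub> (c \<odot>\<^bsub>D (Suc 0)\<^esub> \<beta>) = B1"
      using B1 \<beta>' subgroup_B by (intro D.a_coset_join2) auto
    ultimately show ?thesis by simp
  qed
  moreover have "\<psi> \<in> B1 +>\<^bsub>D (Suc 0)\<^esub> \<psi>"
    using D.a_rcosI[OF _ B1, of "\<zero>\<^bsub>D (Suc 0)\<^esub>" \<psi>] subgroup.one_closed[OF subgroup_B] \<psi>' by simp
  ultimately show ?thesis unfolding Ext_simps by blast
qed

text \<open>The first Ext group is 0 if \<open>d\<close> is not 1 and a shift of the trivial right
  module if \<open>d\<close> is 1. Either way elements of degree 1 annihilate it, and a cocycle of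
  class 0 is a coboundary.\<close>

lemma cocycle_smult_coboundary:
  assumes vanish: "\<And>i. i \<noteq> d \<Longrightarrow> carrier (Ext A G P p \<delta> i) = {\<zero>\<^bsub>Ext A G P p \<delta> i\<^esub>}"
    and iso: "graded_iso (opposite A) (Ext A G P p \<delta> d) (Ext_grading A G P p \<delta> d)
      (trivial_module (opposite A) G) (shift (trivial_grading (opposite A) G) l)"
    and c: "c \<in> G 1" and \<psi>: "\<psi> \<in> Z1"
  shows "c \<odot>\<^bsub>D (Suc 0)\<^esub> \<psi> \<in> B1"
proof -
  interpret D: abelian_group "D (Suc 0)" by (rule abelian_group_D)
  have \<psi>': "\<psi> \<in> carrier (D (Suc 0))" "c \<odot>\<^bsub>D (Suc 0)\<^esub> \<psi> \<in> carrier (D (Suc 0))"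
    using \<psi> Z_smult[OF c \<psi>] Z_subset gD_subset by blast+
  have "B1 +>\<^bsub>D (Suc 0)\<^esub> (c \<odot>\<^bsub>D (Suc 0)\<^esub> \<psi>) = B1"
  proof (cases "d = Suc 0")
    case False
    then have "carrier Ext1 = {B1}" using vanish[of "Suc 0"] by (simp add: Ext_simps(2))
    then show ?thesis using Z_smult[OF c \<psi>] by (auto simp: Ext_simps(1))
  next
    case True
    obtain f where f: "f \<in> lmodule_hom (opposite A) Ext1 (trivial_module (opposite A) G)"
      and inj: "inj_on f (carrier Ext1)"
      using iso True by (auto simp: graded_iso_def bij_betw_def)
    have E: "B1 +>\<^bsub>D (Suc 0)\<^esub> \<psi> \<in> carrier Ext1" using \<psi> by (simp add: Ext_simps(1))
    have *: "f (B1 +>\<^bsub>D (Suc 0)\<^esub> (a \<odot>\<^bsub>D (Suc 0)\<^esub> \<psi>)) = \<mm>" "B1 +>\<^bsub>D (Suc 0)\<^esub> (a \<odot>\<^bsub>D (Suc 0)\<^esub> \<psi>) \<in> carrier Ext1" if a: "a \<in> G 1" for a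
    proof -
      have "f (a \<odot>\<^bsub>Ext1\<^esub> (B1 +>\<^bsub>D (Suc 0)\<^esub> \<psi>)) = a \<odot>\<^bsub>trivial_module (opposite A) G\<^esub> f (B1 +>\<^bsub>D (Suc 0)\<^esub> \<psi>)"
        using f E component_carrier[OF a] by (auto simp: lmodule_hom_def opposite_def)
      also have "\<dots> = \<mm>"
        using f E a component_aug[of 1] by (intro trivial_opposite_smult) (auto simp: lmodule_hom_def)
      finally show "f (B1 +>\<^bsub>D (Suc 0)\<^esub> (a \<odot>\<^bsub>D (Suc 0)\<^esub> \<psi>)) = \<mm>" by (simp add: Ext_smult[OF a \<psi>])
      show "B1 +>\<^bsub>D (Suc 0)\<^esub> (a \<odot>\<^bsub>D (Suc 0)\<^esub> \<psi>) \<in> carrier Ext1" using Z_smult[OF a \<psi>] by (simp add: Ext_simps(1))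
    qed
    \<comment> \<open>The zero element also belongs to \<open>G 1\<close>, so both classes have the
      same image under the injective map \<open>f\<close>.\<close>
    have "B1 +>\<^bsub>D (Suc 0)\<^esub> (c \<odot>\<^bsub>D (Suc 0)\<^esub> \<psi>) = B1 +>\<^bsub>D (Suc 0)\<^esub> (\<zero> \<odot>\<^bsub>D (Suc 0)\<^esub> \<psi>)"
      using *[OF c] *[OF component_zero] inj by (simp add: inj_on_def)
    also have "\<zero> \<odot>\<^bsub>D (Suc 0)\<^esub> \<psi> = \<zero>\<^bsub>D (Suc 0)\<^esub>"
      using \<psi>'(1) by (auto simp: dual_simps lmodule_hom_regular_iff PiE_iff intro!: restrict_ext)
    also have "B1 +>\<^bsub>D (Suc 0)\<^esub> \<zero>\<^bsub>D (Suc 0)\<^esub> = B1"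
      using subgroup_B subgroup.one_closed[OF subgroup_B] by (intro D.a_coset_join2) auto
    finally show ?thesis .
  qed
  then show ?thesis
    using D.a_coset_join1[OF _ \<psi>'(2) subgroup_B] by blast
qed

end

end

context conn_graded
begin

text \<open>If \<open>\<phi>\<close> is left linear on the augmentation ideal, it represents a class in \<open>Ext\<^sup>1\<close>.  By the
  Gorenstein condition \<open>Ext\<^sup>1\<close> is zero or one-dimensional, so elements of positive degree annihilate it:
  \<open>\<phi>\<close> followed by right multiplication with such an element extends to a linear map on \<open>A\<close>, which is
  right multiplication by some \<open>w\<close>.\<close>

lemma AS_Gorenstein_extension:
  assumes gorenstein: "AS_Gorenstein A G d"
    and \<phi>: "\<phi> \<in> carrier A \<rightarrow> carrier A"
      "\<And>x y. x \<in> carrier A \<Longrightarrow> y \<in> carrier A \<Longrightarrow> \<phi> (x \<oplus> y) = \<phi> x \<oplus> \<phi> y"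
      "\<And>a x. a \<in> carrier A \<Longrightarrow> x \<in> \<mm> \<Longrightarrow> \<phi> (a \<otimes> x) = a \<otimes> \<phi> x"
      "\<And>i. \<phi> ` G i \<subseteq> G (i + j)"
    and c: "c \<in> G 1"
  shows "\<exists>w\<in>carrier A. \<forall>a\<in>\<mm>. \<phi> a \<otimes> c = a \<otimes> w"
proof -
  obtain P :: "nat \<Rightarrow> ('a, 'a list set) module" and p \<delta> \<epsilon> l
    where res: "graded_projective_resolution A G triv (trivial_grading A G) P p \<delta> \<epsilon>"
      and "\<forall>i. i \<noteq> d \<longrightarrow> carrier (Ext A G P p \<delta> i) = {\<zero>\<^bsub>Ext A G P p \<delta> i\<^esub>}"
      and iso: "graded_iso (opposite A) (Ext A G P p \<delta> d) (Ext_grading A G P p \<delta> d)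
        (trivial_module (opposite A) G) (shift (trivial_grading (opposite A) G) l)"
    using gorenstein unfolding AS_Gorenstein_def by (elim exE conjE) (rule that)
  then have vanish: "carrier (Ext A G P p \<delta> i) = {\<zero>\<^bsub>Ext A G P p \<delta> i\<^esub>}" if "i \<noteq> d" for i
    using that by simp
  have proj: "projective_module A (P 0)"
    using res by (simp add: graded_projective_resolution_def projective_resolution_def)
  obtain s where s: "s \<in> carrier (P 0) \<rightarrow> carrier A"
    "\<And>x y. x \<in> carrier (P 0) \<Longrightarrow> y \<in> carrier (P 0) \<Longrightarrow> s (x \<oplus>\<^bsub>P 0\<^esub> y) = s x \<oplus> s y"
    "\<And>a x. a \<in> carrier A \<Longrightarrow> x \<in> carrier (P 0) \<Longrightarrow> s (a \<odot>\<^bsub>P 0\<^esub> x) = a \<otimes> s x"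
    "\<And>x. x \<in> carrier (P 0) \<Longrightarrow> \<mm> +> s x = \<epsilon> x"
    "\<And>i x. x \<in> p 0 i \<Longrightarrow> s x \<in> G i"
    by (rule graded_projective_lift[OF proj graded_P[OF res] \<epsilon>_graded_hom[OF res]]) blast
  interpret P0: left_module A "P 0" using graded_P[OF res] by (simp add: graded_module_def)
  interpret P1: left_module A "P (Suc 0)" using graded_P[OF res] by (simp add: graded_module_def)
  interpret P0: graded_group "P 0" "p 0"
    using graded_P[OF res] by unfold_locales (simp add: graded_module_def)
  interpret P1: graded_group "P (Suc 0)" "p (Suc 0)"
    using graded_P[OF res] by unfold_locales (simp add: graded_module_def)
  note \<delta>c = \<delta>_closed[OF res, of _ 0]
  have sc: "s x \<in> carrier A" if "x \<in> carrier (P 0)" for x using s(1) that by auto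
  have s_aug: "s x \<in> \<mm>" if "x \<in> carrier (P 0)" "\<epsilon> x = \<mm>" for x
    using a_coset_join1[OF _ sc aug.a_subgroup] s(4) that by simp
  have \<delta>_ker: "\<epsilon> (\<delta> 0 x) = \<mm>" if "x \<in> carrier (P (Suc 0))" for x
    using exact_0(2)[OF res] that by auto
  \<comment> \<open>The image of \<open>\<delta> 0\<close> is the kernel of \<epsilon>, which
    \<open>s\<close> carries into the augmentation ideal, where \<phi> is linear. So \<psi> is the
    cocycle that represents the class of \<phi> in the given resolution.\<close>
  define \<psi> where "\<psi> = (\<lambda>x\<in>carrier (P (Suc 0)). \<phi> (s (\<delta> 0 x)))"
  have \<delta>_lin: "\<delta> 0 (x \<oplus>\<^bsub>P (Suc 0)\<^esub> y) = \<delta> 0 x \<oplus>\<^bsub>P 0\<^esub> \<delta> 0 y" "a \<in> carrier A \<Longrightarrow> \<delta> 0 (a \<odot>\<^bsub>P (Suc 0)\<^esub> x) = a \<odot>\<^bsub>P 0\<^esub> \<delta> 0 x"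
    if "x \<in> carrier (P (Suc 0))" "y \<in> carrier (P (Suc 0))" for x y a
    using \<delta>_hom(1)[OF res, of 0] that by (auto simp: lmodule_hom_def)
  have \<psi>_hom: "\<psi> \<in> lmodule_hom A (P (Suc 0)) (regular_module A)"
    using \<phi>(1) sc s_aug \<delta>_ker \<delta>_lin(2)
    by (auto simp: lmodule_hom_regular_iff \<psi>_def P1.smult_closed \<delta>_lin(1) \<delta>c s(2,3) \<phi>(2,3))
  have "\<psi> x \<in> G (i + j)" if "x \<in> p (Suc 0) i" for x i
    using s(5)[OF \<delta>_hom(2)[OF res that]] \<phi>(4)[of i] P1.component_carrier[OF that] by (auto simp: \<psi>_def)
  then have "\<psi> \<in> dual_component A G (P (Suc 0)) (p (Suc 0)) j"
    using \<psi>_hom by (auto simp: dual_component_def graded_hom_def)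
  then have \<psi>_gD: "\<psi> \<in> carrier (graded_dual A G (P (Suc 0)) (p (Suc 0)))"
    using dual_component_subset[OF graded_P[OF res]] by blast
  have s0: "s \<zero>\<^bsub>P 0\<^esub> = \<zero>"
    by (rule additive_zero[OF P0.M.abelian_group_axioms abelian_group_axioms s(2,1)])
  have \<phi>0: "\<phi> \<zero> = \<zero>"
    by (rule additive_zero[OF abelian_group_axioms abelian_group_axioms \<phi>(2,1)])
  have "\<psi> (\<delta> (Suc 0) x) = \<zero>" if "x \<in> carrier (P (Suc (Suc 0)))" for x
    using \<delta>_closed[OF res that] \<delta>_\<delta>[OF res that] by (simp add: \<psi>_def s0 \<phi>0)
  then have "\<psi> \<in> cocycles A G P p \<delta> (Suc 0)"
    using \<psi>_gD by (simp add: cocycles_def)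
  from cocycle_smult_coboundary[OF res vanish iso c this]
  obtain \<eta> where \<eta>: "\<eta> \<in> carrier (graded_dual A G (P 0) (p 0))"
    "c \<odot>\<^bsub>dual_module A (P (Suc 0))\<^esub> \<psi> = (\<lambda>x\<in>carrier (P (Suc 0)). \<eta> (\<delta> 0 x))"
    by (auto simp: B_eq[OF res])
  have \<eta>_hom: "\<eta> \<in> lmodule_hom A (P 0) (regular_module A)"
    using graded_dual_hom[OF graded_P[OF res] \<eta>(1)] .
  have \<eta>_\<delta>: "\<phi> (s (\<delta> 0 x)) \<otimes> c = \<eta> (\<delta> 0 x)" if "x \<in> carrier (P (Suc 0))" for x
    using fun_cong[OF \<eta>(2), of x] that by (simp add: dual_simps \<psi>_def)
  have "\<mm> +> \<one> \<in> carrier triv" by (simp add: triv_simps)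
  then obtain q where q: "q \<in> carrier (P 0)" "\<epsilon> q = \<mm> +> \<one>"
    using exact_0(1)[OF res] by (metis imageE)
  \<comment> \<open>For \<open>q\<close> itself \<open>s q\<close> is 1 only modulo the augmentation
    ideal. Since \<open>s\<close> preserves degrees, the degree-zero component is sent to 1
    exactly.\<close>
  define q0 where "q0 = P0.cmp q 0"
  have q0: "q0 \<in> carrier (P 0)" unfolding q0_def using q(1) by (rule P0.cmp_carrier)
  have s_q0: "s q0 = \<one>"
  proof -
    have "s q \<ominus> \<one> \<in> \<mm>"
      using s(4)[OF q(1)] q(2) coset_aug_iff[OF sc[OF q(1)] one_closed] by simp
    then have "cmp (s q \<oplus> \<ominus> \<one>) 0 = \<zero>" unfolding aug_ideal_eq a_minus_def by blast
    then have "cmp (s q) 0 \<oplus> \<ominus> cmp \<one> 0 = \<zero>"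
      using sc[OF q(1)] by (simp only: cmp_add cmp_uminus a_inv_closed one_closed)
    moreover have "cmp \<one> 0 = \<one>" by (simp add: cmp_homogeneous[OF one_component])
    ultimately have "cmp (s q) 0 \<ominus> \<one> = \<zero>" by (simp add: a_minus_def)
    then have "cmp (s q) 0 = \<one>" using cmp_carrier[OF sc[OF q(1)]] by simp
    moreover have "cmp (s q) (0 + 0) = s (P0.cmp q 0)"
      by (rule cmp_additive[OF P0.graded_group_axioms graded_group_axioms s(2,1) _ q(1)]) (use s(5) in auto)
    ultimately show ?thesis by (simp add: q0_def)
  qed
  \<comment> \<open>The element \<open>a q0\<close> lies in the kernel of \<epsilon>, hence is a
    boundary, and \<open>s\<close> sends it back to \<open>a\<close>.\<close>
  have "\<phi> a \<otimes> c = a \<otimes> \<eta> q0" if a: "a \<in> \<mm>" for a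
  proof -
    have aA: "a \<in> carrier A" using a by (rule aug_carrier)
    have aq: "a \<odot>\<^bsub>P 0\<^esub> q0 \<in> carrier (P 0)" using aA q0 by (rule P0.smult_closed)
    have s_aq: "s (a \<odot>\<^bsub>P 0\<^esub> q0) = a" using aA q0 by (simp add: s(3) s_q0)
    have "\<epsilon> (a \<odot>\<^bsub>P 0\<^esub> q0) = \<mm>"
      using s(4)[OF aq] a_coset_join2[OF aA aug.a_subgroup a] by (simp add: s_aq)
    then have "a \<odot>\<^bsub>P 0\<^esub> q0 \<in> \<delta> 0 ` carrier (P (Suc 0))"
      using exact_0(2)[OF res] aq by simp
    then obtain x where "x \<in> carrier (P (Suc 0))" "\<delta> 0 x = a \<odot>\<^bsub>P 0\<^esub> q0" by (metis imageE)
    then have "\<phi> a \<otimes> c = \<eta> (a \<odot>\<^bsub>P 0\<^esub> q0)" using \<eta>_\<delta>[of x] by (simp add: s_aq)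
    also have "\<dots> = a \<otimes> \<eta> q0" using \<eta>_hom aA q0 by (simp add: lmodule_hom_regular_iff)
    finally show ?thesis .
  qed
  moreover have "\<eta> q0 \<in> carrier A" using \<eta>_hom q0 by (auto simp: lmodule_hom_regular_iff)
  ultimately show ?thesis by blast
qed

end

section \<open>The obstruction\<close>

text \<open>The last letter is replaced by words of length \<open>k\<close>, so degrees shift by
  \<open>k - 1\<close>, taken in the integers.\<close>

lemma phi_degree:
  assumes f: "\<forall>w\<in>keys f. int (length w) = i" and k: "\<forall>w\<in>keys u \<union> keys v. length w = k"
    and w: "w \<in> keys (phi u v f)"
  shows "int (length w) = i + (int k - 1)"
proof -
  have "keys (phi u v f) \<subseteq> (\<Union>y\<in>keys f. keys (Poly_Mapping.single [] (lookup f y) * phi_mon u v y))"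
    unfolding phi_def by (rule keys_sum)
  then obtain y where y: "y \<in> keys f" "w \<in> keys (Poly_Mapping.single [] (lookup f y) * phi_mon u v y)"
    using w by blast
  let ?z = "if last y = Lx then u else v"
  have "y \<noteq> []" using y(2) by (auto simp: phi_mon_def)
  then have "w \<in> keys (Poly_Mapping.single (butlast y) (lookup f y) * ?z)"
    using y(2) by (simp add: phi_mon_def single_mult flip: mult.assoc)
  then obtain z where "z \<in> keys u \<union> keys v" "w = butlast y @ z"
    using keys_mult[of "Poly_Mapping.single (butlast y) (lookup f y)" ?z]
    by (fastforce simp: plus_list_def split: if_splits)
  then show ?thesis using f k y(1) \<open>y \<noteq> []\<close> by (cases y) auto
qed

context reduced_basis
begin

abbreviation proj ("\<pi>") where "\<pi> f \<equiv> I +>\<^bsub>free_ring\<^esub> f"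

text \<open>\<open>phi u v\<close> descends to the quotient because it preserves \<open>I\<close>.
  Regularity would make its product with \<open>x\<close> on the right equal to right multiplication
  by the class of some \<open>g\<close>; evaluating at \<open>x\<close> and at \<open>y\<close>
  gives the two memberships that an obstruction rules out.\<close>

lemma obstruction_not_AS_regular:
  assumes obs: "obstruction u v"
  shows "\<not> AS_regular (free_ring Quot I) (total_degree_grading I) d"
proof
  let ?A = "free_ring Quot I" and ?G = "total_degree_grading I"
  assume regular: "AS_regular ?A ?G d"
  interpret A: conn_graded ?A ?G
    using regular by unfold_locales (simp add: AS_regular_def)
  note Q = Quot_simps[OF two_sided] and iff = coset_eq_iff[OF two_sided]
  obtain k where phi_I: "\<And>f. f \<in> I \<Longrightarrow> phi u v f \<in> I" and k: "\<forall>w\<in>keys u \<union> keys v. length w = k"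
    and not_ext: "\<And>g. \<not> (u * mon [Lx] - mon [Lx] * g \<in> I \<and> v * mon [Lx] - mon [Ly] * g \<in> I)"
    using obs unfolding obstruction_def by blast
  \<comment> \<open>An arbitrary representative is chosen; the next fact shows that the choice does
    not matter.\<close>
  define \<phi> where "\<phi> U = \<pi> (phi u v (SOME f. U = \<pi> f))" for U
  have \<phi>: "\<phi> (\<pi> f) = \<pi> (phi u v f)" for f
  proof -
    have "\<pi> f = \<pi> (SOME g. \<pi> f = \<pi> g)" by (rule someI[of _ f]) simp
    then have "phi u v (f - (SOME g. \<pi> f = \<pi> g)) \<in> I" using phi_I by (simp only: iff)
    then have "\<pi> (phi u v f) = \<pi> (phi u v (SOME g. \<pi> f = \<pi> g))" by (simp only: iff phi_diff)
    then show ?thesis by (simp add: \<phi>_def)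
  qed
  have aug: "augmentation_ideal ?A ?G \<subseteq> \<pi> ` aug"
  proof -
    have "subgroup (\<pi> ` aug) (add_monoid ?A)"
    proof (rule A.add.subgroupI)
      show "\<pi> ` aug \<noteq> {}" by (auto simp: aug_def intro!: exI[of _ 0])
    next
      fix U assume "U \<in> \<pi> ` aug"
      then obtain f where f: "f \<in> aug" "U = \<pi> f" by blast
      then have "\<ominus>\<^bsub>?A\<^esub> U = \<pi> (- f)" by (intro A.minus_equality) (auto simp: Q)
      moreover have "- f \<in> aug" using f(1) by (simp add: aug_def)
      ultimately show "\<ominus>\<^bsub>?A\<^esub> U \<in> \<pi> ` aug" by blast
    next
      fix U V assume "U \<in> \<pi> ` aug" "V \<in> \<pi> ` aug"
      then obtain f g where f: "f \<in> aug" "U = \<pi> f" "g \<in> aug" "V = \<pi> g" by blast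
      then have "f + g \<in> aug" by (simp add: aug_def lookup_add)
      then show "U \<oplus>\<^bsub>?A\<^esub> V \<in> \<pi> ` aug" using f by (simp add: Q)
    qed (auto simp: Q)
    moreover have "(\<Union>i\<in>{0<..}. ?G i) \<subseteq> \<pi> ` aug"
    proof
      fix U assume "U \<in> (\<Union>i\<in>{0<..}. ?G i)"
      then obtain i f where f: "i > 0" "U = \<pi> f" "\<forall>w\<in>keys f. int (length w) = i"
        by (auto simp: total_degree_grading_def)
      then have "[] \<notin> keys f" by fastforce
      then show "U \<in> \<pi> ` aug" using f(2) by (auto simp: aug_def in_keys_iff)
    qed
    ultimately show ?thesis
      unfolding augmentation_ideal_def by (rule A.add.generate_subgroup_incl[rotated])
  qed
  have letter: "\<pi> (mon [l]) \<in> ?G 1" for l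
    by (auto simp: total_degree_grading_def)
  have "\<exists>w\<in>carrier ?A. \<forall>a\<in>augmentation_ideal ?A ?G. \<phi> a \<otimes>\<^bsub>?A\<^esub> \<pi> (mon [Lx]) = a \<otimes>\<^bsub>?A\<^esub> w"
  proof (rule A.AS_Gorenstein_extension[where j = "int k - 1"])
    show "AS_Gorenstein ?A ?G d" using regular by (simp add: AS_regular_def)
    show "\<phi> \<in> carrier ?A \<rightarrow> carrier ?A" by (auto simp: Q \<phi>)
    show "\<phi> (x \<oplus>\<^bsub>?A\<^esub> y) = \<phi> x \<oplus>\<^bsub>?A\<^esub> \<phi> y" if "x \<in> carrier ?A" "y \<in> carrier ?A" for x y
      using that by (auto simp: Q \<phi> phi_add)
    show "\<phi> (a \<otimes>\<^bsub>?A\<^esub> x) = a \<otimes>\<^bsub>?A\<^esub> \<phi> x" if a: "a \<in> carrier ?A" and x: "x \<in> augmentation_ideal ?A ?G" for a x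
    proof -
      obtain g where "a = \<pi> g" using a by (auto simp: Q)
      moreover obtain f where "f \<in> aug" "x = \<pi> f" using x aug by blast
      ultimately show ?thesis by (simp add: Q \<phi> phi_left)
    qed
    show "\<phi> ` ?G i \<subseteq> ?G (i + (int k - 1))" for i
    proof
      fix U assume "U \<in> \<phi> ` ?G i"
      then obtain f where f: "U = \<pi> (phi u v f)" "\<forall>w\<in>keys f. int (length w) = i"
        by (auto simp: total_degree_grading_def \<phi>)
      then show "U \<in> ?G (i + (int k - 1))"
        using phi_degree[OF f(2) k] by (auto simp: total_degree_grading_def)
    qed
  qed (rule letter)
  then obtain g where g: "\<And>a. a \<in> augmentation_ideal ?A ?G \<Longrightarrow> \<phi> a \<otimes>\<^bsub>?A\<^esub> \<pi> (mon [Lx]) = a \<otimes>\<^bsub>?A\<^esub> \<pi> g"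
    by (auto simp: Q)
  have "\<pi> (mon [l]) \<in> augmentation_ideal ?A ?G" for l
    using A.component_aug[of 1] letter by auto
  from g[OF this] have "phi u v (mon [l]) * mon [Lx] - mon [l] * g \<in> I" for l
    by (simp add: Q \<phi> iff)
  from this[of Lx] this[of Ly] show False
    using not_ext by (simp add: phi_single phi_mon_def flip: one_eq_mon)
qed

end

theorem proposition8p1:
  shows "\<not> (\<exists>J. AS_regular_deformation (F6_ideal :: ('k::field) free_alg set) J)"
proof
  assume "\<exists>J. AS_regular_deformation (F6_ideal :: 'k free_alg set) J"
  then obtain J where J: "AS_regular_deformation (F6_ideal :: 'k free_alg set) J" ..
  interpret reduced_basis "general_fibre J" by (rule general_fibre_reduced_basis[OF J])
  obtain u v where "obstruction u v" using obstruction_exists by blast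
  then show False
    using J obstruction_not_AS_regular by (auto simp: AS_regular_deformation_def bigraded_AS_regular_def)
qed

end
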